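(* Let $X=\{X(t)\}$ be a supOU process with characteristic quadruple $(a,b,\mu_L,\pi)$, finite nonzero variance and zero mean, such that the cumulant function $\kappa_X(\zeta)=\log\mathbb{E}e^{i\zeta X(1)}$ is analytic in a neighborhood of the origin, and let $X^*(t)=\int_0^t X(s)\,ds$, $t\ge 0$. Suppose that $$\pi((0,x])\sim\ell(x^{-1})\,x^\alpha\quad\text{as }x\to0$$ for some integer $\alpha>1$ and some function $\ell$ slowly varying at infinity. For $q>0$ let $$\tau_{X^*}(q)=\lim_{t\to\infty}\frac{\log\mathbb{E}|X^*(t)|^q}{\log t}.$$ If $\mu_L\not\equiv0$, then the limit exists for every $q>0$ and $$\tau_{X^*}(q)=\begin{cases}\frac12q,&0<q\le2\alpha,\\ q-\alpha,&q\ge2\alpha.\end{cases}$$ If $\mu_L\equiv0$, then $X^*$ is Gaussian and $\tau_{X^*}(q)=\frac12q$ for all $q>0$.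
   Context: SupOU process: let $\pi$ be a probability measure on $\mathbb{R}_+=(0,\infty)$ and let $\kappa_L(\zeta)=\log \mathbb{E}e^{i\zeta L(1)}$ be the cumulant function of an infinitely divisible random variable $L(1)$ with Lévy–Khintchine triplet $(a,b,\mu_L)$: $\kappa_L(\zeta)=i\zeta a-\frac{\zeta^2}{2}b+\int_{\mathbb{R}}(e^{i\zeta x}-1-i\zeta x\mathbf{1}_{[-1,1]}(x))\mu_L(dx)$. Let $\Lambda$ be the homogeneous Lévy basis (independently scattered infinitely divisible random measure) on $\mathbb{R}_+\times\mathbb{R}$ with $\log\mathbb{E}e^{i\zeta\Lambda(A)}=(\pi\times \mathrm{Leb})(A)\,\kappa_L(\zeta)$ for Borel sets $A$ (of finite measure). The supOU process with characteristic quadruple $(a,b,\mu_L,\pi)$ is the strictly stationary process $$X(t)=\int_{\mathbb{R}_+}\int_{\mathbb{R}}e^{-\xi t+s}\mathbf{1}_{[0,\infty)}(\xi t-s)\,\Lambda(d\xi,ds),\quad t\in\mathbb{R},$$ where the stochastic integral is in the sense of Rajput–Rosiński: for $\Lambda$-integrable $f$, $\log\mathbb{E}\exp(i\zeta\int f\,d\Lambda)=\int\int\kappa_L(\zeta f(\xi,s))\,ds\,\pi(d\xi)$. Under zero mean and finite variance of $X$, $\int x^2\mu_L(dx)<\infty$, $\mathbb{E}L(1)=0$ and $\kappa_L(\zeta)=-\frac{\zeta^2}{2}b+\int_{\mathbb{R}}(e^{i\zeta x}-1-i\zeta x)\mu_L(dx)$. Analyticity of $\kappa_X$ near the origin is equivalent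 to exponential decay of the tails of the distribution of $X(1)$; in particular all moments are finite. *)

theory Defs
  imports "HOL-Probability.Probability" "HOL-Library.Landau_Symbols"
begin

section \<open>Cumulant functions and Levy-Khintchine triplets\<close>

text \<open>
  The logarithm of the characteristic function is the distinguished one: the (necessarily unique)
  continuous function that vanishes at the origin and whose exponential is the
  characteristic function.
\<close>

definition is_cumulant_function :: "'w measure \<Rightarrow> ('w \<Rightarrow> real) \<Rightarrow> (real \<Rightarrow> complex) \<Rightarrow> bool" where
  "is_cumulant_function M Y \<kappa> \<longleftrightarrow>
     continuous_on UNIV \<kappa> \<and> \<kappa> 0 = 0 \<and> (\<forall>\<zeta>. char (distr M borel Y) \<zeta> = exp (\<kappa> \<zeta>))"

text \<open>
  For a function of a real variable, analyticity near the origin means being given there by a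
  convergent power series, i.e. extending to a holomorphic function on a complex neighbourhood.
\<close>

definition analytic_near_zero :: "(real \<Rightarrow> complex) \<Rightarrow> bool" where
  "analytic_near_zero \<kappa> \<longleftrightarrow>
     (\<exists>g. g analytic_on {0} \<and> (\<forall>\<^sub>F \<zeta> in nhds 0. \<kappa> \<zeta> = g (complex_of_real \<zeta>)))"

definition levy_triplet :: "real \<Rightarrow> real \<Rightarrow> real measure \<Rightarrow> bool" where
  "levy_triplet a b \<mu> \<longleftrightarrow>
     b \<ge> 0 \<and> sets \<mu> = sets borel \<and> emeasure \<mu> {0} = 0 \<and> integrable \<mu> (\<lambda>x. min 1 (x\<^sup>2))"

definition levy_khintchine :: "real \<Rightarrow> real \<Rightarrow> real measure \<Rightarrow> real \<Rightarrow> complex" where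
  "levy_khintchine a b \<mu> \<zeta> =
     \<i> * of_real (\<zeta> * a) - of_real (\<zeta>\<^sup>2 / 2 * b)
     + (CLINT x|\<mu>. iexp (\<zeta> * x) - 1 - \<i> * of_real (\<zeta> * x * indicator {-1..1} x))"


section \<open>Homogeneous Levy bases and Rajput--Rosinski integration\<close>

text \<open>
  A Levy basis is indexed by the measurable sets of finite measure; its values on other sets are
  irrelevant. Infinite divisibility of the values is part of the prescribed cumulant functions
  when \<open>\<kappa>\<close> is of Levy-Khintchine form.
\<close>

definition levy_basis ::
  "'w measure \<Rightarrow> 's measure \<Rightarrow> (real \<Rightarrow> complex) \<Rightarrow> ('s set \<Rightarrow> 'w \<Rightarrow> real) \<Rightarrow> bool" where
  "levy_basis M C \<kappa> \<Lambda> \<longleftrightarrow>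
     (\<forall>A \<in> fmeasurable C. \<Lambda> A \<in> borel_measurable M) \<and>
     (\<forall>A :: nat \<Rightarrow> 's set. range A \<subseteq> fmeasurable C \<longrightarrow> disjoint_family A \<longrightarrow>
        prob_space.indep_vars M (\<lambda>_. borel) (\<lambda>n. \<Lambda> (A n)) UNIV \<and>
        (\<Union> (range A) \<in> fmeasurable C \<longrightarrow>
           (AE \<omega> in M. (\<lambda>n. \<Lambda> (A n) \<omega>) sums \<Lambda> (\<Union> (range A)) \<omega>))) \<and>
     (\<forall>A \<in> fmeasurable C.
        is_cumulant_function M (\<Lambda> A) (\<lambda>\<zeta>. of_real (measure C A) * \<kappa> \<zeta>))"

definition converges_in_probability ::
  "'w measure \<Rightarrow> (nat \<Rightarrow> 'w \<Rightarrow> real) \<Rightarrow> ('w \<Rightarrow> real) \<Rightarrow> bool" where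
  "converges_in_probability M Y Z \<longleftrightarrow>
     Z \<in> borel_measurable M \<and>
     (\<forall>\<epsilon>>0. (\<lambda>n. measure M {\<omega> \<in> space M. \<epsilon> < \<bar>Y n \<omega> - Z \<omega>\<bar>}) \<longlonglongrightarrow> 0)"

definition simple_stoch_integral ::
  "'s measure \<Rightarrow> ('s set \<Rightarrow> 'w \<Rightarrow> real) \<Rightarrow> 's set \<Rightarrow> ('s \<Rightarrow> real) \<Rightarrow> 'w \<Rightarrow> real" where
  "simple_stoch_integral C \<Lambda> A f \<omega> =
     (\<Sum>y \<in> f ` space C - {0}. y * \<Lambda> (A \<inter> {x \<in> space C. f x = y}) \<omega>)"

text \<open>
  A measurable function is integrable if it is an almost everywhere limit of simple functions whose
  integrals over every measurable set converge in probability. The integral is then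
  determined up to almost sure equality, so it is rendered as a relation.
\<close>

definition has_stoch_integral ::
  "'w measure \<Rightarrow> 's measure \<Rightarrow> ('s set \<Rightarrow> 'w \<Rightarrow> real) \<Rightarrow> ('s \<Rightarrow> real) \<Rightarrow> ('w \<Rightarrow> real) \<Rightarrow> bool" where
  "has_stoch_integral M C \<Lambda> f Y \<longleftrightarrow>
     f \<in> borel_measurable C \<and>
     (\<exists>F :: nat \<Rightarrow> 's \<Rightarrow> real.
        (\<forall>n. Bochner_Integration.simple_bochner_integrable C (F n)) \<and>
        (AE x in C. (\<lambda>n. F n x) \<longlonglongrightarrow> f x) \<and>
        (\<forall>A \<in> sets C. \<exists>Z. converges_in_probability M (\<lambda>n. simple_stoch_integral C \<Lambda> A (F n)) Z) \<and>
        converges_in_probability M (\<lambda>n. simple_stoch_integral C \<Lambda> (space C) (F n)) Y)"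


section \<open>SupOU processes\<close>

definition supOU_kernel :: "real \<Rightarrow> real \<times> real \<Rightarrow> real" where
  "supOU_kernel t = (\<lambda>(\<xi>, s). exp (- \<xi> * t + s) * indicator {0..} (\<xi> * t - s))"

definition supOU_process ::
  "'w measure \<Rightarrow> real \<Rightarrow> real \<Rightarrow> real measure \<Rightarrow> real measure \<Rightarrow> (real \<Rightarrow> 'w \<Rightarrow> real) \<Rightarrow> bool" where
  "supOU_process M a b \<mu> \<pi> X \<longleftrightarrow>
     levy_triplet a b \<mu> \<and>
     prob_space \<pi> \<and> sets \<pi> = sets (restrict_space borel {0<..}) \<and>
     (\<exists>\<Lambda>. levy_basis M (\<pi> \<Otimes>\<^sub>M lborel) (levy_khintchine a b \<mu>) \<Lambda> \<and>
        (\<forall>t. has_stoch_integral M (\<pi> \<Otimes>\<^sub>M lborel) \<Lambda> (supOU_kernel t) (X t)))"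

definition integrated_process :: "(real \<Rightarrow> 'w \<Rightarrow> real) \<Rightarrow> real \<Rightarrow> 'w \<Rightarrow> real" where
  "integrated_process X t \<omega> = (LBINT s:{0..t}. X s \<omega>)"


section \<open>Slow variation and Gaussian processes\<close>

definition slowly_varying :: "(real \<Rightarrow> real) \<Rightarrow> bool" where
  "slowly_varying l \<longleftrightarrow>
     (\<exists>x0. set_borel_measurable borel {x0..} l \<and> (\<forall>x\<ge>x0. l x > 0)) \<and>
     (\<forall>c>0. ((\<lambda>x. l (c * x) / l x) \<longlongrightarrow> 1) at_top)"

text \<open>Degenerate normal laws are admitted, as is needed for \<open>X\<^sup>*(0) = 0\<close>.\<close>

definition gaussian_variable :: "'w measure \<Rightarrow> ('w \<Rightarrow> real) \<Rightarrow> bool" where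
  "gaussian_variable M Y \<longleftrightarrow>
     Y \<in> borel_measurable M \<and>
     ((\<exists>m \<sigma>. \<sigma> > 0 \<and> distributed M lborel Y (normal_density m \<sigma>)) \<or>
      (\<exists>m. AE \<omega> in M. Y \<omega> = m))"

definition gaussian_process :: "'w measure \<Rightarrow> 't set \<Rightarrow> ('t \<Rightarrow> 'w \<Rightarrow> real) \<Rightarrow> bool" where
  "gaussian_process M T Y \<longleftrightarrow>
     (\<forall>J c. finite J \<longrightarrow> J \<subseteq> T \<longrightarrow> gaussian_variable M (\<lambda>\<omega>. \<Sum>t\<in>J. c t * Y t \<omega>))"


section \<open>Scaling function\<close>

text \<open>
  \<open>has_scaling_exponent M Y q \<tau>\<close> says that the limit defining the scaling function at \<open>q\<close> exists
  and equals \<open>\<tau>\<close>. For \<open>\<tau> \<noteq> 0\<close> the conventions that a divergent expectation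
  is 0 and that \<open>ln 0 = 0\<close> are harmless: the quotient would be 0 at such \<open>t\<close>, so convergence to \<open>\<tau>\<close>
  forces the moment to be finite and positive for all large \<open>t\<close>.
\<close>

definition has_scaling_exponent ::
  "'w measure \<Rightarrow> (real \<Rightarrow> 'w \<Rightarrow> real) \<Rightarrow> real \<Rightarrow> real \<Rightarrow> bool" where
  "has_scaling_exponent M Y q \<tau> \<longleftrightarrow>
     ((\<lambda>t. ln (prob_space.expectation M (\<lambda>\<omega>. \<bar>Y t \<omega>\<bar> powr q)) / ln t) \<longlongrightarrow> \<tau>) at_top"

end

theory Submission
  imports Defs "HOL-Complex_Analysis.Complex_Analysis" "HOL-Real_Asymp.Real_Asymp"
begin

text \<open>
  The integral of a kernel \<open>f\<close> against the Levy basis has characteristic function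
  \<open>exp (\<integral> \<kappa> (\<zeta> f))\<close>. Applied to \<open>X 1\<close>, this turns the assumptions on \<open>X\<close> into \<open>E L(1) = 0\<close> and
  finite moments of \<open>\<mu>\<close>. Approximating \<open>X\<^sup>*(t)\<close> by Riemann sums, one
  gets the same formula for \<open>X\<^sup>*(t)\<close> with the kernel \<open>f\<^sub>t = \<integral>\<^sub>0\<^sup>t k\<^sub>u du\<close>, so that its cumulants are
  those of \<open>\<mu>\<close> times \<open>J n t = \<integral> f\<^sub>t\<^sup>n\<close>. Since \<open>f\<^sub>t \<le> min t (1 / \<xi>)\<close> and \<open>\<integral> f\<^sub>t ds = t\<close>, the \<open>n\<close>-th
  cumulant grows like \<open>t\<close> to the power \<open>max 1 (n - \<alpha>)\<close>, up to factors \<open>t\<^sup>\<epsilon>\<close>. By the recursion between moments and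
  cumulants the even moments of order \<open>2 m\<close> grow with exponent \<open>max m (2 m - \<alpha>)\<close>; for \<open>m \<le> \<alpha>\<close> the lower bound comes from
  the variance, for \<open>m > \<alpha>\<close> from the last cumulant. Because \<open>\<alpha>\<close> is an integer, \<open>2 \<alpha>\<close> is itself an even
  order, and log-convexity of moments interpolates between even orders on both sides of it.
\<close>

section \<open>Even moments from cosine integrals, and a gliding hump\<close>

text \<open>A stochastic integral comes only with simple functions that converge almost everywhere
  and whose integrals converge in probability, so nothing dominates the exponents
  \<open>\<kappa> (\<zeta> * F n x)\<close>. Convergence over every measurable set is what replaces
  domination, by way of a gliding hump. Finite moments of \<mu> cannot be read off by
  differentiating \<kappa>, whose smoothness is the very question, and the integral of \<kappa>
  agrees with the given cumulant function a priori only after exponentiation. Real parts are free of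
  this ambiguity and are cosine integrals. Their central differences of even order have a sign, so
  Fatou's lemma turns a Taylor bound into a moment bound. The measure involved may be infinite,
  which is why 1 - cos is used rather than cos. Paths of X may be irregular; the Riemann sums
  converge in mean square, by continuity of time shifts of the kernel. A chord of a convex function
  bounds it from above between two known points, but from below only beyond them. Each linear piece
  of the scaling function is therefore pinned down at three orders.\<close>

definition cdiff_weight :: "nat \<Rightarrow> nat \<Rightarrow> real" where
  "cdiff_weight n j = (- 1) ^ (n + j) * real ((2 * n) choose j)"

text \<open>The generating series of these sums is, up to the sign \<open>(- 1) ^ n\<close>, that of
  exp (-n X) (1 - exp X)^(2n). It is divisible by X^(2n), so all coefficients below that order
  vanish.\<close>

lemma cdiff_weight_moment:
  assumes "k < 2 * n"
  shows "(\<Sum>j\<le>2 * n. cdiff_weight n j * (real j - real n) ^ k) = 0"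
proof -
  let ?F = "(1 - fps_exp 1 :: real fps) ^ (2 * n)"
  have z: "?F $ i = 0" if "i < 2 * n" for i
    using startsby_zero_power_prefix[of "1 - fps_exp 1 :: real fps" "2 * n"] that by simp
  have "(fps_exp (- real n) * ?F) $ k = 0"
    using assms by (auto simp: fps_mult_nth intro!: sum.neutral z)
  moreover have "?F = (\<Sum>j\<le>2 * n. of_nat ((2 * n) choose j) * ((- 1) ^ j * fps_exp (real j)))"
  proof -
    have "?F = (- fps_exp 1 + 1) ^ (2 * n)" by simp
    also have "\<dots> = (\<Sum>j\<le>2 * n. of_nat ((2 * n) choose j) * (- fps_exp 1) ^ j * 1 ^ (2 * n - j))"
      by (rule binomial_ring)
    also have "\<dots> = (\<Sum>j\<le>2 * n. of_nat ((2 * n) choose j) * ((- 1) ^ j * fps_exp (real j)))"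
    proof (intro sum.cong refl)
      fix j
      have "(- fps_exp (1::real)) ^ j = (- 1) ^ j * fps_exp (real j)"
        by (metis fps_exp_power_mult mult.right_neutral power_minus)
      then show "of_nat ((2 * n) choose j) * (- fps_exp (1::real)) ^ j * 1 ^ (2 * n - j) =
          of_nat ((2 * n) choose j) * ((- 1) ^ j * fps_exp (real j))"
        by simp
    qed
    finally show ?thesis .
  qed
  then have "fps_exp (- real n) * ?F =
      (\<Sum>j\<le>2 * n. fps_const (real ((2 * n) choose j) * (- 1) ^ j) * fps_exp (real j - real n))"
  proof -
    have "fps_exp (- real n) * (of_nat ((2 * n) choose j) * ((- 1) ^ j * fps_exp (real j))) =
        fps_const (real ((2 * n) choose j) * (- 1) ^ j) * fps_exp (real j - real n)" for j
    proof -
      have "(- 1 :: real fps) ^ j = fps_const ((- 1) ^ j)"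
        by (simp add: fps_const_power[symmetric] fps_const_neg[symmetric] del: fps_const_power fps_const_neg)
      moreover have "(of_nat m :: real fps) = fps_const (real m)" for m
        by (simp add: fps_of_nat)
      moreover have "fps_exp (real j - real n) = fps_exp (real j) * fps_exp (- real n)"
        by (simp add: fps_exp_add_mult[symmetric])
      ultimately show ?thesis
        by (simp add: fps_const_mult[symmetric] mult_ac del: fps_const_mult)
    qed
    then show ?thesis
      using \<open>?F = _\<close> by (simp add: sum_distrib_left)
  qed
  ultimately have "(\<Sum>j\<le>2 * n. real ((2 * n) choose j) * (- 1) ^ j * ((real j - real n) ^ k / fact k)) = 0"
    by (simp add: fps_sum_nth)
  then have "(\<Sum>j\<le>2 * n. real ((2 * n) choose j) * (- 1) ^ j * (real j - real n) ^ k) / fact k = 0"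
    by (simp add: sum_divide_distrib)
  then have *: "(\<Sum>j\<le>2 * n. real ((2 * n) choose j) * (- 1) ^ j * (real j - real n) ^ k) = 0"
    by simp
  have "(\<Sum>j\<le>2 * n. cdiff_weight n j * (real j - real n) ^ k) =
      (-1) ^ n * (\<Sum>j\<le>2 * n. real ((2 * n) choose j) * (- 1) ^ j * (real j - real n) ^ k)"
    by (simp add: cdiff_weight_def sum_distrib_left power_add mult_ac)
  then show ?thesis
    using * by simp
qed

lemma cdiff_weight_poly:
  assumes "degree p < 2 * n"
  shows "(\<Sum>j\<le>2 * n. cdiff_weight n j * poly p ((real j - real n) * h)) = 0"
proof -
  have "(\<Sum>j\<le>2 * n. cdiff_weight n j * poly p ((real j - real n) * h)) =
     (\<Sum>j\<le>2 * n. \<Sum>i\<le>degree p. coeff p i * h ^ i * (cdiff_weight n j * (real j - real n) ^ i))"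
    by (simp add: poly_altdef sum_distrib_left power_mult_distrib mult_ac)
  also have "\<dots> = (\<Sum>i\<le>degree p. coeff p i * h ^ i * (\<Sum>j\<le>2 * n. cdiff_weight n j * (real j - real n) ^ i))"
    by (subst sum.swap) (simp add: sum_distrib_left)
  also have "\<dots> = 0"
    using assms by (intro sum.neutral) (auto simp: cdiff_weight_moment)
  finally show ?thesis .
qed

text \<open>Raise 2 - 2 cos \<theta> = - exp (-i \<theta>) (1 - exp (i \<theta>))^2 to the power
  \<open>n\<close> and expand. The factor \<open>(- 1) ^ n\<close> inside
  \<open>cdiff_weight\<close> is chosen for this identity: it makes the difference of the cosine
  nonnegative.\<close>

lemma cdiff_weight_cos:
  "(2 - 2 * cos \<theta>) ^ n = (\<Sum>j\<le>2 * n. cdiff_weight n j * cos ((real j - real n) * \<theta>))"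
proof -
  have "complex_of_real (2 - 2 * cos \<theta>) = - cis (- \<theta>) * (- cis \<theta> + 1)\<^sup>2"
  proof -
    have "- cis (- \<theta>) * (- cis \<theta> + 1)\<^sup>2 = 2 * (cis (- \<theta>) * cis \<theta>) - cis (- \<theta>) - (cis (- \<theta>) * cis \<theta>) * cis \<theta>"
      by (simp add: power2_eq_square algebra_simps)
    also have "\<dots> = 2 - cis (- \<theta>) - cis \<theta>"
      by (simp add: cis_mult)
    also have "\<dots> = complex_of_real (2 - 2 * cos \<theta>)"
      by (simp add: complex_eq_iff)
    finally show ?thesis by simp
  qed
  then have "complex_of_real ((2 - 2 * cos \<theta>) ^ n) = (- cis (- \<theta>)) ^ n * (- cis \<theta> + 1) ^ (2 * n)"
    by (simp only: of_real_power power_mult_distrib power_mult)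
  also have "\<dots> = (- cis (- \<theta>)) ^ n * (\<Sum>j\<le>2 * n. of_nat ((2 * n) choose j) * (- cis \<theta>) ^ j)"
    by (subst binomial_ring) simp
  also have "\<dots> = (\<Sum>j\<le>2 * n. cdiff_weight n j * cis ((real j - real n) * \<theta>))"
    unfolding sum_distrib_left
  proof (intro sum.cong refl)
    fix j
    have "(- cis (- \<theta>)) ^ n = (-1) ^ n * cis (- real n * \<theta>)"
      by (subst power_minus, subst Complex.DeMoivre) simp
    moreover have "(- cis \<theta>) ^ j = (-1) ^ j * cis (real j * \<theta>)"
      by (subst power_minus, subst Complex.DeMoivre) simp
    ultimately have "(- cis (- \<theta>)) ^ n * (of_nat ((2 * n) choose j) * (- cis \<theta>) ^ j) =
      (-1) ^ (n + j) * of_nat ((2 * n) choose j) * (cis (- real n * \<theta>) * cis (real j * \<theta>))"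
      by (simp add: power_add mult_ac)
    then show "(- cis (- \<theta>)) ^ n * (of_nat ((2 * n) choose j) * (- cis \<theta>) ^ j) =
        of_real (cdiff_weight n j) * cis ((real j - real n) * \<theta>)"
      by (simp add: cis_mult cdiff_weight_def algebra_simps)
  qed
  finally have "Re (complex_of_real ((2 - 2 * cos \<theta>) ^ n)) =
      Re (\<Sum>j\<le>2 * n. cdiff_weight n j * cis ((real j - real n) * \<theta>))"
    by (rule arg_cong)
  then show ?thesis
    by (simp del: of_real_power)
qed

text \<open>The factor by which the central difference with step \<open>h\<close>, after division by
  \<open>h ^ (2 * n)\<close>, can amplify the coefficient \<open>B\<close> of an error
  \<open>B * \<bar>z\<bar> ^ (2 * n)\<close>.\<close>

definition cdiff_norm :: "nat \<Rightarrow> real" where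
  "cdiff_norm n = (\<Sum>j\<le>2 * n. \<bar>cdiff_weight n j\<bar> * \<bar>real j - real n\<bar> ^ (2 * n))"

lemma cos_second_difference_limit:
  fixes y :: real
  assumes "h \<longlonglongrightarrow> 0" "\<And>m. h m \<noteq> 0"
  shows "(\<lambda>m. (2 - 2 * cos (h m * y)) / (h m)\<^sup>2) \<longlonglongrightarrow> y\<^sup>2"
proof (cases "y = 0")
  case False
  have "((\<lambda>z::real. (2 - 2 * cos z) / z\<^sup>2) \<longlongrightarrow> 1) (at 0)"
    by real_asymp
  moreover have "filterlim (\<lambda>m. h m * y) (at 0) sequentially"
    unfolding filterlim_at using assms False by (auto intro!: tendsto_eq_intros)
  ultimately have "(\<lambda>m. (2 - 2 * cos (h m * y)) / (h m * y)\<^sup>2) \<longlonglongrightarrow> 1"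
    by (rule filterlim_compose)
  then have "(\<lambda>m. (2 - 2 * cos (h m * y)) / (h m * y)\<^sup>2 * y\<^sup>2) \<longlonglongrightarrow> 1 * y\<^sup>2"
    by (intro tendsto_intros)
  then show ?thesis
    using False by (simp add: power_mult_distrib)
qed simp

text \<open>
  The \<open>2n\<close>-th central difference of \<open>1 - cos (z Y)\<close> in \<open>z\<close> at \<open>0\<close> has a constant sign, annihilates
  the polynomial part, and divided by \<open>h\<^sup>2\<^sup>n\<close> tends to \<open>Y\<^sup>2\<^sup>n\<close>; Fatou's lemma then gives the bound.
\<close>

lemma even_moment_bound:
  fixes Y :: "'a \<Rightarrow> real" and p :: "real poly"
  assumes [measurable]: "Y \<in> borel_measurable N"
    and n: "n > 0" and deg: "degree p < 2 * n"
    and ev: "\<forall>\<^sub>F z in nhds 0. integrable N (\<lambda>x. 1 - cos (z * Y x)) \<and>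
               \<bar>(\<integral>x. 1 - cos (z * Y x) \<partial>N) - poly p z\<bar> \<le> B * \<bar>z\<bar> ^ (2 * n)"
  shows "(\<integral>\<^sup>+x. ennreal (Y x ^ (2 * n)) \<partial>N) \<le> ennreal (B * cdiff_norm n)"
proof -
  from ev obtain d where d: "d > 0" and
    int: "\<And>z. \<bar>z\<bar> < d \<Longrightarrow> integrable N (\<lambda>x. 1 - cos (z * Y x))" and
    bd: "\<And>z. \<bar>z\<bar> < d \<Longrightarrow> \<bar>(\<integral>x. 1 - cos (z * Y x) \<partial>N) - poly p z\<bar> \<le> B * \<bar>z\<bar> ^ (2 * n)"
    unfolding eventually_nhds_metric by (auto simp: dist_real_def)
  \<comment> \<open>The steps tend to zero through nonzero values and are so small that all nodes
    \<open>(real j - real n) * h m\<close> with \<open>j \<le> 2 * n\<close> stay within distance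
    \<open>d\<close> of the origin.\<close>
  define h where "h m = d / (n + 1) / real (Suc (Suc m))" for m
  have h0: "h m > 0" for m using d by (simp add: h_def)
  have hlim: "h \<longlonglongrightarrow> 0"
    unfolding h_def by real_asymp
  have hd: "\<bar>(real j - real n) * h m\<bar> < d" if "j \<le> 2 * n" for j m
  proof -
    have "\<bar>real j - real n\<bar> \<le> n" using that by auto
    moreover have "h m < d / (n + 1)"
      using d by (simp add: h_def divide_simps)
    ultimately have "\<bar>(real j - real n) * h m\<bar> \<le> n * h m"
      using h0[of m] by (simp add: abs_mult mult_right_mono)
    also have "\<dots> \<le> n * (d / (n + 1))"
      using \<open>h m < _\<close> by (intro mult_left_mono) auto
    also have "\<dots> < d" using d by (simp add: divide_simps)
    finally show ?thesis .
  qed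
  have fin: "(\<integral>\<^sup>+x. ennreal (((2 - 2 * cos (h m * Y x)) / (h m)\<^sup>2) ^ n) \<partial>N) \<le> ennreal (B * cdiff_norm n)" for m
  proof -
    have s0: "(\<Sum>j\<le>2 * n. cdiff_weight n j) = 0"
      using cdiff_weight_moment[of 0 n] n by simp
    \<comment> \<open>The weights sum to zero, so every cosine may be replaced by
      \<open>cos - 1\<close>. Only \<open>1 - cos\<close> is known to be integrable; the cosine
      itself is not when \<open>N\<close> is infinite and \<open>Y\<close> is mostly near
      zero.\<close>
    have eq: "(2 - 2 * cos (h m * Y x)) ^ n =
        (\<Sum>j\<le>2 * n. (- cdiff_weight n j) * (1 - cos ((real j - real n) * h m * Y x)))" for x
    proof -
      have "(\<Sum>j\<le>2 * n. (- cdiff_weight n j) * (1 - cos ((real j - real n) * h m * Y x))) =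
          (\<Sum>j\<le>2 * n. cdiff_weight n j * cos ((real j - real n) * (h m * Y x))) - (\<Sum>j\<le>2 * n. cdiff_weight n j)"
        by (simp add: algebra_simps sum_subtractf)
      then show ?thesis
        by (simp add: s0 cdiff_weight_cos)
    qed
    have ii: "integrable N (\<lambda>x. (2 - 2 * cos (h m * Y x)) ^ n)"
      unfolding eq by (intro Bochner_Integration.integrable_sum integrable_mult_right int hd) simp
    have "(\<integral>x. (2 - 2 * cos (h m * Y x)) ^ n \<partial>N) =
        (\<Sum>j\<le>2 * n. (- cdiff_weight n j) * (\<integral>x. 1 - cos ((real j - real n) * h m * Y x) \<partial>N))"
      unfolding eq
      by (subst Bochner_Integration.integral_sum)
         (auto intro!: integrable_mult_right int hd simp del: mult_minus_left)
    \<comment> \<open>The degree of \<open>p\<close> is below the order of the difference, so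
      subtracting \<open>p\<close> at every node changes nothing; what remains is the error
      term.\<close>
    also have "\<dots> = (\<Sum>j\<le>2 * n. (- cdiff_weight n j) *
        ((\<integral>x. 1 - cos ((real j - real n) * h m * Y x) \<partial>N) - poly p ((real j - real n) * h m)))"
      using cdiff_weight_poly[OF deg, of "h m"] by (simp add: algebra_simps sum.distrib sum_subtractf sum_negf)
    also have "\<dots> \<le> (\<Sum>j\<le>2 * n. \<bar>cdiff_weight n j\<bar> * (B * \<bar>(real j - real n) * h m\<bar> ^ (2 * n)))"
    proof (intro sum_mono)
      fix j assume "j \<in> {..2 * n}"
      then have "\<bar>(\<integral>x. 1 - cos ((real j - real n) * h m * Y x) \<partial>N) - poly p ((real j - real n) * h m)\<bar>
          \<le> B * \<bar>(real j - real n) * h m\<bar> ^ (2 * n)"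
        by (intro bd hd) simp
      then have "\<bar>- cdiff_weight n j\<bar> * \<bar>(\<integral>x. 1 - cos ((real j - real n) * h m * Y x) \<partial>N) - poly p ((real j - real n) * h m)\<bar>
          \<le> \<bar>cdiff_weight n j\<bar> * (B * \<bar>(real j - real n) * h m\<bar> ^ (2 * n))"
        by (intro mult_mono) auto
      then show "- cdiff_weight n j *
        ((\<integral>x. 1 - cos ((real j - real n) * h m * Y x) \<partial>N) - poly p ((real j - real n) * h m))
         \<le> \<bar>cdiff_weight n j\<bar> * (B * \<bar>(real j - real n) * h m\<bar> ^ (2 * n))"
        unfolding abs_mult[symmetric] by (rule order_trans[OF abs_ge_self])
    qed
    also have "\<dots> = B * cdiff_norm n * (h m) ^ (2 * n)"
      using h0[of m] by (simp add: cdiff_norm_def sum_distrib_left sum_distrib_right abs_mult power_mult_distrib mult_ac)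
    finally have le: "(\<integral>x. (2 - 2 * cos (h m * Y x)) ^ n \<partial>N) \<le> B * cdiff_norm n * (h m) ^ (2 * n)" .
    have pos: "0 \<le> (2 - 2 * cos (h m * Y x)) ^ n" for x
      by (intro zero_le_power) simp
    have e2: "((2 - 2 * cos (h m * Y x)) / (h m)\<^sup>2) ^ n = (2 - 2 * cos (h m * Y x)) ^ n / (h m) ^ (2 * n)" for x
      by (simp add: power_divide power_mult)
    have "(\<integral>\<^sup>+x. ennreal (((2 - 2 * cos (h m * Y x)) / (h m)\<^sup>2) ^ n) \<partial>N) =
        ennreal (\<integral>x. (2 - 2 * cos (h m * Y x)) ^ n / (h m) ^ (2 * n) \<partial>N)"
      unfolding e2 using ii h0[of m] pos by (intro nn_integral_eq_integral) auto
    also have "\<dots> \<le> ennreal (B * cdiff_norm n)"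
      using le h0[of m] by (intro ennreal_leI) (simp add: divide_simps)
    finally show ?thesis .
  qed
  have "(\<integral>\<^sup>+x. ennreal (Y x ^ (2 * n)) \<partial>N) =
      (\<integral>\<^sup>+x. liminf (\<lambda>m. ennreal (((2 - 2 * cos (h m * Y x)) / (h m)\<^sup>2) ^ n)) \<partial>N)"
  proof (intro nn_integral_cong)
    fix x
    have "(\<lambda>m. ennreal (((2 - 2 * cos (h m * Y x)) / (h m)\<^sup>2) ^ n)) \<longlonglongrightarrow> ennreal (((Y x)\<^sup>2) ^ n)"
      using h0 by (intro tendsto_ennrealI tendsto_power cos_second_difference_limit[OF hlim]) (simp add: less_imp_neq[symmetric])
    from lim_imp_Liminf[OF sequentially_bot this]
    show "ennreal (Y x ^ (2 * n)) = liminf (\<lambda>m. ennreal (((2 - 2 * cos (h m * Y x)) / (h m)\<^sup>2) ^ n))"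
      by (simp only: power_mult)
  qed
  also have "\<dots> \<le> liminf (\<lambda>m. \<integral>\<^sup>+x. ennreal (((2 - 2 * cos (h m * Y x)) / (h m)\<^sup>2) ^ n) \<partial>N)"
    by (intro nn_integral_liminf) simp
  also have "\<dots> \<le> ennreal (B * cdiff_norm n)"
    using fin by (intro Liminf_le) (auto intro!: always_eventually)
  finally show ?thesis .
qed

text \<open>
  A gliding hump: along a subsequence \<open>h\<^sub>n\<close> is concentrated on disjoint sets \<open>D\<^sub>k\<close> up to errors that
  tend to zero; on the union of the \<open>D\<^sub>k\<close> with even \<open>k\<close> the integrals are close to \<open>\<integral>h\<^sub>n\<close> for even \<open>k\<close>
  and close to \<open>0\<close> for odd \<open>k\<close>, so that both have the same limit.
\<close>

lemma (in sigma_finite_measure) exp_integral_tendsto_1: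
  fixes h :: "nat \<Rightarrow> 'a \<Rightarrow> complex"
  assumes int: "\<And>n. integrable M (h n)"
    and ae: "AE x in M. (\<lambda>n. h n x) \<longlonglongrightarrow> 0"
    and conv: "\<And>A. A \<in> sets M \<Longrightarrow> convergent (\<lambda>n. exp (set_lebesgue_integral M A (h n)))"
  shows "(\<lambda>n. exp (integral\<^sup>L M (h n))) \<longlonglongrightarrow> 1"
proof -
  have [measurable]: "h n \<in> borel_measurable M" for n
    using int[of n] by auto
  \<comment> \<open>Sigma-finiteness gives a strictly positive integrable \<open>w\<close>. It
    dominates \<open>h n\<close> on \<open>B N\<close> for all \<open>n \<ge> N\<close>, and because
    \<open>w\<close> is positive, almost every point eventually lies in the increasing sets
    \<open>B N\<close>.\<close>
  obtain w :: "'a \<Rightarrow> real" where w [measurable]: "w \<in> borel_measurable M"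
    and wpos: "\<And>x. w x > 0" and wint: "integrable M w"
    by (meson obtain_positive_integrable_function)
  define B where "B N = {x \<in> space M. \<forall>n\<ge>N. norm (h n x) \<le> w x}" for N
  have B [measurable]: "B N \<in> sets M" for N
    unfolding B_def by measurable
  have Bmono: "B N \<subseteq> B N'" if "N \<le> N'" for N N'
    using that by (auto simp: B_def)
  have Bfull: "AE x in M. \<forall>\<^sub>F N in sequentially. x \<in> B N"
    using ae AE_space
  proof (eventually_elim)
    fix x assume *: "(\<lambda>n. h n x) \<longlonglongrightarrow> 0" "x \<in> space M"
    then have "\<forall>\<^sub>F n in sequentially. norm (h n x) < w x"
      using wpos[of x] by (auto simp: tendsto_iff)
    then obtain N0 where "\<And>n. n \<ge> N0 \<Longrightarrow> norm (h n x) < w x"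
      by (auto simp: eventually_sequentially)
    then have "x \<in> B N" if "N \<ge> N0" for N
      using that *(2) by (auto simp: B_def intro!: less_imp_le)
    then show "\<forall>\<^sub>F N in sequentially. x \<in> B N"
      by (auto simp: eventually_sequentially)
  qed
  define mass where "mass A n = (\<integral>x. indicator A x * norm (h n x) \<partial>M)" for A n
  have imass: "integrable M (\<lambda>x. indicator A x * norm (h n x))" if "A \<in> sets M" for A n
    using integrable_mult_indicator[OF that integrable_norm[OF int[of n]]] by simp
  have lim_n: "(\<lambda>n. mass (B N) n) \<longlonglongrightarrow> 0" for N
  proof -
    have "(\<lambda>n. mass (B N) (n + N)) \<longlonglongrightarrow> (\<integral>x. 0 \<partial>M)"
      unfolding mass_def
    proof (rule integral_dominated_convergence[where w = w])
      show "AE x in M. (\<lambda>n. indicator (B N) x * norm (h (n + N) x)) \<longlonglongrightarrow> 0"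
        using ae
      proof (eventually_elim)
        fix x assume "(\<lambda>n. h n x) \<longlonglongrightarrow> 0"
        then have "(\<lambda>n. norm (h (n + N) x)) \<longlonglongrightarrow> 0"
          by (intro LIMSEQ_ignore_initial_segment tendsto_norm_zero)
        then show "(\<lambda>n. indicator (B N) x * norm (h (n + N) x)) \<longlonglongrightarrow> 0"
          by (rule tendsto_mult_right_zero)
      qed
      show "AE x in M. norm (indicator (B N) x * norm (h (n + N) x)) \<le> w x" for n
        using wpos by (auto simp: indicator_def B_def less_imp_le)
    qed (auto intro: wint)
    then show ?thesis
      by (simp add: LIMSEQ_offset)
  qed
  have lim_N: "(\<lambda>N. mass (space M - B N) n) \<longlonglongrightarrow> 0" for n
  proof -
    have "(\<lambda>N. mass (space M - B N) n) \<longlonglongrightarrow> (\<integral>x. 0 \<partial>M)"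
      unfolding mass_def
    proof (rule integral_dominated_convergence[where w = "\<lambda>x. norm (h n x)"])
      show "AE x in M. (\<lambda>N. indicator (space M - B N) x * norm (h n x)) \<longlonglongrightarrow> 0"
        using Bfull
      proof (eventually_elim)
        fix x assume "\<forall>\<^sub>F N in sequentially. x \<in> B N"
        then have "\<forall>\<^sub>F N in sequentially. indicator (space M - B N) x * norm (h n x) = 0"
          by eventually_elim simp
        then show "(\<lambda>N. indicator (space M - B N) x * norm (h n x)) \<longlonglongrightarrow> 0"
          by (rule tendsto_eventually)
      qed
      show "AE x in M. norm (indicator (space M - B N) x * norm (h n x)) \<le> norm (h n x)" for N
        by (auto simp: indicator_def)
    qed (auto intro: int integrable_norm)
    then show ?thesis by simp
  qed
  define \<epsilon> where "\<epsilon> k = 1 / real (Suc k)" for k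
  have epos: "\<epsilon> k > 0" for k by (simp add: \<epsilon>_def)
  have elim: "\<epsilon> \<longlonglongrightarrow> 0" unfolding \<epsilon>_def by (rule LIMSEQ_Suc[OF lim_1_over_n])
  \<comment> \<open>Pairs \<open>(N, n)\<close> are chosen in turn: first \<open>N\<close> so large
    that the previous function has little mass outside \<open>B N\<close>, then \<open>n\<close> so
    large that the new one has little mass inside \<open>B N\<close>. The function of stage
    \<open>k\<close> then lives on \<open>D k\<close>, up to mass
    \<open>2 * \<epsilon> k\<close>.\<close>
  have "\<exists>f. \<forall>k. mass (B (fst (f k))) (snd (f k)) < \<epsilon> k \<and>
     (fst (f (Suc k)) \<ge> fst (f k) \<and> snd (f (Suc k)) > snd (f k) \<and>
      mass (space M - B (fst (f (Suc k)))) (snd (f k)) < \<epsilon> k)"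
  proof (rule dependent_nat_choice[where P = "\<lambda>k u. mass (B (fst u)) (snd u) < \<epsilon> k"
        and Q = "\<lambda>k u v. fst v \<ge> fst u \<and> snd v > snd u \<and> mass (space M - B (fst v)) (snd u) < \<epsilon> k"])
    have "\<forall>\<^sub>F n in sequentially. mass (B 0) n < \<epsilon> 0"
      by (rule order_tendstoD(2)[OF lim_n epos])
    then show "\<exists>u. mass (B (fst u)) (snd u) < \<epsilon> 0"
      by (auto simp: eventually_sequentially)
  next
    fix u :: "nat \<times> nat" and k
    have "\<forall>\<^sub>F N in sequentially. N \<ge> fst u \<and> mass (space M - B N) (snd u) < \<epsilon> k"
      by (intro eventually_conj eventually_ge_at_top order_tendstoD(2)[OF lim_N epos])
    then obtain N where N: "N \<ge> fst u" "mass (space M - B N) (snd u) < \<epsilon> k"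
      by (auto simp: eventually_sequentially)
    have "\<forall>\<^sub>F n in sequentially. n > snd u \<and> mass (B N) n < \<epsilon> (Suc k)"
      by (intro eventually_conj eventually_gt_at_top order_tendstoD(2)[OF lim_n epos])
    then obtain n where "n > snd u" "mass (B N) n < \<epsilon> (Suc k)"
      by (auto simp: eventually_sequentially)
    with N show "\<exists>v. mass (B (fst v)) (snd v) < \<epsilon> (Suc k) \<and>
        fst v \<ge> fst u \<and> snd v > snd u \<and> mass (space M - B (fst v)) (snd u) < \<epsilon> k"
      by (intro exI[of _ "(N, n)"]) auto
  qed
  then obtain f where f: "\<And>k. mass (B (fst (f k))) (snd (f k)) < \<epsilon> k"
     "\<And>k. fst (f k) \<le> fst (f (Suc k))" "\<And>k. snd (f k) < snd (f (Suc k))"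
     "\<And>k. mass (space M - B (fst (f (Suc k)))) (snd (f k)) < \<epsilon> k"
    by blast
  define \<phi> where "\<phi> k = snd (f k)" for k
  define D where "D k = B (fst (f (Suc k))) - B (fst (f k))" for k
  have D [measurable]: "D k \<in> sets M" for k by (auto simp: D_def)
  have \<phi>: "strict_mono \<phi>" unfolding \<phi>_def by (intro strict_monoI_Suc f)
  have fmono: "fst (f i) \<le> fst (f j)" if "i \<le> j" for i j
    using that f(2) by (rule lift_Suc_mono_le[rotated])
  have Ddisj: "D i \<inter> D j = {}" if "i < j" for i j
    using Bmono[OF fmono[of "Suc i" j]] that by (auto simp: D_def)
  have outside: "mass E (\<phi> k) \<le> 2 * \<epsilon> k" if E: "E \<in> sets M" "E \<inter> D k = {}" for E k
  proof -
    have "mass E (\<phi> k) \<le> (\<integral>x. indicator (B (fst (f k))) x * norm (h (\<phi> k) x) +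
        indicator (space M - B (fst (f (Suc k)))) x * norm (h (\<phi> k) x) \<partial>M)"
      unfolding mass_def
    proof (rule integral_mono[OF imass[OF E(1)]])
      show "integrable M (\<lambda>x. indicator (B (fst (f k))) x * norm (h (\<phi> k) x) +
        indicator (space M - B (fst (f (Suc k)))) x * norm (h (\<phi> k) x))"
        by (intro Bochner_Integration.integrable_add imass) auto
      show "indicator E x * norm (h (\<phi> k) x) \<le> indicator (B (fst (f k))) x * norm (h (\<phi> k) x) +
        indicator (space M - B (fst (f (Suc k)))) x * norm (h (\<phi> k) x)" if "x \<in> space M" for x
        using that E(2) by (auto simp: indicator_def D_def)
    qed
    also have "\<dots> = mass (B (fst (f k))) (\<phi> k) + mass (space M - B (fst (f (Suc k)))) (\<phi> k)"
      unfolding mass_def by (intro Bochner_Integration.integral_add imass) auto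
    also have "\<dots> \<le> 2 * \<epsilon> k"
      using f(1)[of k] f(4)[of k] by (simp add: \<phi>_def)
    finally show ?thesis .
  qed
  have nm: "norm (set_lebesgue_integral M E (h n)) \<le> mass E n" if "E \<in> sets M" for E n
    using integral_norm_bound[of M "\<lambda>x. indicator E x *\<^sub>R h n x"]
    by (simp add: mass_def set_lebesgue_integral_def)
  define A where "A = (\<Union>k. D (2 * k))"
  have A [measurable]: "A \<in> sets M" by (auto simp: A_def)
  let ?I = "\<lambda>E n. set_lebesgue_integral M E (h n)"
  have even: "D (2 * k) \<subseteq> A" for k by (auto simp: A_def)
  have odd: "A \<inter> D (2 * k + 1) = {}" for k
  proof -
    have "D (2 * i) \<inter> D (2 * k + 1) = {}" for i
      using Ddisj[of "2 * i" "2 * k + 1"] Ddisj[of "2 * k + 1" "2 * i"] by (cases "i \<le> k") auto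
    then show ?thesis by (auto simp: A_def)
  qed
  obtain z where z: "(\<lambda>n. exp (?I A n)) \<longlonglongrightarrow> z"
    using conv[OF A] by (auto simp: convergent_def)
  obtain z' where z': "(\<lambda>n. exp (integral\<^sup>L M (h n))) \<longlonglongrightarrow> z'"
    using conv[OF sets.top] unfolding convergent_def set_integral_space[OF int] by blast
  have sub_odd: "strict_mono (\<lambda>k. \<phi> (2 * k + 1))" and sub_even: "strict_mono (\<lambda>k. \<phi> (2 * k))"
    by (auto simp: strict_mono_def intro!: strict_monoD[OF \<phi>])
  have l2: "(\<lambda>k. 2 * \<epsilon> (2 * k + 1)) \<longlonglongrightarrow> 0" "(\<lambda>k. 2 * \<epsilon> (2 * k)) \<longlonglongrightarrow> 0"
    unfolding \<epsilon>_def by real_asymp+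
  have "(\<lambda>k. ?I A (\<phi> (2 * k + 1))) \<longlonglongrightarrow> 0"
    by (rule Lim_null_comparison[OF _ l2(1)])
       (intro always_eventually allI order_trans[OF nm[OF A]] outside A odd)
  then have "(\<lambda>k. exp (?I A (\<phi> (2 * k + 1)))) \<longlonglongrightarrow> exp 0"
    by (rule tendsto_exp)
  moreover have "(\<lambda>k. exp (?I A (\<phi> (2 * k + 1)))) \<longlonglongrightarrow> z"
    using LIMSEQ_subseq_LIMSEQ[OF z sub_odd] by (simp add: o_def)
  ultimately have z1: "z = 1"
    using LIMSEQ_unique by fastforce
  have split: "integral\<^sup>L M (h n) = ?I A n + ?I (space M - A) n" for n
  proof -
    have "set_lebesgue_integral M (A \<union> (space M - A)) (h n) = ?I A n + ?I (space M - A) n"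
      by (intro set_integral_Un) (auto simp: set_integrable_def intro!: integrable_mult_indicator int)
    moreover have "A \<union> (space M - A) = space M"
      using sets.sets_into_space[OF A] by auto
    ultimately show ?thesis
      by (simp add: set_integral_space int)
  qed
  have "(\<lambda>k. ?I (space M - A) (\<phi> (2 * k))) \<longlonglongrightarrow> 0"
    by (rule Lim_null_comparison[OF _ l2(2)])
       (intro always_eventually allI order_trans[OF nm] outside; use even in auto)
  then have "(\<lambda>k. exp (?I A (\<phi> (2 * k))) * exp (?I (space M - A) (\<phi> (2 * k)))) \<longlonglongrightarrow> z * exp 0"
    using LIMSEQ_subseq_LIMSEQ[OF z sub_even] by (intro tendsto_intros) (simp_all add: o_def)
  then have "(\<lambda>k. exp (integral\<^sup>L M (h (\<phi> (2 * k))))) \<longlonglongrightarrow> 1"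
    by (simp add: split z1 exp_add)
  moreover have "(\<lambda>k. exp (integral\<^sup>L M (h (\<phi> (2 * k))))) \<longlonglongrightarrow> z'"
    using LIMSEQ_subseq_LIMSEQ[OF z' sub_even] by (simp add: o_def)
  ultimately have "z' = 1"
    using LIMSEQ_unique by blast
  with z' show ?thesis by simp
qed

section \<open>Mean-square bounds for time integrals\<close>

lemma set_integrable_of_square:
  fixes \<phi> :: "real \<Rightarrow> real"
  assumes [measurable]: "\<phi> \<in> borel_measurable borel"
    and fin: "(\<integral>\<^sup>+s. indicator {0..t} s * ennreal ((\<phi> s)\<^sup>2) \<partial>lborel) < \<infinity>"
  shows "integrable lborel (\<lambda>s. indicator {0..t} s * (\<phi> s)\<^sup>2)" "integrable lborel (\<lambda>s. indicator {0..t} s * \<phi> s)"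
proof -
  show sq: "integrable lborel (\<lambda>s. indicator {0..t} s * (\<phi> s)\<^sup>2)"
    by (rule integrableI_nonneg) (use fin in \<open>auto simp: ennreal_mult' ennreal_indicator\<close>)
  have id: "integrable lborel (indicator {0..t} :: real \<Rightarrow> real)"
    by (cases "t \<ge> 0") (simp_all add: integrable_indicator_iff)
  show "integrable lborel (\<lambda>s. indicator {0..t} s * \<phi> s)"
  proof (rule Bochner_Integration.integrable_bound[OF Bochner_Integration.integrable_add[OF id sq]])
    have "\<bar>y\<bar> \<le> 1 + y\<^sup>2" for y :: real
      using sum_squares_bound[of 1 "\<bar>y\<bar>"] zero_le_power2[of y] by simp
    then show "AE s in lborel. norm (indicator {0..t} s * \<phi> s) \<le> norm (indicator {0..t} s + indicator {0..t} s * (\<phi> s)\<^sup>2)"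
      by (auto simp: indicator_def)
  qed auto
qed

text \<open>Cauchy-Schwarz on \<open>{0..t}\<close>, from the nonnegativity of the integrated
  squared deviation of \<open>\<phi>\<close> from its average \<open>c / t\<close>. The right-hand
  side is extended-valued so that the bound can be integrated over a further variable before
  finiteness is known.\<close>

lemma set_integral_square_le:
  fixes \<phi> :: "real \<Rightarrow> real"
  assumes t: "t \<ge> 0" and [measurable]: "\<phi> \<in> borel_measurable borel"
  shows "ennreal ((LBINT s:{0..t}. \<phi> s)\<^sup>2) \<le>
     ennreal t * (\<integral>\<^sup>+s. indicator {0..t} s * ennreal ((\<phi> s)\<^sup>2) \<partial>lborel)"
proof (cases "t = 0 \<or> (\<integral>\<^sup>+s. indicator {0..t} s * ennreal ((\<phi> s)\<^sup>2) \<partial>lborel) = \<infinity>")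
  \<comment> \<open>At \<open>t = 0\<close> the left-hand side vanishes as an integral over a null
    set. If \<open>t > 0\<close> and the square integral is infinite, so is the right-hand side,
    whatever default value the Bochner integral takes.\<close>
  case True
  moreover have "AE s in lborel. indicator {0..t} s *\<^sub>R \<phi> s = 0" if "t = 0"
    using AE_lborel_singleton[of 0] unfolding that by (rule eventually_mono) (auto simp: indicator_def)
  then have "(LBINT s:{0..t}. \<phi> s) = 0" if "t = 0"
    using that unfolding set_lebesgue_integral_def by (intro integral_eq_zero_AE) auto
  ultimately show ?thesis
    using t by (auto simp: ennreal_mult_top)
next
  case False
  then have t: "t > 0" and fin: "(\<integral>\<^sup>+s. indicator {0..t} s * ennreal ((\<phi> s)\<^sup>2) \<partial>lborel) < \<infinity>"
    using t by (auto simp: less_top)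
  note sq = set_integrable_of_square(1)[OF assms(2) fin] and i1 = set_integrable_of_square(2)[OF assms(2) fin]
  have id: "integrable lborel (indicator {0..t} :: real \<Rightarrow> real)"
    using t by (simp add: integrable_indicator_iff)
  define c where "c = (LBINT s:{0..t}. \<phi> s)"
  have c: "c = (LBINT s. indicator {0..t} s * \<phi> s)"
    by (simp add: c_def set_lebesgue_integral_def)
  have "0 \<le> (LBINT s. indicator {0..t} s * (\<phi> s - c / t)\<^sup>2)"
    by (intro integral_nonneg_AE) auto
  also have "\<dots> = (LBINT s. indicator {0..t} s * (\<phi> s)\<^sup>2 - 2 * c / t * (indicator {0..t} s * \<phi> s) + (c / t)\<^sup>2 * indicator {0..t} s)"
    by (intro Bochner_Integration.integral_cong) (auto simp: power2_diff algebra_simps)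
  also have "\<dots> = (LBINT s. indicator {0..t} s * (\<phi> s)\<^sup>2) - 2 * c / t * c + (c / t)\<^sup>2 * t"
    using sq i1 id t by (simp add: c del: times_divide_eq_left)
  also have "\<dots> = (LBINT s. indicator {0..t} s * (\<phi> s)\<^sup>2) - c\<^sup>2 / t"
    using t by (simp add: field_simps power2_eq_square)
  finally have "c\<^sup>2 \<le> t * (LBINT s. indicator {0..t} s * (\<phi> s)\<^sup>2)"
    using t by (simp add: field_simps)
  moreover have "(\<integral>\<^sup>+s. indicator {0..t} s * ennreal ((\<phi> s)\<^sup>2) \<partial>lborel) = ennreal (LBINT s. indicator {0..t} s * (\<phi> s)\<^sup>2)"
    using sq by (subst nn_integral_eq_integral[symmetric]) (auto simp: ennreal_mult' ennreal_indicator)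
  ultimately show ?thesis
    using t by (simp add: c_def[symmetric] ennreal_mult'[symmetric] ennreal_leI)
qed

text \<open>Cauchy-Schwarz in time, then Tonelli. The space is general because the bound serves
  twice: for \<open>X\<close> over the probability space and for the kernels over
  \<open>\<pi> \<Otimes>\<^sub>M lborel\<close>.\<close>

lemma (in sigma_finite_measure) nn_integral_square_time_integral_le:
  fixes \<Phi> :: "real \<Rightarrow> 'a \<Rightarrow> real"
  assumes t: "t \<ge> 0" and m [measurable]: "(\<lambda>(s, x). \<Phi> s x) \<in> borel_measurable (borel \<Otimes>\<^sub>M M)"
  shows "(\<integral>\<^sup>+x. ennreal ((LBINT s:{0..t}. \<Phi> s x)\<^sup>2) \<partial>M) \<le>
     ennreal t * (\<integral>\<^sup>+s. indicator {0..t} s * (\<integral>\<^sup>+x. ennreal ((\<Phi> s x)\<^sup>2) \<partial>M) \<partial>lborel)"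
proof -
  interpret P: pair_sigma_finite lborel M ..
  have [measurable]: "(\<lambda>(s, x). \<Phi> s x) \<in> borel_measurable (lborel \<Otimes>\<^sub>M M)"
    using m by (simp cong: measurable_cong_sets sets_pair_measure_cong)
  have "(\<integral>\<^sup>+x. ennreal ((LBINT s:{0..t}. \<Phi> s x)\<^sup>2) \<partial>M) \<le>
      (\<integral>\<^sup>+x. ennreal t * (\<integral>\<^sup>+s. indicator {0..t} s * ennreal ((\<Phi> s x)\<^sup>2) \<partial>lborel) \<partial>M)"
    using t by (intro nn_integral_mono set_integral_square_le) auto
  also have "\<dots> = ennreal t * (\<integral>\<^sup>+x. (\<integral>\<^sup>+s. indicator {0..t} s * ennreal ((\<Phi> s x)\<^sup>2) \<partial>lborel) \<partial>M)"
    by (intro nn_integral_cmult) measurable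
  also have "(\<integral>\<^sup>+x. (\<integral>\<^sup>+s. indicator {0..t} s * ennreal ((\<Phi> s x)\<^sup>2) \<partial>lborel) \<partial>M) =
      (\<integral>\<^sup>+s. (\<integral>\<^sup>+x. indicator {0..t} s * ennreal ((\<Phi> s x)\<^sup>2) \<partial>M) \<partial>lborel)"
    by (rule P.Fubini') measurable
  also have "\<dots> = (\<integral>\<^sup>+s. indicator {0..t} s * (\<integral>\<^sup>+x. ennreal ((\<Phi> s x)\<^sup>2) \<partial>M) \<partial>lborel)"
    by (intro nn_integral_cong nn_integral_cmult) measurable
  finally show ?thesis .
qed

section \<open>Moments and cumulants\<close>

lemma isCont_tendsto_nhds:
  "isCont f a \<Longrightarrow> (f \<longlongrightarrow> f a) (nhds a)"
  by (simp add: isCont_def tendsto_at_iff_tendsto_nhds)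

text \<open>After the first \<open>N\<close> terms are split off, the rest is \<open>z ^ N\<close>
  times the series \<open>fps_shift N F\<close>, which converges near zero and is therefore bounded
  there.\<close>

lemma has_fps_expansion_truncation_error:
  fixes f :: "complex \<Rightarrow> complex"
  assumes F: "f has_fps_expansion F"
  shows "\<exists>B. \<forall>\<^sub>F z in nhds 0. norm (f z - (\<Sum>k<N. F $ k * z ^ k)) \<le> B * norm z ^ N"
proof -
  let ?H = "fps_shift N F"
  have H: "eval_fps ?H has_fps_expansion ?H"
    using F by (intro eval_fps_has_fps_expansion) (auto simp: has_fps_expansion_def)
  have "(\<lambda>z. (\<Sum>k<N. F $ k * z ^ k) + z ^ N * eval_fps ?H z) has_fps_expansion
      ((\<Sum>k<N. fps_const (F $ k) * fps_X ^ k) + fps_X ^ N * ?H)"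
    by (intro fps_expansion_intros H)
  also have "(\<Sum>k<N. fps_const (F $ k) * fps_X ^ k) + fps_X ^ N * ?H = F"
    by (rule fps_ext) (auto simp: fps_sum_nth fps_X_power_mult_nth fps_mult_fps_X_power_nonzero if_distrib[of "\<lambda>x. _ * x"] sum.delta cong: if_cong)
  finally have "\<forall>\<^sub>F z in nhds 0. eval_fps F z = (\<Sum>k<N. F $ k * z ^ k) + z ^ N * eval_fps ?H z"
    by (simp add: has_fps_expansion_def)
  moreover have "\<forall>\<^sub>F z in nhds 0. eval_fps F z = f z"
    using F by (simp add: has_fps_expansion_def)
  moreover have "((\<lambda>z. norm (eval_fps ?H z)) \<longlongrightarrow> norm (?H $ 0)) (nhds 0)"
    by (intro tendsto_norm has_fps_expansion_imp_tendsto_0 H)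
  then have "\<forall>\<^sub>F z in nhds 0. norm (eval_fps ?H z) < norm (?H $ 0) + 1"
    by (rule order_tendstoD(2)) simp
  ultimately have "\<forall>\<^sub>F z in nhds 0. norm (f z - (\<Sum>k<N. F $ k * z ^ k)) \<le> (norm (?H $ 0) + 1) * norm z ^ N"
  proof eventually_elim
    case (elim z)
    then have "norm (f z - (\<Sum>k<N. F $ k * z ^ k)) = norm z ^ N * norm (eval_fps ?H z)"
      by (simp add: norm_mult norm_power)
    also have "\<dots> \<le> norm z ^ N * (norm (?H $ 0) + 1)"
      using elim by (intro mult_left_mono) auto
    finally show ?case by (simp add: mult.commute)
  qed
  then show ?thesis by blast
qed

text \<open>Letting \<open>z\<close> tend to zero kills the constant coefficient, and dividing by
  \<open>z\<close> lowers both \<open>N\<close> and the degree by one. It serves as uniqueness of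
  Taylor coefficients along the real axis.\<close>

lemma poly_eq_0_if_eventually_small:
  fixes p :: "complex poly"
  assumes "degree p < N"
    and "\<forall>\<^sub>F z in at (0::real). norm (poly p (of_real z)) \<le> B * \<bar>z\<bar> ^ N"
  shows "p = 0"
  using assms
proof (induction N arbitrary: p)
  case (Suc N)
  obtain c q where p: "p = pCons c q" by (cases p)
  have "((\<lambda>z::real. norm (poly p (of_real z))) \<longlongrightarrow> norm (poly p (of_real 0))) (at 0)"
    by (intro tendsto_intros)
  moreover have "((\<lambda>z::real. B * \<bar>z\<bar> ^ Suc N) \<longlongrightarrow> B * \<bar>0\<bar> ^ Suc N) (at 0)"
    by (intro tendsto_intros)
  ultimately have "norm (poly p (of_real 0)) \<le> B * \<bar>0\<bar> ^ Suc N"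
    using Suc.prems(2) by (intro tendsto_le[OF trivial_limit_at])
  then have c: "c = 0" by (simp add: p)
  show ?case
  proof (cases "q = 0")
    case False
    then have "degree q < N" using Suc.prems(1) by (simp add: p)
    moreover have "\<forall>\<^sub>F z in at (0::real). norm (poly q (of_real z)) \<le> B * \<bar>z\<bar> ^ N"
      using Suc.prems(2) eventually_neq_at_within[of 0]
    proof eventually_elim
      case (elim z)
      then have "\<bar>z\<bar> * norm (poly q (of_real z)) \<le> \<bar>z\<bar> * (B * \<bar>z\<bar> ^ N)"
        by (simp add: p c norm_mult mult_ac)
      with elim show ?case by (simp add: mult_le_cancel_left)
    qed
    ultimately have "q = 0" by (rule Suc.IH)
    then show ?thesis by (simp add: p c)
  qed (simp add: p c)
qed simp

text \<open>The recursion between moments and cumulants that results from \<open>\<phi>' = \<kappa>' \<phi>\<close>.\<close>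

fun moment_of_cumulants :: "(nat \<Rightarrow> 'a::comm_semiring_1) \<Rightarrow> nat \<Rightarrow> 'a" where
  "moment_of_cumulants c 0 = 1"
| "moment_of_cumulants c (Suc n) =
     (\<Sum>k\<le>n. of_nat (n choose k) * c (Suc k) * moment_of_cumulants c (n - k))"

lemma of_real_moment_of_cumulants:
  "of_real (moment_of_cumulants c n) = (moment_of_cumulants (\<lambda>k. of_real (c k)) n :: 'a::{real_algebra_1,comm_semiring_1})"
proof (induction n rule: less_induct)
  case (less n)
  then show ?case by (cases n) (auto intro!: sum.cong)
qed

text \<open>The series F of the exponential of a polynomial P satisfies F' = P' F, and comparing
  coefficients gives the recursion of \<open>moment_of_cumulants\<close>. The agreement is only
  claimed up to order \<open>N\<close>, where P is cut off, and that is all an error of order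
  \<open>Suc N\<close> requires.\<close>

lemma exp_polynomial_expansion:
  fixes c :: "nat \<Rightarrow> complex"
  shows "\<exists>B. \<forall>\<^sub>F z in nhds 0. norm (exp (\<Sum>k=1..N. c k * z ^ k / fact k) -
     (\<Sum>n\<le>N. moment_of_cumulants c n * z ^ n / fact n)) \<le> B * norm z ^ Suc N"
proof -
  define P :: "complex fps" where "P = (\<Sum>k=1..N. fps_const (c k / fact k) * fps_X ^ k)"
  have Pn: "P $ k = (if 1 \<le> k \<and> k \<le> N then c k / fact k else 0)" for k
    by (auto simp: P_def fps_sum_nth if_distrib[of "\<lambda>x. _ * x"] cong: if_cong)
  have "(\<lambda>z. \<Sum>k=1..N. c k / fact k * z ^ k) has_fps_expansion P"
    unfolding P_def by (intro fps_expansion_intros)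
  then have "(exp \<circ> (\<lambda>z. \<Sum>k=1..N. c k / fact k * z ^ k)) has_fps_expansion fps_compose (fps_exp 1) P"
    using has_fps_expansion_exp[of "1::complex"] by (intro has_fps_expansion_compose) (auto simp: Pn)
  moreover define F where "F = fps_compose (fps_exp 1) P"
  ultimately have F: "(\<lambda>z. exp (\<Sum>k=1..N. c k * z ^ k / fact k)) has_fps_expansion F"
    by (simp add: o_def)
  have F0: "F $ 0 = 1" by (simp add: F_def)
  have "fps_deriv F = F * fps_deriv P"
    unfolding F_def by (subst fps_compose_deriv) (auto simp: Pn)
  then have *: "fps_deriv F = fps_deriv P * F" by (simp add: mult.commute)
  have rec: "of_nat (Suc n) * F $ Suc n = (\<Sum>k\<le>n. of_nat (Suc k) * P $ Suc k * F $ (n - k))" for n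
  proof -
    have "of_nat (Suc n) * F $ Suc n = fps_deriv F $ n" by simp
    then show ?thesis by (simp add: * fps_mult_nth atLeast0AtMost)
  qed
  have Fn: "F $ n = moment_of_cumulants c n / fact n" if "n \<le> N" for n
    using that
  proof (induction n rule: less_induct)
    case (less n)
    show ?case
    proof (cases n)
      case 0
      then show ?thesis by (simp add: F0)
    next
      case (Suc m)
      have "of_nat (Suc m) * F $ Suc m =
          (\<Sum>k\<le>m. of_nat (m choose k) * c (Suc k) * moment_of_cumulants c (m - k) / fact m)"
        unfolding rec
      proof (intro sum.cong refl)
        fix k assume k: "k \<in> {..m}"
        then have "of_nat (Suc k) * P $ Suc k * F $ (m - k) =
           of_nat (Suc k) * (c (Suc k) / fact (Suc k)) * (moment_of_cumulants c (m - k) / fact (m - k))"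
          using less Suc by (simp add: Pn del: fact_Suc of_nat_Suc)
        also have "\<dots> = c (Suc k) * moment_of_cumulants c (m - k) / (fact k * fact (m - k))"
          by (subst fact_Suc) (simp add: divide_simps del: of_nat_Suc fact_Suc)
        also have "\<dots> = of_nat (m choose k) * c (Suc k) * moment_of_cumulants c (m - k) / fact m"
          using k by (simp add: binomial_fact field_simps)
        finally show "of_nat (Suc k) * P $ Suc k * F $ (m - k) =
          of_nat (m choose k) * c (Suc k) * moment_of_cumulants c (m - k) / fact m" .
      qed
      also have "\<dots> = moment_of_cumulants c (Suc m) / fact m"
        by (simp add: sum_divide_distrib)
      finally show ?thesis
        using Suc by (simp add: field_simps del: of_nat_Suc moment_of_cumulants.simps)
    qed
  qed
  show ?thesis
    using has_fps_expansion_truncation_error[OF F, of "Suc N"]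
    by (simp add: Fn lessThan_Suc_atMost cong: sum.cong_simp)
qed

text \<open>Only the real part is kept, because it is what the modulus of a characteristic function
  determines. The degree is strictly below \<open>N\<close> so that a central difference of order
  \<open>N\<close> annihilates \<open>p\<close>.\<close>

lemma analytic_near_zero_Re_expansion:
  assumes "analytic_near_zero \<kappa>" "N > 0"
  shows "\<exists>p B. degree p < N \<and> (\<forall>\<^sub>F \<zeta> in nhds 0. \<bar>Re (\<kappa> \<zeta>) - poly p \<zeta>\<bar> \<le> B * \<bar>\<zeta>\<bar> ^ N)"
proof -
  obtain g where g: "g analytic_on {0}" "\<forall>\<^sub>F \<zeta> in nhds 0. \<kappa> \<zeta> = g (complex_of_real \<zeta>)"
    using assms by (auto simp: analytic_near_zero_def)
  define F where "F = fps_expansion g 0"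
  obtain B where B: "\<forall>\<^sub>F z in nhds 0. norm (g z - (\<Sum>k<N. F $ k * z ^ k)) \<le> B * norm z ^ N"
    using has_fps_expansion_truncation_error[OF analytic_at_imp_has_fps_expansion_0[OF g(1)]] F_def by blast
  have "filterlim complex_of_real (nhds 0) (nhds 0)"
    using isCont_tendsto_nhds[where f = complex_of_real and a = 0] by simp
  from eventually_compose_filterlim[OF B this]
  have ev: "\<forall>\<^sub>F \<zeta> in nhds 0. norm (g (of_real \<zeta>) - (\<Sum>k<N. F $ k * of_real \<zeta> ^ k)) \<le> B * norm (complex_of_real \<zeta>) ^ N" .
  define p where "p = (\<Sum>k<N. monom (Re (F $ k)) k)"
  have Re: "Re (\<Sum>k<N. F $ k * of_real \<zeta> ^ k) = poly p \<zeta>" for \<zeta>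
    by (simp add: p_def poly_sum poly_monom Re_sum of_real_power[symmetric] del: of_real_power)
  have "\<forall>\<^sub>F \<zeta> in nhds 0. \<bar>Re (\<kappa> \<zeta>) - poly p \<zeta>\<bar> \<le> B * \<bar>\<zeta>\<bar> ^ N"
    using ev g(2)
  proof eventually_elim
    case (elim \<zeta>)
    have "\<bar>Re (\<kappa> \<zeta>) - poly p \<zeta>\<bar> = \<bar>Re (g (of_real \<zeta>) - (\<Sum>k<N. F $ k * of_real \<zeta> ^ k))\<bar>"
      by (simp add: elim Re[symmetric])
    also have "\<dots> \<le> norm (g (of_real \<zeta>) - (\<Sum>k<N. F $ k * of_real \<zeta> ^ k))"
      by (rule abs_Re_le_cmod)
    finally show ?case using elim by simp
  qed
  moreover have "degree p < N"
    unfolding p_def using assms(2)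
    by (intro degree_sum_less) (auto intro: le_less_trans[OF degree_monom_le])
  ultimately show ?thesis by blast
qed

lemma norm_exp_minus_one_le:
  fixes z :: complex
  assumes "norm z \<le> 1"
  shows "norm (exp z - 1) \<le> 3 * norm z"
proof -
  have "norm (exp z - 1) \<le> exp \<bar>Re z\<bar> * norm z"
    using Taylor_exp[of z 0] by simp
  also have "\<dots> \<le> 3 * norm z"
  proof (intro mult_right_mono)
    have "\<bar>Re z\<bar> \<le> 1" using abs_Re_le_cmod[of z] assms by linarith
    then have "exp \<bar>Re z\<bar> \<le> exp 1" by simp
    also have "exp (1::real) \<le> 3" by (rule exp_le)
    finally show "exp \<bar>Re z\<bar> \<le> 3" .
  qed simp
  finally show ?thesis .
qed

text \<open>Compare through the exponential of the Taylor polynomial P of \<open>K\<close>: exp K -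
  exp P = exp P (exp (K - P) - 1). Here exp P stays bounded near zero, and the last factor is at
  most three times the error of \<open>K\<close>.\<close>

lemma exp_expansion_transfer:
  fixes K :: "real \<Rightarrow> complex" and c :: "nat \<Rightarrow> real"
  assumes "\<forall>\<^sub>F \<zeta> in nhds 0. norm (K \<zeta> - (\<Sum>k=1..N. of_real (c k) * (\<i> * of_real \<zeta>) ^ k / fact k)) \<le> B * \<bar>\<zeta>\<bar> ^ Suc N"
  shows "\<exists>B. \<forall>\<^sub>F \<zeta> in nhds 0. norm (exp (K \<zeta>) -
      (\<Sum>n\<le>N. of_real (moment_of_cumulants c n) * (\<i> * of_real \<zeta>) ^ n / fact n)) \<le> B * \<bar>\<zeta>\<bar> ^ Suc N"
proof -
  let ?P = "\<lambda>\<zeta>. (\<Sum>k=1..N. of_real (c k) * (\<i> * of_real \<zeta>) ^ k / fact k)"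
  let ?Q = "\<lambda>\<zeta>. (\<Sum>n\<le>N. of_real (moment_of_cumulants c n) * (\<i> * of_real \<zeta>) ^ n / fact n)"
  obtain B' where B': "\<forall>\<^sub>F z in nhds 0. norm (exp (\<Sum>k=1..N. of_real (c k) * z ^ k / fact k) -
     (\<Sum>n\<le>N. moment_of_cumulants (\<lambda>k. complex_of_real (c k)) n * z ^ n / fact n)) \<le> B' * norm z ^ Suc N"
    using exp_polynomial_expansion[of "\<lambda>k. complex_of_real (c k)" N] by blast
  have "filterlim (\<lambda>\<zeta>. \<i> * complex_of_real \<zeta>) (nhds 0) (nhds 0)"
    using isCont_tendsto_nhds[where f = "\<lambda>\<zeta>. \<i> * complex_of_real \<zeta>" and a = 0] by simp
  from eventually_compose_filterlim[OF B' this]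
  have e1: "\<forall>\<^sub>F \<zeta> in nhds 0. norm (exp (?P \<zeta>) - ?Q \<zeta>) \<le> B' * \<bar>\<zeta>\<bar> ^ Suc N"
    by (simp add: of_real_moment_of_cumulants norm_mult del: power_Suc)
  have l1: "((\<lambda>\<zeta>. B * \<bar>\<zeta>\<bar> ^ Suc N) \<longlongrightarrow> 0) (nhds 0)"
    using isCont_tendsto_nhds[where f = "\<lambda>\<zeta>. B * \<bar>\<zeta>\<bar> ^ Suc N" and a = 0] by simp
  then have e2: "\<forall>\<^sub>F \<zeta> in nhds 0. B * \<bar>\<zeta>\<bar> ^ Suc N < 1"
    by (rule order_tendstoD(2)) simp
  have "((\<lambda>\<zeta>. norm (exp (?P \<zeta>))) \<longlongrightarrow> norm (exp (?P 0))) (nhds 0)"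
    by (intro isCont_tendsto_nhds continuous_intros) auto
  then have e3: "\<forall>\<^sub>F \<zeta> in nhds 0. norm (exp (?P \<zeta>)) < norm (exp (?P 0)) + 1"
    by (rule order_tendstoD(2)) simp
  define D where "D = norm (exp (?P 0)) + 1"
  show ?thesis
  proof (intro exI)
    show "\<forall>\<^sub>F \<zeta> in nhds 0. norm (exp (K \<zeta>) - ?Q \<zeta>) \<le> (D * (3 * B) + B') * \<bar>\<zeta>\<bar> ^ Suc N"
      using e1 e2 e3 assms
    proof eventually_elim
      case (elim \<zeta>)
      have "exp (K \<zeta>) - exp (?P \<zeta>) = exp (?P \<zeta>) * (exp (K \<zeta> - ?P \<zeta>) - 1)"
        by (simp add: exp_diff field_simps)
      then have "norm (exp (K \<zeta>) - exp (?P \<zeta>)) = norm (exp (?P \<zeta>)) * norm (exp (K \<zeta> - ?P \<zeta>) - 1)"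
        by (simp only: norm_mult)
      also have "\<dots> \<le> D * (3 * (B * \<bar>\<zeta>\<bar> ^ Suc N))"
        using elim by (intro mult_mono order_trans[OF norm_exp_minus_one_le]) (auto simp: D_def simp del: norm_exp_eq_Re)
      finally have "norm (exp (K \<zeta>) - exp (?P \<zeta>)) \<le> D * (3 * (B * \<bar>\<zeta>\<bar> ^ Suc N))" .
      moreover have "norm (exp (K \<zeta>) - ?Q \<zeta>) \<le> norm (exp (K \<zeta>) - exp (?P \<zeta>)) + norm (exp (?P \<zeta>) - ?Q \<zeta>)"
        using norm_triangle_ineq[of "exp (K \<zeta>) - exp (?P \<zeta>)" "exp (?P \<zeta>) - ?Q \<zeta>"] by simp
      ultimately show ?case
        using elim(1) by (simp add: algebra_simps)
    qed
  qed
qed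

lemma (in prob_space) integral_one_minus_cos:
  assumes [measurable]: "Y \<in> borel_measurable M"
  shows "integrable M (\<lambda>x. 1 - cos (\<zeta> * Y x))"
    "(\<integral>x. 1 - cos (\<zeta> * Y x) \<partial>M) = 1 - Re (char (distr M borel Y) \<zeta>)"
proof -
  have i_iexp: "integrable M (\<lambda>x. iexp (\<zeta> * Y x))"
    by (intro integrable_const_bound[of _ 1]) auto
  have "Re (CLINT x|M. iexp (\<zeta> * Y x)) = (\<integral>x. cos (\<zeta> * Y x) \<partial>M)"
    by (subst integral_Re[OF i_iexp, symmetric]) (simp add: Re_exp)
  moreover have ic: "integrable M (\<lambda>x. cos (\<zeta> * Y x))"
    by (intro integrable_const_bound[of _ 1]) auto
  ultimately show "(\<integral>x. 1 - cos (\<zeta> * Y x) \<partial>M) = 1 - Re (char (distr M borel Y) \<zeta>)"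
    by (simp add: char_def integral_distr prob_space)
  show "integrable M (\<lambda>x. 1 - cos (\<zeta> * Y x))" using ic by simp
qed

text \<open>Existence comes first, from even central differences of one minus the real part of the
  characteristic function. Only then can the characteristic function be expanded with the true
  moments, and uniqueness of the expansion identifies them.\<close>

lemma (in prob_space) moments_eq_moment_of_cumulants:
  fixes Y :: "'a \<Rightarrow> real" and K :: "real \<Rightarrow> complex" and c :: "nat \<Rightarrow> real"
  assumes Y [measurable]: "Y \<in> borel_measurable M"
    and ch: "\<And>\<zeta>. char (distr M borel Y) \<zeta> = exp (K \<zeta>)"
    and K: "\<And>N. N > 0 \<Longrightarrow> \<exists>B. \<forall>\<^sub>F \<zeta> in nhds 0.
      norm (K \<zeta> - (\<Sum>k=1..N. of_real (c k) * (\<i> * of_real \<zeta>) ^ k / fact k)) \<le> B * \<bar>\<zeta>\<bar> ^ Suc N"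
  shows "integrable M (\<lambda>x. Y x ^ n)" "expectation (\<lambda>x. Y x ^ n) = moment_of_cumulants c n"
proof -
  let ?m = "moment_of_cumulants c"
  interpret D: real_distribution "distr M borel Y"
    by (rule real_distribution_distr) simp
  have ex: "\<exists>B. \<forall>\<^sub>F \<zeta> in nhds 0. norm (char (distr M borel Y) \<zeta> -
      (\<Sum>n\<le>N. of_real (?m n) * (\<i> * of_real \<zeta>) ^ n / fact n)) \<le> B * \<bar>\<zeta>\<bar> ^ Suc N" if "N > 0" for N
    unfolding ch using K[OF that] exp_expansion_transfer by blast
  note Re = integral_one_minus_cos[OF Y]
  have even: "integrable M (\<lambda>x. Y x ^ (2 * n))" if n: "n > 0" for n
  proof -
    \<comment> \<open>The expansion to odd order leaves a remainder of order exactly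
      \<open>2 * n\<close>, which fits both the degree bound and the error exponent of
      \<open>even_moment_bound\<close>.\<close>
    define N where "N = 2 * n - 1"
    have N: "N > 0" "Suc N = 2 * n" using n by (auto simp: N_def)
    obtain B where B: "\<forall>\<^sub>F \<zeta> in nhds 0. norm (char (distr M borel Y) \<zeta> -
      (\<Sum>n\<le>N. of_real (?m n) * (\<i> * of_real \<zeta>) ^ n / fact n)) \<le> B * \<bar>\<zeta>\<bar> ^ Suc N"
      using ex[OF N(1)] by blast
    define p where "p = 1 - (\<Sum>k\<le>N. monom (Re (of_real (?m k) * \<i> ^ k / fact k)) k)"
    have p: "1 - Re (\<Sum>n\<le>N. of_real (?m n) * (\<i> * of_real \<zeta>) ^ n / fact n) = poly p \<zeta>" for \<zeta>
    proof -
      have "Re (of_real (?m n) * (\<i> * of_real \<zeta>) ^ n / fact n) = Re (of_real (?m n) * \<i> ^ n / fact n) * \<zeta> ^ n" for n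
      proof -
        have "of_real (?m n) * (\<i> * of_real \<zeta>) ^ n / fact n = of_real (?m n) * \<i> ^ n / fact n * of_real (\<zeta> ^ n)"
          by (simp add: power_mult_distrib)
        then show ?thesis by (metis Re_complex_of_real Im_complex_of_real mult_zero_right diff_zero times_complex.simps(1))
      qed
      then show ?thesis
        by (simp add: p_def poly_sum poly_monom Re_sum)
    qed
    have "degree p < 2 * n"
      unfolding p_def N(2)[symmetric]
      by (intro degree_diff_less degree_sum_less) (auto intro: le_less_trans[OF degree_monom_le])
    moreover have "\<forall>\<^sub>F z in nhds 0. integrable M (\<lambda>x. 1 - cos (z * Y x)) \<and>
               \<bar>(\<integral>x. 1 - cos (z * Y x) \<partial>M) - poly p z\<bar> \<le> B * \<bar>z\<bar> ^ (2 * n)"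
      using B
    proof eventually_elim
      case (elim z)
      let ?S = "\<Sum>n\<le>N. of_real (?m n) * (\<i> * of_real z) ^ n / fact n"
      have "\<bar>(\<integral>x. 1 - cos (z * Y x) \<partial>M) - poly p z\<bar> = \<bar>Re (char (distr M borel Y) z - ?S)\<bar>"
        by (simp add: Re(2) p[symmetric])
      moreover have "\<bar>Re (char (distr M borel Y) z - ?S)\<bar> \<le> norm (char (distr M borel Y) z - ?S)"
        by (rule abs_Re_le_cmod)
      ultimately show ?case
        using elim Re(1)[of z] unfolding N(2) by auto
    qed
    ultimately have "(\<integral>\<^sup>+x. ennreal (Y x ^ (2 * n)) \<partial>M) \<le> ennreal (B * cdiff_norm n)"
      by (intro even_moment_bound n) auto
    then show ?thesis
      by (intro integrableI_nonneg) (auto simp: zero_le_even_power intro: le_less_trans)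
  qed
  show int: "integrable M (\<lambda>x. Y x ^ n)" for n
  proof (rule Bochner_Integration.integrable_bound[OF Bochner_Integration.integrable_add[OF integrable_const[of 1] even[of "Suc n"]]])
    have "\<bar>y\<bar> ^ n \<le> 1 + y ^ (2 * Suc n)" for y :: real
    proof (cases "\<bar>y\<bar> \<le> 1")
      case True
      then have "\<bar>y\<bar> ^ n \<le> 1" by (simp add: power_le_one)
      moreover have "0 \<le> y ^ (2 * Suc n)" by (rule zero_le_even_power) simp
      ultimately show ?thesis by linarith
    next
      case False
      then have "\<bar>y\<bar> ^ n \<le> \<bar>y\<bar> ^ (2 * Suc n)" by (intro power_increasing) auto
      also have "\<dots> = y ^ (2 * Suc n)" by (rule power_even_abs) simp
      finally show ?thesis by simp
    qed
    then show "AE x in M. norm (Y x ^ n) \<le> norm (1 + Y x ^ (2 * Suc n))"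
      by (auto simp: power_abs zero_le_even_power simp del: mult_Suc_right)
  qed auto
  show "expectation (\<lambda>x. Y x ^ n) = ?m n"
  proof -
    \<comment> \<open>One order more than \<open>n\<close>, so that \<open>N > 0\<close> holds also
      for \<open>n = 0\<close>.\<close>
    define N where "N = Suc n"
    obtain B where B: "\<forall>\<^sub>F \<zeta> in nhds 0. norm (char (distr M borel Y) \<zeta> -
      (\<Sum>n\<le>N. of_real (?m n) * (\<i> * of_real \<zeta>) ^ n / fact n)) \<le> B * \<bar>\<zeta>\<bar> ^ Suc N"
      using ex[of N] by (auto simp: N_def)
    let ?e = "\<lambda>k. expectation (\<lambda>x. Y x ^ k)"
    have di: "integrable (distr M borel Y) (\<lambda>x. x ^ k)" for k
      by (subst integrable_distr_eq) (auto intro: int)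
    have de: "D.expectation (\<lambda>x. x ^ k) = ?e k" for k
      by (subst integral_distr) auto
    define B2 where "B2 = 2 / fact (Suc N) * D.expectation (\<lambda>x. \<bar>x\<bar> ^ Suc N)"
    have 2: "norm (char (distr M borel Y) \<zeta> - (\<Sum>k\<le>Suc N. (\<i> * \<zeta>) ^ k / fact k * ?e k)) \<le> B2 * \<bar>\<zeta>\<bar> ^ Suc N" for \<zeta>
      using D.char_approx1[of "Suc N" \<zeta>, OF di] unfolding de B2_def by (simp add: mult_ac del: sum.atMost_Suc fact_Suc power_Suc)
    \<comment> \<open>\<open>char_approx1\<close> has a remainder of order \<open>Suc N\<close>
      after a sum that itself reaches order \<open>Suc N\<close>, one term beyond the cumulant
      expansion; \<open>B3\<close> absorbs this extra term.\<close>
    define B3 where "B3 = norm (?e (Suc N)) / fact (Suc N)"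
    define p where "p = (\<Sum>k\<le>N. monom (\<i> ^ k / fact k * (of_real (?e k) - of_real (?m k))) k)"
    have p: "poly p (of_real \<zeta>) = (\<Sum>k\<le>N. (\<i> * \<zeta>) ^ k / fact k * ?e k) - (\<Sum>n\<le>N. of_real (?m n) * (\<i> * of_real \<zeta>) ^ n / fact n)" for \<zeta> :: real
      by (simp add: p_def poly_sum poly_monom sum_subtractf[symmetric] power_mult_distrib algebra_simps)
    have deg: "degree p < Suc N"
      unfolding p_def by (intro degree_sum_less) (auto intro: le_less_trans[OF degree_monom_le])
    have "\<forall>\<^sub>F \<zeta> in nhds 0. norm (poly p (of_real \<zeta>)) \<le> (B + B2 + B3) * \<bar>\<zeta>\<bar> ^ Suc N"
      using B
    proof eventually_elim
      case (elim \<zeta>)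
      let ?c = "char (distr M borel Y) \<zeta>" and ?S = "\<Sum>n\<le>N. of_real (?m n) * (\<i> * of_real \<zeta>) ^ n / fact n"
      let ?E = "\<Sum>k\<le>Suc N. (\<i> * \<zeta>) ^ k / fact k * ?e k" and ?l = "(\<i> * \<zeta>) ^ Suc N / fact (Suc N) * ?e (Suc N)"
      have "poly p (of_real \<zeta>) = (?c - ?S) - (?c - ?E) - ?l"
        by (simp add: p)
      then have "norm (poly p (of_real \<zeta>)) \<le> norm (?c - ?S) + norm (?c - ?E) + norm ?l"
        by (smt (verit) norm_triangle_ineq4)
      moreover have "norm ?l = B3 * \<bar>\<zeta>\<bar> ^ Suc N"
        by (simp add: B3_def norm_mult norm_divide norm_power del: fact_Suc power_Suc)
      ultimately show ?case
        using elim 2[of \<zeta>] by (simp add: algebra_simps del: sum.atMost_Suc)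
    qed
    then have "\<forall>\<^sub>F \<zeta> in at 0. norm (poly p (of_real \<zeta>)) \<le> (B + B2 + B3) * \<bar>\<zeta>\<bar> ^ Suc N"
      by (auto simp: eventually_at_filter elim: eventually_mono)
    with deg have "p = 0" by (rule poly_eq_0_if_eventually_small)
    then have "coeff p n = 0" by simp
    then have "\<i> ^ n / fact n * (complex_of_real (?e n) - of_real (?m n)) = 0"
      by (simp add: p_def coeff_sum N_def)
    then have "complex_of_real (?e n) = of_real (?m n)" by simp
    then show ?thesis by (simp only: of_real_eq_iff)
  qed
qed

section \<open>Integrals against a Levy basis\<close>

text \<open>Where \<open>Y n\<close> and \<open>Z\<close> differ by at most \<open>e\<close>, the
  exponentials differ by at most \<open>\<bar>\<zeta>\<bar> * e\<close>; on the remaining event,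
  whose probability tends to zero, they differ by at most 2.\<close>

lemma (in prob_space) converges_in_probability_char:
  assumes Y [measurable]: "\<And>n. Y n \<in> borel_measurable M" and conv: "converges_in_probability M Y Z"
  shows "(\<lambda>n. char (distr M borel (Y n)) \<zeta>) \<longlonglongrightarrow> char (distr M borel Z) \<zeta>"
proof -
  have Z [measurable]: "Z \<in> borel_measurable M"
    using conv by (simp add: converges_in_probability_def)
  have ch: "char (distr M borel W) \<zeta> = (CLINT x|M. iexp (\<zeta> * W x))" if [measurable]: "W \<in> borel_measurable M" for W
    by (simp add: char_def integral_distr)
  have ii: "integrable M (\<lambda>x. iexp (\<zeta> * W x))" if [measurable]: "W \<in> borel_measurable M" for W
    by (intro integrable_const_bound[of _ 1]) auto
  have bound: "norm (char (distr M borel (Y n)) \<zeta> - char (distr M borel Z) \<zeta>) \<le>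
      \<bar>\<zeta>\<bar> * e + 2 * measure M {\<omega> \<in> space M. e < \<bar>Y n \<omega> - Z \<omega>\<bar>}" if "e > 0" for n e
  proof -
    let ?B = "{\<omega> \<in> space M. e < \<bar>Y n \<omega> - Z \<omega>\<bar>}"
    have "char (distr M borel (Y n)) \<zeta> - char (distr M borel Z) \<zeta> =
        (CLINT x|M. iexp (\<zeta> * Y n x) - iexp (\<zeta> * Z x))"
      unfolding ch[OF Y] ch[OF Z] by (rule Bochner_Integration.integral_diff[symmetric, OF ii[OF Y] ii[OF Z]])
    also have "norm \<dots> \<le> (\<integral>x. norm (iexp (\<zeta> * Y n x) - iexp (\<zeta> * Z x)) \<partial>M)"
      by (rule integral_norm_bound)
    also have "\<dots> \<le> (\<integral>x. \<bar>\<zeta>\<bar> * e + 2 * indicator ?B x \<partial>M)"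
    proof (rule integral_mono)
      show "integrable M (\<lambda>x. norm (iexp (\<zeta> * Y n x) - iexp (\<zeta> * Z x)))"
        by (intro integrable_norm Bochner_Integration.integrable_diff ii) auto
      show "integrable M (\<lambda>x. \<bar>\<zeta>\<bar> * e + 2 * indicator ?B x)"
        by (intro Bochner_Integration.integrable_add integrable_mult_right integrable_real_indicator) (auto simp: emeasure_eq_measure)
      fix x assume x: "x \<in> space M"
      show "norm (iexp (\<zeta> * Y n x) - iexp (\<zeta> * Z x)) \<le> \<bar>\<zeta>\<bar> * e + 2 * indicator ?B x"
      proof (cases "x \<in> ?B")
        case True
        have "norm (iexp (\<zeta> * Y n x) - iexp (\<zeta> * Z x)) \<le> norm (iexp (\<zeta> * Y n x)) + norm (iexp (\<zeta> * Z x))"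
          by (rule norm_triangle_ineq4)
        also have "\<dots> = 2" by (simp del: of_real_mult)
        finally show ?thesis using True that by (simp add: add_increasing)
      next
        case False
        have "iexp (\<zeta> * Y n x) - iexp (\<zeta> * Z x) = iexp (\<zeta> * Z x) * (iexp (\<zeta> * (Y n x - Z x)) - 1)"
          by (simp add: algebra_simps exp_add[symmetric])
        then have "norm (iexp (\<zeta> * Y n x) - iexp (\<zeta> * Z x)) = norm (iexp (\<zeta> * (Y n x - Z x)) - 1)"
          by (simp add: norm_mult del: of_real_mult of_real_diff)
        also have "\<dots> \<le> \<bar>\<zeta> * (Y n x - Z x)\<bar>"
          using iexp_approx1[of "\<zeta> * (Y n x - Z x)" 0] by simp
        also have "\<dots> \<le> \<bar>\<zeta>\<bar> * e"
          using False x by (auto simp: abs_mult intro!: mult_left_mono)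
        finally show ?thesis using False by simp
      qed
    qed
    also have "\<dots> = \<bar>\<zeta>\<bar> * e + 2 * measure M ?B"
      by (subst Bochner_Integration.integral_add)
         (auto simp: prob_space emeasure_eq_measure intro!: integrable_mult_right)
    finally show ?thesis .
  qed
  show ?thesis
  proof (rule LIMSEQ_I)
    fix r :: real assume r: "r > 0"
    \<comment> \<open>Makes \<open>\<bar>\<zeta>\<bar> * e\<close> at most half of \<open>r\<close>;
      the added 1 avoids division by zero at \<open>\<zeta> = 0\<close>.\<close>
    define e where "e = r / (2 * (\<bar>\<zeta>\<bar> + 1))"
    have e: "e > 0" using r by (simp add: e_def)
    have "\<bar>\<zeta>\<bar> * e \<le> (\<bar>\<zeta>\<bar> + 1) * e" using e by (intro mult_right_mono) auto
    also have "\<dots> = r / 2"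
    proof -
      have "\<bar>\<zeta>\<bar> + 1 \<noteq> 0" using abs_ge_zero[of \<zeta>] by linarith
      then show ?thesis unfolding e_def by (simp add: divide_simps)
    qed
    finally have e2: "\<bar>\<zeta>\<bar> * e \<le> r / 2" .
    have "\<forall>\<^sub>F n in sequentially. measure M {\<omega> \<in> space M. e < \<bar>Y n \<omega> - Z \<omega>\<bar>} < r / 4"
      using conv e r unfolding converges_in_probability_def by (intro order_tendstoD(2)) auto
    then show "\<exists>no. \<forall>n\<ge>no. norm (char (distr M borel (Y n)) \<zeta> - char (distr M borel Z) \<zeta>) < r"
      unfolding eventually_sequentially
    proof (elim exE, intro exI allI impI)
      fix N n assume "\<forall>n\<ge>N. measure M {\<omega> \<in> space M. e < \<bar>Y n \<omega> - Z \<omega>\<bar>} < r / 4" "N \<le> n"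
      then have "measure M {\<omega> \<in> space M. e < \<bar>Y n \<omega> - Z \<omega>\<bar>} < r / 4" by blast
      with bound[OF e, of n] e2 show "norm (char (distr M borel (Y n)) \<zeta> - char (distr M borel Z) \<zeta>) < r"
        by linarith
    qed
  qed
qed

text \<open>The combination is allowed to hold almost surely because a Levy basis is additive only
  up to null sets, and so is the integral of simple functions.\<close>

lemma (in prob_space) converges_in_probability_linear:
  assumes Y [measurable]: "\<And>n. Y n \<in> borel_measurable M" "\<And>n. Y' n \<in> borel_measurable M" "\<And>n. Y'' n \<in> borel_measurable M"
    and conv: "converges_in_probability M Y Z" "converges_in_probability M Y' Z'"
    and eq: "\<And>n. AE \<omega> in M. Y'' n \<omega> = Y n \<omega> + d * Y' n \<omega>"
  shows "converges_in_probability M Y'' (\<lambda>\<omega>. Z \<omega> + d * Z' \<omega>)"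
proof -
  have Z [measurable]: "Z \<in> borel_measurable M" "Z' \<in> borel_measurable M"
    using conv by (simp_all add: converges_in_probability_def)
  show ?thesis
    unfolding converges_in_probability_def
  proof (intro conjI allI impI)
    fix e :: real assume e: "e > 0"
    define e' where "e' = e / (2 * (\<bar>d\<bar> + 1))"
    have e': "e' > 0" using e by (simp add: e'_def)
    have "\<bar>d\<bar> + 1 \<noteq> 0" using abs_ge_zero[of d] by linarith
    then have "(\<bar>d\<bar> + 1) * e' = e / 2" unfolding e'_def by (simp add: divide_simps)
    then have de: "\<bar>d\<bar> * e' \<le> e / 2" using e' by (simp add: algebra_simps)
    have bd: "measure M {\<omega> \<in> space M. e < \<bar>Y'' n \<omega> - (Z \<omega> + d * Z' \<omega>)\<bar>} \<le>
        measure M {\<omega> \<in> space M. e / 2 < \<bar>Y n \<omega> - Z \<omega>\<bar>} + measure M {\<omega> \<in> space M. e' < \<bar>Y' n \<omega> - Z' \<omega>\<bar>}" for n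
    proof -
      have "measure M {\<omega> \<in> space M. e < \<bar>Y'' n \<omega> - (Z \<omega> + d * Z' \<omega>)\<bar>} \<le>
        measure M ({\<omega> \<in> space M. e / 2 < \<bar>Y n \<omega> - Z \<omega>\<bar>} \<union> {\<omega> \<in> space M. e' < \<bar>Y' n \<omega> - Z' \<omega>\<bar>})"
      proof (rule finite_measure_mono_AE)
        show "AE x in M. x \<in> {\<omega> \<in> space M. e < \<bar>Y'' n \<omega> - (Z \<omega> + d * Z' \<omega>)\<bar>} \<longrightarrow>
            x \<in> {\<omega> \<in> space M. e / 2 < \<bar>Y n \<omega> - Z \<omega>\<bar>} \<union> {\<omega> \<in> space M. e' < \<bar>Y' n \<omega> - Z' \<omega>\<bar>}"
          using eq[of n]
        proof eventually_elim
          case (elim x)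
          have "\<bar>Y'' n x - (Z x + d * Z' x)\<bar> \<le> \<bar>Y n x - Z x\<bar> + \<bar>d\<bar> * \<bar>Y' n x - Z' x\<bar>"
            unfolding elim abs_mult[symmetric] right_diff_distrib by linarith
          moreover have "\<bar>d\<bar> * \<bar>Y' n x - Z' x\<bar> \<le> e / 2" if "\<bar>Y' n x - Z' x\<bar> \<le> e'"
            using mult_left_mono[OF that, of "\<bar>d\<bar>"] de by simp
          ultimately show ?case by (auto simp: not_less)
        qed
      qed measurable
      also have "\<dots> \<le> measure M {\<omega> \<in> space M. e / 2 < \<bar>Y n \<omega> - Z \<omega>\<bar>} + measure M {\<omega> \<in> space M. e' < \<bar>Y' n \<omega> - Z' \<omega>\<bar>}"
        by (rule measure_Un_le) auto
      finally show ?thesis .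
    qed
    have c: "(\<lambda>n. measure M {\<omega> \<in> space M. r < \<bar>U n \<omega> - V \<omega>\<bar>}) \<longlonglongrightarrow> 0"
      if "converges_in_probability M U V" "r > 0" for U V and r :: real
      using that by (simp add: converges_in_probability_def)
    have "(\<lambda>n. measure M {\<omega> \<in> space M. e / 2 < \<bar>Y n \<omega> - Z \<omega>\<bar>} + measure M {\<omega> \<in> space M. e' < \<bar>Y' n \<omega> - Z' \<omega>\<bar>}) \<longlonglongrightarrow> 0 + 0"
      by (rule tendsto_add[OF c[OF conv(1) half_gt_zero[OF e]] c[OF conv(2) e']])
    then have lim: "(\<lambda>n. measure M {\<omega> \<in> space M. e / 2 < \<bar>Y n \<omega> - Z \<omega>\<bar>} + measure M {\<omega> \<in> space M. e' < \<bar>Y' n \<omega> - Z' \<omega>\<bar>}) \<longlonglongrightarrow> 0"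
      by simp
    show "(\<lambda>n. measure M {\<omega> \<in> space M. e < \<bar>Y'' n \<omega> - (Z \<omega> + d * Z' \<omega>)\<bar>}) \<longlonglongrightarrow> 0"
      by (rule Lim_null_comparison[OF _ lim], rule always_eventually, rule allI,
          subst real_norm_def, subst abs_of_nonneg[OF measure_nonneg], rule bd)
  qed simp
qed

text \<open>\<open>levy_basis\<close> only constrains multiples of \<open>\<kappa>\<close> by
  measures of sets. Without a set of positive finite measure it would say nothing about
  \<open>\<kappa>\<close>, hence the separate assumptions on it.\<close>

locale levy_basis_space = prob_space M + C: sigma_finite_measure C
  for M :: "'w measure" and C :: "'s measure" +
  fixes \<kappa> :: "real \<Rightarrow> complex" and \<Lambda> :: "'s set \<Rightarrow> 'w \<Rightarrow> real"
  assumes basis: "levy_basis M C \<kappa> \<Lambda>"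
    and continuous_exponent: "continuous_on UNIV \<kappa>" and exponent_0 [simp]: "\<kappa> 0 = 0"
begin

lemma exponent_measurable [measurable]: "\<kappa> \<in> borel_measurable borel"
  using continuous_exponent by (rule borel_measurable_continuous_onI)

lemma basis_measurable: "A \<in> fmeasurable C \<Longrightarrow> \<Lambda> A \<in> borel_measurable M"
  using basis by (simp add: levy_basis_def)

lemma basis_char: "A \<in> fmeasurable C \<Longrightarrow> char (distr M borel (\<Lambda> A)) \<zeta> = exp (of_real (measure C A) * \<kappa> \<zeta>)"
  using basis by (simp add: levy_basis_def is_cumulant_function_def)

text \<open>The axioms of a Levy basis speak of sequences of sets, so a finite family is listed as a
  sequence that continues with empty sets.\<close>

lemma finite_disjoint_enumeration:
  assumes "finite I" "disjoint_family_on A I" "\<And>i. i \<in> I \<Longrightarrow> A i \<in> fmeasurable C"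
  obtains h :: "nat \<Rightarrow> 'i" and B :: "nat \<Rightarrow> 's set" where
    "bij_betw h {..<card I} I" "range B \<subseteq> fmeasurable C" "disjoint_family B"
    "\<And>k. k < card I \<Longrightarrow> B k = A (h k)" "\<And>k. k \<ge> card I \<Longrightarrow> B k = {}"
proof -
  obtain h where h: "bij_betw h {..<card I} I"
    using ex_bij_betw_nat_finite[OF assms(1)] by (auto simp: atLeast0LessThan)
  define B where "B k = (if k < card I then A (h k) else {})" for k
  show thesis
  proof (rule that[of h B])
    show "range B \<subseteq> fmeasurable C"
      using h assms(3) by (auto simp: B_def bij_betw_def)
    show "disjoint_family B"
      unfolding disjoint_family_on_def
    proof (intro ballI impI)
      fix i j :: nat assume "i \<noteq> j"
      show "B i \<inter> B j = {}"
      proof (cases "i < card I \<and> j < card I")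
        case True
        then have "h i \<noteq> h j" "h i \<in> I" "h j \<in> I"
          using \<open>i \<noteq> j\<close> h by (auto simp: bij_betw_def inj_on_def)
        then show ?thesis
          using assms(2) True by (auto simp: B_def disjoint_family_on_def)
      qed (auto simp: B_def)
    qed
  qed (use h in \<open>auto simp: B_def\<close>)
qed

text \<open>Independence over disjoint sets turns the characteristic function into a product, and
  each coefficient \<open>y i\<close> moves into the argument of \<open>\<kappa>\<close>.\<close>

lemma char_finite_combination:
  fixes y :: "'i \<Rightarrow> real"
  assumes "finite I" "disjoint_family_on A I" and A: "\<And>i. i \<in> I \<Longrightarrow> A i \<in> fmeasurable C"
  shows "char (distr M borel (\<lambda>\<omega>. \<Sum>i\<in>I. y i * \<Lambda> (A i) \<omega>)) \<zeta> =
    exp (\<Sum>i\<in>I. of_real (measure C (A i)) * \<kappa> (\<zeta> * y i))"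
proof -
  obtain h B where hB: "bij_betw h {..<card I} I" "range B \<subseteq> fmeasurable C" "disjoint_family B"
    "\<And>k. k < card I \<Longrightarrow> B k = A (h k)" "\<And>k. k \<ge> card I \<Longrightarrow> B k = {}"
    using finite_disjoint_enumeration[OF assms] by metis
  have "indep_vars (\<lambda>_. borel) (\<lambda>n. \<Lambda> (B n)) UNIV"
    using basis hB(2,3) unfolding levy_basis_def by blast
  then have "indep_vars (\<lambda>_. borel) (\<lambda>n. \<Lambda> (B n)) {..<card I}"
    by (rule indep_vars_subset) simp
  then have ind: "indep_vars (\<lambda>_. borel) (\<lambda>n \<omega>. y (h n) * \<Lambda> (B n) \<omega>) {..<card I}"
    by (rule indep_vars_compose2[where Y = "\<lambda>n z. y (h n) * z"]) simp
  have eq: "(\<Sum>i\<in>I. f i) = (\<Sum>k<card I. f (h k))" for f :: "'i \<Rightarrow> 'b::comm_monoid_add"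
    by (rule sum.reindex_bij_betw[OF hB(1), symmetric])
  have Ak: "A (h k) \<in> fmeasurable C" if "k < card I" for k
    using hB(1) A that by (auto simp: bij_betw_def)
  have "char (distr M borel (\<lambda>\<omega>. \<Sum>i\<in>I. y i * \<Lambda> (A i) \<omega>)) \<zeta> =
      char (distr M borel (\<lambda>\<omega>. \<Sum>k<card I. y (h k) * \<Lambda> (B k) \<omega>)) \<zeta>"
    by (simp add: eq hB(4))
  also have "\<dots> = (\<Prod>k<card I. char (distr M borel (\<lambda>\<omega>. y (h k) * \<Lambda> (B k) \<omega>)) \<zeta>)"
    by (rule char_distr_sum[OF ind])
  also have "\<dots> = (\<Prod>k<card I. exp (of_real (measure C (A (h k))) * \<kappa> (\<zeta> * y (h k))))"
  proof (intro prod.cong refl)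
    fix k assume k: "k \<in> {..<card I}"
    have [measurable]: "\<Lambda> (A (h k)) \<in> borel_measurable M"
      using Ak k by (intro basis_measurable) auto
    have "char (distr M borel (\<lambda>\<omega>. y (h k) * \<Lambda> (B k) \<omega>)) \<zeta> = char (distr M borel (\<Lambda> (A (h k)))) (\<zeta> * y (h k))"
      using k by (simp add: hB(4) char_def integral_distr mult_ac)
    also have "\<dots> = exp (of_real (measure C (A (h k))) * \<kappa> (\<zeta> * y (h k)))"
      using Ak k by (intro basis_char) auto
    finally show "char (distr M borel (\<lambda>\<omega>. y (h k) * \<Lambda> (B k) \<omega>)) \<zeta> = exp (of_real (measure C (A (h k))) * \<kappa> (\<zeta> * y (h k)))" .
  qed
  also have "\<dots> = exp (\<Sum>i\<in>I. of_real (measure C (A i)) * \<kappa> (\<zeta> * y i))"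
    by (simp add: eq exp_sum)
  finally show ?thesis .
qed

text \<open>Additivity for the constant sequence of empty sets: a convergent series with constant
  terms has zero terms.\<close>

lemma basis_empty: "AE \<omega> in M. \<Lambda> {} \<omega> = 0"
proof -
  have "range (\<lambda>n::nat. {} :: 's set) \<subseteq> fmeasurable C" "disjoint_family (\<lambda>n::nat. {} :: 's set)"
    by (auto simp: disjoint_family_on_def)
  then have "AE \<omega> in M. (\<lambda>n::nat. \<Lambda> {} \<omega>) sums \<Lambda> (\<Union>(range (\<lambda>n::nat. {}))) \<omega>"
    using basis[unfolded levy_basis_def, THEN conjunct2, THEN conjunct1, rule_format, of "\<lambda>n. {}"] by simp
  then show ?thesis
  proof eventually_elim
    case (elim \<omega>)
    then have "(\<lambda>n::nat. \<Lambda> {} \<omega>) \<longlonglongrightarrow> 0" by (intro summable_LIMSEQ_zero) (auto simp: sums_iff)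
    then show ?case by (simp add: LIMSEQ_const_iff)
  qed
qed

lemma basis_finite_Union:
  assumes "finite I" "disjoint_family_on A I" and A: "\<And>i. i \<in> I \<Longrightarrow> A i \<in> fmeasurable C"
  shows "AE \<omega> in M. \<Lambda> (\<Union>i\<in>I. A i) \<omega> = (\<Sum>i\<in>I. \<Lambda> (A i) \<omega>)"
proof -
  obtain h B where hB: "bij_betw h {..<card I} I" "range B \<subseteq> fmeasurable C" "disjoint_family B"
    "\<And>k. k < card I \<Longrightarrow> B k = A (h k)" "\<And>k. k \<ge> card I \<Longrightarrow> B k = {}"
    using finite_disjoint_enumeration[OF assms] by metis
  have U: "\<Union>(range B) = (\<Union>i\<in>I. A i)"
  proof -
    have "\<Union>(range B) = (\<Union>k<card I. B k)"
      using hB(5) by (auto simp: not_less[symmetric])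
    also have "\<dots> = (\<Union>i\<in>h ` {..<card I}. A i)" using hB(4) by auto
    also have "h ` {..<card I} = I" using hB(1) by (simp add: bij_betw_def)
    finally show ?thesis .
  qed
  moreover have "(\<Union>i\<in>I. A i) \<in> fmeasurable C"
    using assms by (intro fmeasurable.finite_UN) auto
  ultimately have "AE \<omega> in M. (\<lambda>n. \<Lambda> (B n) \<omega>) sums \<Lambda> (\<Union>i\<in>I. A i) \<omega>"
    using basis[unfolded levy_basis_def, THEN conjunct2, THEN conjunct1, rule_format, OF hB(2,3)] by simp
  then show ?thesis
    using basis_empty
  proof eventually_elim
    case (elim \<omega>)
    have "(\<lambda>n. \<Lambda> (B n) \<omega>) sums (\<Sum>k<card I. \<Lambda> (B k) \<omega>)"
      by (rule sums_finite) (use elim hB(5) in \<open>auto simp: not_less\<close>)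
    with elim have "\<Lambda> (\<Union>i\<in>I. A i) \<omega> = (\<Sum>k<card I. \<Lambda> (B k) \<omega>)" by (simp add: sums_iff)
    also have "\<dots> = (\<Sum>i\<in>I. \<Lambda> (A i) \<omega>)"
      using hB(4) by (simp add: sum.reindex_bij_betw[OF hB(1), symmetric])
    finally show ?case .
  qed
qed

section \<open>Integrals of simple functions\<close>

lemma simple_piece_fmeasurable:
  fixes F :: "'s \<Rightarrow> real"
  assumes "Bochner_Integration.simple_bochner_integrable C F" "A \<in> sets C" "y \<noteq> 0"
  shows "A \<inter> {x \<in> space C. F x = y} \<in> fmeasurable C"
proof (rule fmeasurableI2)
  from assms(1) have F: "simple_function C F" "emeasure C {x \<in> space C. F x \<noteq> 0} \<noteq> \<infinity>"
    by (auto elim: Bochner_Integration.simple_bochner_integrable.cases)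
  have [measurable]: "F \<in> borel_measurable C"
    using F(1) by (rule borel_measurable_simple_function)
  show "{x \<in> space C. F x \<noteq> 0} \<in> fmeasurable C"
    using F(2) by (intro fmeasurableI) (auto simp: less_top)
  show "A \<inter> {x \<in> space C. F x = y} \<in> sets C" using assms(2) by measurable
qed (use assms in auto)

lemma simple_image_finite: "Bochner_Integration.simple_bochner_integrable C F \<Longrightarrow> finite (F ` space C)"
  by (auto elim!: Bochner_Integration.simple_bochner_integrable.cases simp: simple_function_def)

lemma simple_stoch_integral_measurable:
  assumes "Bochner_Integration.simple_bochner_integrable C F" "A \<in> sets C"
  shows "simple_stoch_integral C \<Lambda> A F \<in> borel_measurable M"
  unfolding simple_stoch_integral_def[abs_def]
  by (intro borel_measurable_sum borel_measurable_times borel_measurable_const basis_measurable simple_piece_fmeasurable assms) auto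

lemma simple_exponent_expansion:
  assumes "Bochner_Integration.simple_bochner_integrable C F" "A \<in> sets C"
  shows "integrable C (\<lambda>x. indicator A x *\<^sub>R \<kappa> (\<zeta> * F x))"
    "(CLINT x|C. indicator A x *\<^sub>R \<kappa> (\<zeta> * F x)) =
      (\<Sum>y\<in>F ` space C - {0}. of_real (measure C (A \<inter> {x \<in> space C. F x = y})) * \<kappa> (\<zeta> * y))"
proof -
  let ?E = "\<lambda>y. A \<inter> {x \<in> space C. F x = y}"
  \<comment> \<open>The value 0, whose level set may have infinite measure, drops out because
    \<open>\<kappa> 0 = 0\<close>.\<close>
  have eq: "indicator A x *\<^sub>R \<kappa> (\<zeta> * F x) = (\<Sum>y\<in>F ` space C - {0}. indicator (?E y) x *\<^sub>R \<kappa> (\<zeta> * y))" if "x \<in> space C" for x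
  proof -
    have "(\<Sum>y\<in>F ` space C - {0}. indicator (?E y) x *\<^sub>R \<kappa> (\<zeta> * y)) =
        (\<Sum>y\<in>F ` space C - {0}. if y = F x then indicator A x *\<^sub>R \<kappa> (\<zeta> * y) else 0)"
      using that by (intro sum.cong) (auto simp: indicator_def)
    then show ?thesis
      using simple_image_finite[OF assms(1)] that by (auto simp: sum.delta)
  qed
  have i: "integrable C (\<lambda>x. indicator (?E y) x *\<^sub>R \<kappa> (\<zeta> * y))" if "y \<in> F ` space C - {0}" for y
    using simple_piece_fmeasurable[OF assms, of y] that
    by (intro integrable_scaleR_left integrable_real_indicator) (auto simp: fmeasurable_def)
  have "integrable C (\<lambda>x. \<Sum>y\<in>F ` space C - {0}. indicator (?E y) x *\<^sub>R \<kappa> (\<zeta> * y))"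
    using i by (rule Bochner_Integration.integrable_sum)
  then show "integrable C (\<lambda>x. indicator A x *\<^sub>R \<kappa> (\<zeta> * F x))"
    by (subst Bochner_Integration.integrable_cong[OF refl eq])
  have "(CLINT x|C. indicator A x *\<^sub>R \<kappa> (\<zeta> * F x)) =
      (CLINT x|C. (\<Sum>y\<in>F ` space C - {0}. indicator (?E y) x *\<^sub>R \<kappa> (\<zeta> * y)))"
    by (intro Bochner_Integration.integral_cong eq refl)
  also have "\<dots> = (\<Sum>y\<in>F ` space C - {0}. (CLINT x|C. indicator (?E y) x *\<^sub>R \<kappa> (\<zeta> * y)))"
    using i by (rule Bochner_Integration.integral_sum)
  also have "\<dots> = (\<Sum>y\<in>F ` space C - {0}. of_real (measure C (?E y)) * \<kappa> (\<zeta> * y))"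
  proof (intro sum.cong refl)
    fix y assume y: "y \<in> F ` space C - {0}"
    have "(CLINT x|C. indicator (?E y) x *\<^sub>R \<kappa> (\<zeta> * y)) = (\<integral>x. indicator (?E y) x \<partial>C) *\<^sub>R \<kappa> (\<zeta> * y)"
      using simple_piece_fmeasurable[OF assms, of y] y
      by (intro integral_scaleR_left integrable_real_indicator) (auto simp: fmeasurable_def)
    also have "(\<integral>x. indicator (?E y) x \<partial>C) = measure C (?E y)"
      by (simp add: Int_absorb2 Int_def) (rule arg_cong[of _ _ "measure C"], auto)
    finally show "(CLINT x|C. indicator (?E y) x *\<^sub>R \<kappa> (\<zeta> * y)) = of_real (measure C (?E y)) * \<kappa> (\<zeta> * y)"
      by (simp add: scaleR_conv_of_real)
  qed
  finally show "(CLINT x|C. indicator A x *\<^sub>R \<kappa> (\<zeta> * F x)) =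
      (\<Sum>y\<in>F ` space C - {0}. of_real (measure C (?E y)) * \<kappa> (\<zeta> * y))" .
qed

lemma char_simple_stoch_integral:
  assumes "Bochner_Integration.simple_bochner_integrable C F" "A \<in> sets C"
  shows "char (distr M borel (simple_stoch_integral C \<Lambda> A F)) \<zeta> = exp (CLINT x|C. indicator A x *\<^sub>R \<kappa> (\<zeta> * F x))"
  unfolding simple_stoch_integral_def[abs_def] simple_exponent_expansion(2)[OF assms]
  using simple_image_finite[OF assms(1)]
  by (intro char_finite_combination simple_piece_fmeasurable assms) (auto simp: disjoint_family_on_def)

text \<open>\<open>simple_stoch_integral\<close> sums over values and so treats each level set as
  one piece. Linearity needs it on finer partitions with repeated values; grouping the pieces by
  value and finite additivity of \<open>\<Lambda>\<close> up to null sets provide this.\<close>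

lemma simple_stoch_integral_eq:
  fixes v :: "'i \<Rightarrow> real"
  assumes A: "A \<in> sets C" and I: "finite I" "disjoint_family_on E I" and E: "\<And>i. i \<in> I \<Longrightarrow> E i \<in> fmeasurable C"
    and on: "\<And>i x. i \<in> I \<Longrightarrow> x \<in> E i \<Longrightarrow> F x = v i"
    and off: "\<And>x. x \<in> space C \<Longrightarrow> x \<notin> (\<Union>i\<in>I. E i) \<Longrightarrow> F x = 0"
    and fin: "finite (F ` space C)"
  shows "AE \<omega> in M. simple_stoch_integral C \<Lambda> A F \<omega> = (\<Sum>i\<in>I. v i * \<Lambda> (A \<inter> E i) \<omega>)"
proof -
  let ?V = "v ` I - {0}" and ?W = "F ` space C - {0}"
  let ?P = "\<lambda>y. A \<inter> {x \<in> space C. F x = y}"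
  have Esp: "E i \<subseteq> space C" if "i \<in> I" for i
    using E[OF that] by (auto simp: fmeasurable_def dest: sets.sets_into_space)
  have WV: "?W \<subseteq> ?V"
  proof
    fix y assume "y \<in> ?W"
    then obtain x where x: "x \<in> space C" "F x = y" "y \<noteq> 0" by auto
    then obtain i where "i \<in> I" "x \<in> E i" using off by blast
    then show "y \<in> ?V" using on x by auto
  qed
  have piece: "?P y = (\<Union>i\<in>{i\<in>I. v i = y}. A \<inter> E i)" if "y \<noteq> 0" for y
  proof (intro equalityI subsetI)
    fix x assume x: "x \<in> ?P y"
    then have "x \<in> (\<Union>i\<in>I. E i)" using off[of x] that by (cases "x \<in> (\<Union>i\<in>I. E i)") auto
    then obtain i where "i \<in> I" "x \<in> E i" by blast
    with x on show "x \<in> (\<Union>i\<in>{i\<in>I. v i = y}. A \<inter> E i)" by auto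
  next
    fix x assume "x \<in> (\<Union>i\<in>{i\<in>I. v i = y}. A \<inter> E i)"
    then obtain i where "i \<in> I" "v i = y" "x \<in> A" "x \<in> E i" by auto
    with on[of i x] Esp[of i] show "x \<in> ?P y" by auto
  qed
  have AE1: "AE \<omega> in M. \<Lambda> (?P y) \<omega> = (\<Sum>i\<in>{i\<in>I. v i = y}. \<Lambda> (A \<inter> E i) \<omega>)" if "y \<in> ?V" for y
  proof -
    have "AE \<omega> in M. \<Lambda> (\<Union>i\<in>{i\<in>I. v i = y}. A \<inter> E i) \<omega> = (\<Sum>i\<in>{i\<in>I. v i = y}. \<Lambda> (A \<inter> E i) \<omega>)"
      using I A E by (intro basis_finite_Union) (auto simp: disjoint_family_on_def Int_commute[of A] intro!: fmeasurable_Int_fmeasurable)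
    then show ?thesis using that by (subst piece) auto
  qed
  have "AE \<omega> in M. \<forall>y\<in>?V. \<Lambda> (?P y) \<omega> = (\<Sum>i\<in>{i\<in>I. v i = y}. \<Lambda> (A \<inter> E i) \<omega>)"
    using I(1) AE1 by (intro AE_finite_allI) auto
  then show ?thesis
    using basis_empty
  proof eventually_elim
    case (elim \<omega>)
    \<comment> \<open>A value \<open>v i\<close> that occurs only on empty pieces is not a value of
      \<open>F\<close>; its term involves \<open>\<Lambda> {}\<close>, which vanishes almost
      surely.\<close>
    have "simple_stoch_integral C \<Lambda> A F \<omega> = (\<Sum>y\<in>?V. y * \<Lambda> (?P y) \<omega>)"
      unfolding simple_stoch_integral_def
    proof (rule sum.mono_neutral_left)
      show "\<forall>y\<in>?V - ?W. y * \<Lambda> (?P y) \<omega> = 0"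
      proof
        fix y assume "y \<in> ?V - ?W"
        then have "y \<notin> F ` space C" by auto
        then have "?P y = {}" by blast
        then show "y * \<Lambda> (?P y) \<omega> = 0" using elim(2) by simp
      qed
    qed (use I WV in auto)
    also have "\<dots> = (\<Sum>y\<in>?V. \<Sum>i\<in>{i\<in>I. v i = y}. v i * \<Lambda> (A \<inter> E i) \<omega>)"
      using elim(1) by (intro sum.cong refl) (simp add: sum_distrib_left)
    also have "\<dots> = (\<Sum>y\<in>v ` I. \<Sum>i\<in>{i\<in>I. v i = y}. v i * \<Lambda> (A \<inter> E i) \<omega>)"
      using I(1) by (intro sum.mono_neutral_left) (auto intro!: sum.neutral)
    also have "\<dots> = (\<Sum>i\<in>I. v i * \<Lambda> (A \<inter> E i) \<omega>)"
      using I(1) by (rule sum.image_gen[symmetric])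
    finally show ?case .
  qed
qed

text \<open>All functions involved are constant on the level sets of the pair
  \<open>(F x, G x)\<close>. The pair \<open>(0, 0)\<close> is left out since its level set may have
  infinite measure; every other one lies in a level set of \<open>F\<close> or \<open>G\<close> at a
  nonzero value.\<close>

lemma simple_stoch_integral_linear:
  assumes F: "Bochner_Integration.simple_bochner_integrable C F" and G: "Bochner_Integration.simple_bochner_integrable C G"
    and A: "A \<in> sets C"
  shows "Bochner_Integration.simple_bochner_integrable C (\<lambda>x. F x + d * G x)"
    "AE \<omega> in M. simple_stoch_integral C \<Lambda> A (\<lambda>x. F x + d * G x) \<omega> =
      simple_stoch_integral C \<Lambda> A F \<omega> + d * simple_stoch_integral C \<Lambda> A G \<omega>"
proof -
  show H: "Bochner_Integration.simple_bochner_integrable C (\<lambda>x. F x + d * G x)"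
    by (rule simple_bochner_integrable_compose2[OF _ F G, of "\<lambda>a b. a + d * b"]) simp
  define I where "I = F ` space C \<times> G ` space C - {(0, 0)}"
  define E where "E i = {x \<in> space C. F x = fst i \<and> G x = snd i}" for i
  have I: "finite I" using simple_image_finite[OF F] simple_image_finite[OF G] by (simp add: I_def)
  have disj: "disjoint_family_on E I" by (auto simp: disjoint_family_on_def E_def)
  have [measurable]: "F \<in> borel_measurable C" "G \<in> borel_measurable C"
    using F G by (auto elim!: Bochner_Integration.simple_bochner_integrable.cases intro: borel_measurable_simple_function)
  have E: "E i \<in> fmeasurable C" if "i \<in> I" for i
  proof (cases "fst i = 0")
    case False
    then show ?thesis
      using simple_piece_fmeasurable[OF F sets.top False]
      by (rule_tac fmeasurableI2[of "space C \<inter> {x \<in> space C. F x = fst i}"]) (auto simp: E_def)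
  next
    case True
    then have 2: "snd i \<noteq> 0" using that by (auto simp: I_def prod_eq_iff)
    show ?thesis
      using simple_piece_fmeasurable[OF G sets.top 2]
      by (rule_tac fmeasurableI2[of "space C \<inter> {x \<in> space C. G x = snd i}"]) (auto simp: E_def)
  qed
  have off: "F x = 0 \<and> G x = 0" if "x \<in> space C" "x \<notin> (\<Union>i\<in>I. E i)" for x
  proof (rule ccontr)
    assume "\<not> (F x = 0 \<and> G x = 0)"
    then have "(F x, G x) \<in> I" "x \<in> E (F x, G x)" using that by (auto simp: I_def E_def)
    then show False using that by blast
  qed
  have "AE \<omega> in M. simple_stoch_integral C \<Lambda> A F \<omega> = (\<Sum>i\<in>I. fst i * \<Lambda> (A \<inter> E i) \<omega>)"
    using off by (intro simple_stoch_integral_eq A I disj E simple_image_finite F) (auto simp: E_def)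
  moreover have "AE \<omega> in M. simple_stoch_integral C \<Lambda> A G \<omega> = (\<Sum>i\<in>I. snd i * \<Lambda> (A \<inter> E i) \<omega>)"
    using off by (intro simple_stoch_integral_eq A I disj E simple_image_finite G) (auto simp: E_def)
  moreover have "AE \<omega> in M. simple_stoch_integral C \<Lambda> A (\<lambda>x. F x + d * G x) \<omega> = (\<Sum>i\<in>I. (fst i + d * snd i) * \<Lambda> (A \<inter> E i) \<omega>)"
    using off by (intro simple_stoch_integral_eq A I disj E simple_image_finite H) (auto simp: E_def dest!: off)
  ultimately show "AE \<omega> in M. simple_stoch_integral C \<Lambda> A (\<lambda>x. F x + d * G x) \<omega> =
      simple_stoch_integral C \<Lambda> A F \<omega> + d * simple_stoch_integral C \<Lambda> A G \<omega>"
    by eventually_elim (simp add: sum_distrib_left sum.distrib algebra_simps)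
qed

section \<open>Integrals of general functions and their characteristic functions\<close>

lemma has_stoch_integral_measurable:
  assumes "has_stoch_integral M C \<Lambda> f Y"
  shows "f \<in> borel_measurable C" "Y \<in> borel_measurable M"
  using assms by (auto simp: has_stoch_integral_def converges_in_probability_def)

lemma has_stoch_integral_linear:
  assumes "has_stoch_integral M C \<Lambda> f Y" "has_stoch_integral M C \<Lambda> g Z"
  shows "has_stoch_integral M C \<Lambda> (\<lambda>x. f x + d * g x) (\<lambda>\<omega>. Y \<omega> + d * Z \<omega>)"
proof -
  note [measurable] = assms[THEN has_stoch_integral_measurable(1)]
  obtain F where F: "\<And>n. Bochner_Integration.simple_bochner_integrable C (F n)"
    "AE x in C. (\<lambda>n. F n x) \<longlonglongrightarrow> f x"
    "\<And>A. A \<in> sets C \<Longrightarrow> \<exists>Z. converges_in_probability M (\<lambda>n. simple_stoch_integral C \<Lambda> A (F n)) Z"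
    "converges_in_probability M (\<lambda>n. simple_stoch_integral C \<Lambda> (space C) (F n)) Y"
    using assms(1) unfolding has_stoch_integral_def by blast
  obtain G where G: "\<And>n. Bochner_Integration.simple_bochner_integrable C (G n)"
    "AE x in C. (\<lambda>n. G n x) \<longlonglongrightarrow> g x"
    "\<And>A. A \<in> sets C \<Longrightarrow> \<exists>Z. converges_in_probability M (\<lambda>n. simple_stoch_integral C \<Lambda> A (G n)) Z"
    "converges_in_probability M (\<lambda>n. simple_stoch_integral C \<Lambda> (space C) (G n)) Z"
    using assms(2) unfolding has_stoch_integral_def by blast
  let ?H = "\<lambda>n x. F n x + d * G n x"
  note H = simple_stoch_integral_linear[OF F(1) G(1)]
  have conv: "converges_in_probability M (\<lambda>n. simple_stoch_integral C \<Lambda> A (?H n)) (\<lambda>\<omega>. U \<omega> + d * V \<omega>)"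
    if "A \<in> sets C" "converges_in_probability M (\<lambda>n. simple_stoch_integral C \<Lambda> A (F n)) U"
      "converges_in_probability M (\<lambda>n. simple_stoch_integral C \<Lambda> A (G n)) V" for A U V
    by (rule converges_in_probability_linear[OF _ _ _ that(2,3)])
       (intro simple_stoch_integral_measurable F G H(1)[OF that(1)] H(2)[OF that(1)] that(1))+
  show ?thesis
    unfolding has_stoch_integral_def
  proof (intro conjI exI[of _ ?H] allI ballI)
    show "(\<lambda>x. f x + d * g x) \<in> borel_measurable C" by measurable
    show "AE x in C. (\<lambda>n. ?H n x) \<longlonglongrightarrow> f x + d * g x"
      using F(2) G(2) by eventually_elim (intro tendsto_intros)
    show "\<exists>Z. converges_in_probability M (\<lambda>n. simple_stoch_integral C \<Lambda> A (?H n)) Z" if "A \<in> sets C" for A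
      using F(3)[OF that] G(3)[OF that] conv[OF that] by blast
    show "converges_in_probability M (\<lambda>n. simple_stoch_integral C \<Lambda> (space C) (?H n)) (\<lambda>\<omega>. Y \<omega> + d * Z \<omega>)"
      by (intro conv F(4) G(4)) auto
    show "Bochner_Integration.simple_bochner_integrable C (?H n)" for n
      by (rule H(1)[OF sets.top])
  qed
qed

lemma has_stoch_integral_0: "has_stoch_integral M C \<Lambda> (\<lambda>x. 0) (\<lambda>\<omega>. 0)"
proof -
  have [simp]: "simple_stoch_integral C \<Lambda> A (\<lambda>x. 0) = (\<lambda>\<omega>. 0)" for A
    by (auto simp: simple_stoch_integral_def fun_eq_iff intro!: sum.neutral)
  have "Bochner_Integration.simple_bochner_integrable C (\<lambda>x. 0 :: real)"
    by (intro Bochner_Integration.simple_bochner_integrable.intros) auto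
  moreover have "converges_in_probability M (\<lambda>n \<omega>. 0) (\<lambda>\<omega>. 0)"
    by (simp add: converges_in_probability_def)
  ultimately show ?thesis
    unfolding has_stoch_integral_def by (intro conjI exI[of _ "\<lambda>n x. 0"]) auto
qed

lemma has_stoch_integral_sum:
  assumes "\<And>i. i \<in> I \<Longrightarrow> has_stoch_integral M C \<Lambda> (f i) (Y i)"
  shows "has_stoch_integral M C \<Lambda> (\<lambda>x. \<Sum>i\<in>I. c i * f i x) (\<lambda>\<omega>. \<Sum>i\<in>I. c i * Y i \<omega>)"
  using assms
proof (induction I rule: infinite_finite_induct)
  case (insert i I)
  then have "has_stoch_integral M C \<Lambda> (\<lambda>x. (\<Sum>i\<in>I. c i * f i x) + c i * f i x) (\<lambda>\<omega>. (\<Sum>i\<in>I. c i * Y i \<omega>) + c i * Y i \<omega>)"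
    by (intro has_stoch_integral_linear) auto
  then show ?case using insert by (simp add: add.commute)
qed (simp_all add: has_stoch_integral_0)

text \<open>Fatou's lemma for the nonnegative functions - Re \<kappa> along simple approximants,
  whose integrals are visible in the modulus of the characteristic function. Integrability of
  \<open>\<kappa> (\<zeta> * f x)\<close> is not presupposed, so this one-sided bound is available
  before any moment of the Levy measure is known to exist.\<close>

lemma nn_integral_Re_exponent_le:
  assumes int: "has_stoch_integral M C \<Lambda> f Y" and neg: "\<And>\<zeta>. Re (\<kappa> \<zeta>) \<le> 0"
    and nz: "char (distr M borel Y) \<zeta> \<noteq> 0"
  shows "(\<integral>\<^sup>+x. ennreal (- Re (\<kappa> (\<zeta> * f x))) \<partial>C) \<le> ennreal (- ln (norm (char (distr M borel Y) \<zeta>)))"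
proof -
  note [measurable] = has_stoch_integral_measurable[OF int]
  obtain F where F: "\<And>n. Bochner_Integration.simple_bochner_integrable C (F n)"
    "AE x in C. (\<lambda>n. F n x) \<longlonglongrightarrow> f x"
    "converges_in_probability M (\<lambda>n. simple_stoch_integral C \<Lambda> (space C) (F n)) Y"
    using int unfolding has_stoch_integral_def by blast
  have Fm [measurable]: "F n \<in> borel_measurable C" for n
    using F(1)[of n] by (auto elim!: Bochner_Integration.simple_bochner_integrable.cases intro: borel_measurable_simple_function)
  have ii: "integrable C (\<lambda>x. \<kappa> (\<zeta> * F n x))" for n
    using simple_exponent_expansion(1)[OF F(1) sets.top, of \<zeta> n] by (subst (asm) Bochner_Integration.integrable_cong[OF refl]) auto
  have ch: "char (distr M borel (simple_stoch_integral C \<Lambda> (space C) (F n))) \<zeta> = exp (CLINT x|C. \<kappa> (\<zeta> * F n x))" for n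
    unfolding char_simple_stoch_integral[OF F(1) sets.top]
    by (intro arg_cong[of _ _ exp] Bochner_Integration.integral_cong) auto
  have "(\<lambda>n. exp (CLINT x|C. \<kappa> (\<zeta> * F n x))) \<longlonglongrightarrow> char (distr M borel Y) \<zeta>"
    unfolding ch[symmetric]
    by (intro converges_in_probability_char F(3) simple_stoch_integral_measurable F(1) sets.top)
  then have "(\<lambda>n. - ln (norm (exp (CLINT x|C. \<kappa> (\<zeta> * F n x))))) \<longlonglongrightarrow> - ln (norm (char (distr M borel Y) \<zeta>))"
    using nz by (intro tendsto_intros) auto
  moreover have "- ln (norm (exp (CLINT x|C. \<kappa> (\<zeta> * F n x)))) = (\<integral>x. - Re (\<kappa> (\<zeta> * F n x)) \<partial>C)" for n
    using ii[of n] by (simp add: integral_Re)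
  ultimately have lim: "(\<lambda>n. ennreal (\<integral>x. - Re (\<kappa> (\<zeta> * F n x)) \<partial>C)) \<longlonglongrightarrow> ennreal (- ln (norm (char (distr M borel Y) \<zeta>)))"
    by (intro tendsto_ennrealI) simp
  have nn: "(\<integral>\<^sup>+x. ennreal (- Re (\<kappa> (\<zeta> * F n x))) \<partial>C) = ennreal (\<integral>x. - Re (\<kappa> (\<zeta> * F n x)) \<partial>C)" for n
    using ii[of n] neg by (intro nn_integral_eq_integral) auto
  have "(\<integral>\<^sup>+x. ennreal (- Re (\<kappa> (\<zeta> * f x))) \<partial>C) = (\<integral>\<^sup>+x. liminf (\<lambda>n. ennreal (- Re (\<kappa> (\<zeta> * F n x)))) \<partial>C)"
  proof (rule nn_integral_cong_AE, use F(2) in eventually_elim)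
    fix x assume "(\<lambda>n. F n x) \<longlonglongrightarrow> f x"
    moreover have "isCont \<kappa> (\<zeta> * f x)"
      using continuous_exponent by (simp add: continuous_on_eq_continuous_at)
    ultimately have "(\<lambda>n. \<kappa> (\<zeta> * F n x)) \<longlonglongrightarrow> \<kappa> (\<zeta> * f x)"
      by (intro isCont_tendsto_compose[of _ \<kappa>] tendsto_intros)
    then have "(\<lambda>n. ennreal (- Re (\<kappa> (\<zeta> * F n x)))) \<longlonglongrightarrow> ennreal (- Re (\<kappa> (\<zeta> * f x)))"
      by (intro tendsto_ennrealI tendsto_intros)
    from lim_imp_Liminf[OF sequentially_bot this]
    show "ennreal (- Re (\<kappa> (\<zeta> * f x))) = liminf (\<lambda>n. ennreal (- Re (\<kappa> (\<zeta> * F n x))))" by simp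
  qed
  also have "\<dots> \<le> liminf (\<lambda>n. \<integral>\<^sup>+x. ennreal (- Re (\<kappa> (\<zeta> * F n x))) \<partial>C)"
    by (intro nn_integral_liminf) measurable
  also have "\<dots> = ennreal (- ln (norm (char (distr M borel Y) \<zeta>)))"
    unfolding nn by (rule lim_imp_Liminf[OF sequentially_bot lim])
  finally show ?thesis .
qed

text \<open>Almost everywhere convergence of the simple functions does not make the integrals of
  their exponents converge. \<open>exp_integral_tendsto_1\<close> applied to the differences
  \<open>h n\<close> overcomes this: the exponentials of their integrals over any fixed set
  converge, since the simple integrals over that set converge in probability.\<close>

theorem char_stoch_integral:
  assumes int: "has_stoch_integral M C \<Lambda> f Y" and i: "integrable C (\<lambda>x. \<kappa> (\<zeta> * f x))"
  shows "char (distr M borel Y) \<zeta> = exp (CLINT x|C. \<kappa> (\<zeta> * f x))"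
proof -
  note [measurable] = has_stoch_integral_measurable[OF int]
  obtain F where F: "\<And>n. Bochner_Integration.simple_bochner_integrable C (F n)"
    "AE x in C. (\<lambda>n. F n x) \<longlonglongrightarrow> f x"
    "\<And>A. A \<in> sets C \<Longrightarrow> \<exists>Z. converges_in_probability M (\<lambda>n. simple_stoch_integral C \<Lambda> A (F n)) Z"
    "converges_in_probability M (\<lambda>n. simple_stoch_integral C \<Lambda> (space C) (F n)) Y"
    using int unfolding has_stoch_integral_def by blast
  define h where "h n x = \<kappa> (\<zeta> * F n x) - \<kappa> (\<zeta> * f x)" for n x
  have ii: "integrable C (\<lambda>x. \<kappa> (\<zeta> * F n x))" for n
    using simple_exponent_expansion(1)[OF F(1) sets.top, of \<zeta> n] by (subst (asm) Bochner_Integration.integrable_cong[OF refl]) auto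
  have ch: "exp (set_lebesgue_integral C A (h n)) =
      char (distr M borel (simple_stoch_integral C \<Lambda> A (F n))) \<zeta> / exp (CLINT x:A|C. \<kappa> (\<zeta> * f x))" if A: "A \<in> sets C" for A n
  proof -
    have "set_lebesgue_integral C A (h n) = (CLINT x:A|C. \<kappa> (\<zeta> * F n x)) - (CLINT x:A|C. \<kappa> (\<zeta> * f x))"
      unfolding h_def using A i ii[of n]
      by (intro set_integral_diff) (auto simp: set_integrable_def intro!: integrable_mult_indicator)
    then show ?thesis
      unfolding char_simple_stoch_integral[OF F(1) A] by (simp add: exp_diff set_lebesgue_integral_def)
  qed
  have lim: "(\<lambda>n. char (distr M borel (simple_stoch_integral C \<Lambda> A (F n))) \<zeta> / exp (CLINT x:A|C. \<kappa> (\<zeta> * f x)))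
      \<longlonglongrightarrow> char (distr M borel Z) \<zeta> / exp (CLINT x:A|C. \<kappa> (\<zeta> * f x))"
    if "A \<in> sets C" "converges_in_probability M (\<lambda>n. simple_stoch_integral C \<Lambda> A (F n)) Z" for A Z
    using that by (intro tendsto_divide tendsto_const converges_in_probability_char simple_stoch_integral_measurable F(1)) auto
  have "(\<lambda>n. exp (integral\<^sup>L C (h n))) \<longlonglongrightarrow> 1"
  proof (rule C.exp_integral_tendsto_1)
    show "integrable C (h n)" for n
      unfolding h_def by (intro Bochner_Integration.integrable_diff ii i)
    show "AE x in C. (\<lambda>n. h n x) \<longlonglongrightarrow> 0"
      using F(2)
    proof eventually_elim
      fix x assume "(\<lambda>n. F n x) \<longlonglongrightarrow> f x"
      moreover have "isCont \<kappa> (\<zeta> * f x)"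
        using continuous_exponent by (simp add: continuous_on_eq_continuous_at)
      ultimately have "(\<lambda>n. \<kappa> (\<zeta> * F n x)) \<longlonglongrightarrow> \<kappa> (\<zeta> * f x)"
        by (intro isCont_tendsto_compose[of _ \<kappa>] tendsto_intros)
      then show "(\<lambda>n. h n x) \<longlonglongrightarrow> 0"
        unfolding h_def by (simp add: LIM_zero)
    qed
    show "convergent (\<lambda>n. exp (set_lebesgue_integral C A (h n)))" if "A \<in> sets C" for A
      unfolding ch[OF that] using F(3)[OF that] lim[OF that] by (auto simp: convergent_def)
  qed
  moreover have "integral\<^sup>L C (h n) = set_lebesgue_integral C (space C) (h n)" for n
    unfolding h_def by (intro set_integral_space[symmetric] Bochner_Integration.integrable_diff ii i)
  ultimately have "(\<lambda>n. exp (set_lebesgue_integral C (space C) (h n))) \<longlonglongrightarrow> 1" by simp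
  moreover have "(\<lambda>n. exp (set_lebesgue_integral C (space C) (h n)))
      \<longlonglongrightarrow> char (distr M borel Y) \<zeta> / exp (CLINT x:space C|C. \<kappa> (\<zeta> * f x))"
    unfolding ch[OF sets.top] by (rule lim[OF sets.top F(4)])
  ultimately have "char (distr M borel Y) \<zeta> / exp (CLINT x:space C|C. \<kappa> (\<zeta> * f x)) = 1"
    using LIMSEQ_unique by blast
  then show ?thesis
    by (simp add: set_integral_space[OF i])
qed

end

section \<open>The Levy-Khintchine exponent\<close>

lemma norm_iexp_diff_1: "norm (iexp y - 1) \<le> \<bar>y\<bar>"
  using iexp_approx1[of y 0] by simp

lemma norm_iexp_diff_2: "norm (iexp y - 1 - \<i> * of_real y) \<le> y\<^sup>2 / 2"
  using iexp_approx1[of y 1] by (simp add: diff_diff_eq power2_eq_square)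

locale levy_exponent =
  fixes a b :: real and \<mu> :: "real measure"
  assumes triplet: "levy_triplet a b \<mu>"
begin

abbreviation "\<kappa> \<equiv> levy_khintchine a b \<mu>"

lemma gauss_nonneg: "b \<ge> 0" using triplet by (simp add: levy_triplet_def)

lemma sets_mu [measurable_cong, simp]: "sets \<mu> = sets borel"
  using triplet by (simp add: levy_triplet_def)

lemma space_mu [simp]: "space \<mu> = UNIV"
  using sets_eq_imp_space_eq[OF sets_mu] by simp

lemma integrable_min: "integrable \<mu> (\<lambda>x. min 1 (x\<^sup>2))"
  using triplet by (simp add: levy_triplet_def)

lemma null_0: "{0} \<in> null_sets \<mu>"
  using triplet by (auto simp: levy_triplet_def)

text \<open>The sets where \<open>min 1 (x\<^sup>2)\<close> is at least 1 / (n + 1) have finite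
  measure and cover everything but the null set \<open>{0}\<close>. This permits Tonelli's theorem
  for jumps and kernel variables together.\<close>

lemma sigma_finite_mu: "sigma_finite_measure \<mu>"
proof
  define A where "A n = {x :: real. 1 / real (Suc n) \<le> min 1 (x\<^sup>2)}" for n
  have Am [measurable]: "A n \<in> sets borel" for n unfolding A_def by measurable
  have fin: "emeasure \<mu> (A n) \<noteq> \<infinity>" for n
  proof -
    have "emeasure \<mu> (A n) = (\<integral>\<^sup>+x. indicator (A n) x \<partial>\<mu>)" by simp
    also have "\<dots> \<le> (\<integral>\<^sup>+x. ennreal (real (Suc n) * min 1 (x\<^sup>2)) \<partial>\<mu>)"
    proof (intro nn_integral_mono)
      fix x
      have "1 \<le> real (Suc n) * min 1 (x\<^sup>2)" if "x \<in> A n"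
        using that by (simp add: A_def field_simps)
      then show "indicator (A n) x \<le> ennreal (real (Suc n) * min 1 (x\<^sup>2))"
        by (auto simp: indicator_def simp flip: ennreal_1 intro: ennreal_leI)
    qed
    also have "\<dots> < \<infinity>"
      using integrable_mult_right[OF integrable_min, of "real (Suc n)"]
      by (subst nn_integral_eq_integral) auto
    finally show ?thesis by simp
  qed
  show "\<exists>A. countable A \<and> A \<subseteq> sets \<mu> \<and> \<Union>A = space \<mu> \<and> (\<forall>a\<in>A. emeasure \<mu> a \<noteq> \<infinity>)"
  proof (intro exI[of _ "insert {0} (range A)"] conjI)
    have "x \<in> \<Union>(insert {0} (range A))" for x
    proof (cases "x = 0")
      case False
      then have "min 1 (x\<^sup>2) > 0" by simp
      then obtain n where "inverse (real (Suc n)) < min 1 (x\<^sup>2)"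
        using reals_Archimedean by blast
      then have "x \<in> A n" by (simp add: A_def inverse_eq_divide)
      then show ?thesis by blast
    qed simp
    then show "\<Union>(insert {0} (range A)) = space \<mu>" by auto
    show "\<forall>a\<in>insert {0} (range A). emeasure \<mu> a \<noteq> \<infinity>"
      using null_0 fin by (auto simp: null_sets_def)
  qed (auto simp: Am)
qed

text \<open>The factor \<open>\<zeta>\<^sup>2 + 2\<close> covers both regimes: the second-order
  Taylor bound on \<open>{-1..1}\<close>, and the trivial bound 2 outside, where
  \<open>min 1 (x\<^sup>2) = 1\<close>.\<close>

lemma integrable_levy_khintchine:
  "integrable \<mu> (\<lambda>x. iexp (\<zeta> * x) - 1 - \<i> * of_real (\<zeta> * x * indicator {-1..1} x))"
proof (rule Bochner_Integration.integrable_bound[OF integrable_mult_right[OF integrable_min, of "\<zeta>\<^sup>2 + 2"]])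
  have "norm (iexp (\<zeta> * x) - 1 - \<i> * of_real (\<zeta> * x * indicator {-1..1} x)) \<le> (\<zeta>\<^sup>2 + 2) * min 1 (x\<^sup>2)" for x
  proof (cases "x \<in> {-1..1}")
    case True
    have "norm (iexp (\<zeta> * x) - 1 - \<i> * of_real (\<zeta> * x * indicator {-1..1} x)) \<le> (\<zeta> * x)\<^sup>2 / 2"
      using norm_iexp_diff_2[of "\<zeta> * x"] True by simp
    also have "\<dots> \<le> (\<zeta>\<^sup>2 + 2) * x\<^sup>2"
      by (auto simp: power_mult_distrib algebra_simps)
    also have "x\<^sup>2 = min 1 (x\<^sup>2)"
      using True abs_square_le_1[of x] by (auto simp: abs_le_iff)
    finally show ?thesis .
  next
    case False
    then have "1 \<le> x\<^sup>2" using abs_square_less_1[of x] by (auto simp: abs_less_iff not_less[symmetric])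
    then have m: "min 1 (x\<^sup>2) = 1" by simp
    have "norm (iexp (\<zeta> * x) - 1 - \<i> * of_real (\<zeta> * x * indicator {-1..1} x)) = norm (iexp (\<zeta> * x) - 1)"
      using False by simp
    also have "\<dots> \<le> 2"
      using norm_triangle_ineq4[of "iexp (\<zeta> * x)" 1] by simp
    also have "2 \<le> (\<zeta>\<^sup>2 + 2) * min 1 (x\<^sup>2)" unfolding m by simp
    finally show ?thesis .
  qed
  then show "AE x in \<mu>. norm (iexp (\<zeta> * x) - 1 - \<i> * of_real (\<zeta> * x * indicator {-1..1} x)) \<le> norm ((\<zeta>\<^sup>2 + 2) * min 1 (x\<^sup>2))"
    by (auto intro: order_trans[OF _ abs_ge_self])
qed measurable

lemma integrable_cos: "integrable \<mu> (\<lambda>x. 1 - cos (\<zeta> * x))"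
  and Re_exponent: "Re (\<kappa> \<zeta>) = - (b * \<zeta>\<^sup>2 / 2) - (\<integral>x. 1 - cos (\<zeta> * x) \<partial>\<mu>)"
proof -
  let ?g = "\<lambda>x. iexp (\<zeta> * x) - 1 - \<i> * of_real (\<zeta> * x * indicator {-1..1} x)"
  have Re: "Re (?g x) = cos (\<zeta> * x) - 1" for x
    by (simp add: Re_exp)
  have "integrable \<mu> (\<lambda>x. Re (?g x))"
    by (intro integrable_Re integrable_levy_khintchine)
  then have "integrable \<mu> (\<lambda>x. - (cos (\<zeta> * x) - 1))"
    unfolding Re by (rule Bochner_Integration.integrable_minus)
  then show i: "integrable \<mu> (\<lambda>x. 1 - cos (\<zeta> * x))" by simp
  have "Re (integral\<^sup>L \<mu> ?g) = (\<integral>x. cos (\<zeta> * x) - 1 \<partial>\<mu>)"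
    unfolding integral_Re[OF integrable_levy_khintchine, symmetric] Re ..
  also have "\<dots> = (\<integral>x. - (1 - cos (\<zeta> * x)) \<partial>\<mu>)" by simp
  also have "\<dots> = - (\<integral>x. 1 - cos (\<zeta> * x) \<partial>\<mu>)" by (rule Bochner_Integration.integral_minus)
  finally show "Re (\<kappa> \<zeta>) = - (b * \<zeta>\<^sup>2 / 2) - (\<integral>x. 1 - cos (\<zeta> * x) \<partial>\<mu>)"
    by (simp add: levy_khintchine_def)
qed

lemma Re_exponent_le: "Re (\<kappa> \<zeta>) \<le> - (\<integral>x. 1 - cos (\<zeta> * x) \<partial>\<mu>)"
  using gauss_nonneg by (simp add: Re_exponent)

lemma Re_exponent_nonpos: "Re (\<kappa> \<zeta>) \<le> 0"
proof -
  have "0 \<le> (\<integral>x. 1 - cos (\<zeta> * x) \<partial>\<mu>)" by (intro integral_nonneg_AE) auto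
  with Re_exponent_le[of \<zeta>] show ?thesis by linarith
qed

lemma exponent_0: "\<kappa> 0 = 0"
  by (simp add: levy_khintchine_def)

end

locale square_integrable_levy_exponent = levy_exponent +
  assumes square_integrable: "integrable \<mu> (\<lambda>x. x\<^sup>2)"
begin

text \<open>This is the mean of L(1): the triplet compensates only jumps in \<open>{-1..1}\<close>,
  so the larger ones add to the drift. Likewise \<open>levy_var\<close> is the variance of
  L(1).\<close>

definition "levy_mean = a + (\<integral>x. x * indicator (- {-1..1}) x \<partial>\<mu>)"
definition "levy_var = b + (\<integral>x. x\<^sup>2 \<partial>\<mu>)"

lemma levy_var_nonneg: "levy_var \<ge> 0"
  using gauss_nonneg by (simp add: levy_var_def)

lemma integrable_compensated: "integrable \<mu> (\<lambda>x. iexp (\<zeta> * x) - 1 - \<i> * of_real (\<zeta> * x))"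
proof (rule Bochner_Integration.integrable_bound[OF integrable_mult_right[OF square_integrable, of "\<zeta>\<^sup>2 / 2"]])
  show "AE x in \<mu>. norm (iexp (\<zeta> * x) - 1 - \<i> * of_real (\<zeta> * x)) \<le> norm (\<zeta>\<^sup>2 / 2 * x\<^sup>2)"
  proof (rule AE_I2)
    show "norm (iexp (\<zeta> * x) - 1 - \<i> * of_real (\<zeta> * x)) \<le> norm (\<zeta>\<^sup>2 / 2 * x\<^sup>2)" for x
      using norm_iexp_diff_2[of "\<zeta> * x"] by (simp add: power_mult_distrib)
  qed
qed measurable

text \<open>The compensator is extended from the small jumps to all of them; the large ones are
  integrable because \<bar>x\<bar> \<le> x^2 outside \<open>{-1..1}\<close>.\<close>

lemma exponent_eq:
  "\<kappa> \<zeta> = \<i> * of_real (\<zeta> * levy_mean) - of_real (b * \<zeta>\<^sup>2 / 2) + (CLINT x|\<mu>. iexp (\<zeta> * x) - 1 - \<i> * of_real (\<zeta> * x))"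
proof -
  have i: "integrable \<mu> (\<lambda>x. x * indicator (- {-1..1}) x)"
  proof (rule Bochner_Integration.integrable_bound[OF square_integrable])
    have "\<bar>x\<bar> \<le> x\<^sup>2" if "x \<notin> {-1..1}" for x :: real
    proof -
      have "1 \<le> \<bar>x\<bar>" using that by auto
      then have "\<bar>x\<bar> * 1 \<le> \<bar>x\<bar> * \<bar>x\<bar>" by (intro mult_left_mono) auto
      then show ?thesis by (simp add: power2_eq_square)
    qed
    then show "AE x in \<mu>. norm (x * indicator (- {-1..1}) x) \<le> norm (x\<^sup>2)"
      by (auto simp: indicator_def)
  qed measurable
  have ii: "integrable \<mu> (\<lambda>x. \<i> * of_real (\<zeta> * (x * indicator (- {-1..1}) x)))"
    by (intro integrable_mult_right integrable_of_real i)
  have "(CLINT x|\<mu>. iexp (\<zeta> * x) - 1 - \<i> * of_real (\<zeta> * x * indicator {-1..1} x)) =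
     (CLINT x|\<mu>. (iexp (\<zeta> * x) - 1 - \<i> * of_real (\<zeta> * x)) + \<i> * of_real (\<zeta> * (x * indicator (- {-1..1}) x)))"
    by (intro Bochner_Integration.integral_cong) (auto simp: indicator_def)
  also have "\<dots> = (CLINT x|\<mu>. iexp (\<zeta> * x) - 1 - \<i> * of_real (\<zeta> * x)) + (CLINT x|\<mu>. \<i> * of_real (\<zeta> * (x * indicator (- {-1..1}) x)))"
    by (rule Bochner_Integration.integral_add[OF integrable_compensated ii])
  also have "(CLINT x|\<mu>. \<i> * of_real (\<zeta> * (x * indicator (- {-1..1}) x))) = \<i> * of_real (\<zeta> * (\<integral>x. x * indicator (- {-1..1}) x \<partial>\<mu>))"
    unfolding integral_mult_right_zero integral_complex_of_real ..
  finally show ?thesis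
    by (simp add: levy_khintchine_def levy_mean_def algebra_simps)
qed

lemma exponent_mean_bound: "norm (\<kappa> \<zeta> - \<i> * of_real (\<zeta> * levy_mean)) \<le> levy_var / 2 * \<zeta>\<^sup>2"
proof -
  have "norm (CLINT x|\<mu>. iexp (\<zeta> * x) - 1 - \<i> * of_real (\<zeta> * x)) \<le> (\<integral>x. norm (iexp (\<zeta> * x) - 1 - \<i> * of_real (\<zeta> * x)) \<partial>\<mu>)"
    by (rule integral_norm_bound)
  also have "\<dots> \<le> (\<integral>x. \<zeta>\<^sup>2 / 2 * x\<^sup>2 \<partial>\<mu>)"
  proof (rule integral_mono[OF integrable_norm[OF integrable_compensated] integrable_mult_right[OF square_integrable]])
    show "norm (iexp (\<zeta> * x) - 1 - \<i> * of_real (\<zeta> * x)) \<le> \<zeta>\<^sup>2 / 2 * x\<^sup>2" for x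
      using norm_iexp_diff_2[of "\<zeta> * x"] by (simp add: power_mult_distrib)
  qed
  also have "\<dots> = \<zeta>\<^sup>2 / 2 * (\<integral>x. x\<^sup>2 \<partial>\<mu>)" by simp
  finally have "norm (CLINT x|\<mu>. iexp (\<zeta> * x) - 1 - \<i> * of_real (\<zeta> * x)) \<le> \<zeta>\<^sup>2 / 2 * (\<integral>x. x\<^sup>2 \<partial>\<mu>)" .
  moreover have "norm (complex_of_real (b * \<zeta>\<^sup>2 / 2)) = b * \<zeta>\<^sup>2 / 2"
    unfolding norm_of_real using gauss_nonneg by simp
  moreover have "\<kappa> \<zeta> - \<i> * of_real (\<zeta> * levy_mean) =
      (CLINT x|\<mu>. iexp (\<zeta> * x) - 1 - \<i> * of_real (\<zeta> * x)) - of_real (b * \<zeta>\<^sup>2 / 2)"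
    unfolding exponent_eq by simp
  ultimately have "norm (\<kappa> \<zeta> - \<i> * of_real (\<zeta> * levy_mean)) \<le> \<zeta>\<^sup>2 / 2 * (\<integral>x. x\<^sup>2 \<partial>\<mu>) + b * \<zeta>\<^sup>2 / 2"
    by (smt (verit) norm_triangle_ineq4)
  then show ?thesis by (simp add: levy_var_def algebra_simps)
qed

end

locale centered_levy_exponent = square_integrable_levy_exponent +
  assumes centered: "levy_mean = 0"
begin

lemma exponent_bound: "norm (\<kappa> \<zeta>) \<le> levy_var / 2 * \<zeta>\<^sup>2"
  using exponent_mean_bound[of \<zeta>] by (simp add: centered)

text \<open>The compensated exponentials at x and y differ by exp (i y z) times the one at x - y,
  plus i (x - y) z (exp (i y z) - 1). A quadratic bound with a factor x - y in each term makes
  exponents of functions close in \<open>L\<^sup>2\<close> close in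
  \<open>L\<^sup>1\<close>.\<close>

lemma exponent_diff_bound: "norm (\<kappa> x - \<kappa> y) \<le> levy_var * ((x - y)\<^sup>2 + \<bar>x - y\<bar> * \<bar>y\<bar>)"
proof -
  let ?g = "\<lambda>\<zeta> z. iexp (\<zeta> * z) - 1 - \<i> * of_real (\<zeta> * z)"
  have pw: "norm (?g x z - ?g y z) \<le> z\<^sup>2 * ((x - y)\<^sup>2 + \<bar>x - y\<bar> * \<bar>y\<bar>)" for z
  proof -
    have "?g x z - ?g y z = iexp (y * z) * (iexp ((x - y) * z) - 1 - \<i> * of_real ((x - y) * z)) + \<i> * of_real ((x - y) * z) * (iexp (y * z) - 1)"
      by (simp add: algebra_simps exp_add[symmetric])
    also have "norm \<dots> \<le> norm (iexp (y * z) * (iexp ((x - y) * z) - 1 - \<i> * of_real ((x - y) * z))) + norm (\<i> * of_real ((x - y) * z) * (iexp (y * z) - 1))"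
      by (rule norm_triangle_ineq)
    also have "norm (iexp (y * z) * (iexp ((x - y) * z) - 1 - \<i> * of_real ((x - y) * z))) = norm (iexp ((x - y) * z) - 1 - \<i> * of_real ((x - y) * z))"
      unfolding norm_mult norm_exp_i_times by simp
    also have "\<dots> \<le> ((x - y) * z)\<^sup>2 / 2"
      by (rule norm_iexp_diff_2)
    also have "norm (\<i> * of_real ((x - y) * z) * (iexp (y * z) - 1)) = \<bar>(x - y) * z\<bar> * norm (iexp (y * z) - 1)"
      unfolding norm_mult norm_of_real by simp
    also have "\<dots> \<le> \<bar>(x - y) * z\<bar> * \<bar>y * z\<bar>"
      by (intro mult_left_mono norm_iexp_diff_1) auto
    also have "((x - y) * z)\<^sup>2 / 2 + \<bar>(x - y) * z\<bar> * \<bar>y * z\<bar> \<le> ((x - y) * z)\<^sup>2 + \<bar>(x - y) * z\<bar> * \<bar>y * z\<bar>"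
      by simp
    also have "\<dots> = z\<^sup>2 * ((x - y)\<^sup>2 + \<bar>x - y\<bar> * \<bar>y\<bar>)"
    proof -
      have "\<bar>(x - y) * z\<bar> * \<bar>y * z\<bar> = \<bar>z\<bar>\<^sup>2 * (\<bar>x - y\<bar> * \<bar>y\<bar>)"
        unfolding abs_mult by (simp only: power2_eq_square mult_ac)
      then show ?thesis by (simp only: power_mult_distrib distrib_left mult.commute power2_abs)
    qed
    finally show ?thesis by simp
  qed
  let ?c = "(x - y)\<^sup>2 + \<bar>x - y\<bar> * \<bar>y\<bar>"
  have c: "?c \<ge> 0" by simp
  have "norm ((CLINT z|\<mu>. ?g x z) - (CLINT z|\<mu>. ?g y z)) = norm (CLINT z|\<mu>. ?g x z - ?g y z)"
    by (subst Bochner_Integration.integral_diff[OF integrable_compensated integrable_compensated]) simp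
  also have "\<dots> \<le> (\<integral>z. norm (?g x z - ?g y z) \<partial>\<mu>)"
    by (rule integral_norm_bound)
  also have "\<dots> \<le> (\<integral>z. z\<^sup>2 * ?c \<partial>\<mu>)"
    by (rule integral_mono[OF integrable_norm[OF Bochner_Integration.integrable_diff[OF integrable_compensated integrable_compensated]]
        integrable_mult_left[OF square_integrable] pw])
  also have "\<dots> = (\<integral>z. z\<^sup>2 \<partial>\<mu>) * ?c" by simp
  finally have 1: "norm ((CLINT z|\<mu>. ?g x z) - (CLINT z|\<mu>. ?g y z)) \<le> (\<integral>z. z\<^sup>2 \<partial>\<mu>) * ?c" .
  have "norm (complex_of_real (b * x\<^sup>2 / 2) - of_real (b * y\<^sup>2 / 2)) = b * (\<bar>x - y\<bar> * \<bar>x + y\<bar> / 2)"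
  proof -
    have "b * x\<^sup>2 / 2 - b * y\<^sup>2 / 2 = b * ((x - y) * (x + y) / 2)"
      by (simp add: algebra_simps power2_eq_square diff_divide_distrib)
    then show ?thesis
      unfolding of_real_diff[symmetric] norm_of_real by (simp only: abs_mult abs_of_nonneg[OF gauss_nonneg] abs_divide abs_numeral)
  qed
  also have "\<dots> \<le> b * ?c"
  proof (intro mult_left_mono gauss_nonneg)
    have "\<bar>x + y\<bar> \<le> \<bar>x - y\<bar> + 2 * \<bar>y\<bar>" by linarith
    then have "\<bar>x - y\<bar> * \<bar>x + y\<bar> \<le> \<bar>x - y\<bar> * (\<bar>x - y\<bar> + 2 * \<bar>y\<bar>)" by (intro mult_left_mono) auto
    also have "\<dots> = (x - y)\<^sup>2 + 2 * (\<bar>x - y\<bar> * \<bar>y\<bar>)"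
      by (simp add: algebra_simps power2_eq_square abs_mult[symmetric])
    finally have "\<bar>x - y\<bar> * \<bar>x + y\<bar> \<le> (x - y)\<^sup>2 + 2 * (\<bar>x - y\<bar> * \<bar>y\<bar>)" .
    then show "\<bar>x - y\<bar> * \<bar>x + y\<bar> / 2 \<le> ?c"
      using zero_le_power2[of "x - y"] by linarith
  qed
  finally have 2: "norm (complex_of_real (b * x\<^sup>2 / 2) - of_real (b * y\<^sup>2 / 2)) \<le> b * ?c" .
  have "\<kappa> x - \<kappa> y = ((CLINT z|\<mu>. ?g x z) - (CLINT z|\<mu>. ?g y z)) - (complex_of_real (b * x\<^sup>2 / 2) - of_real (b * y\<^sup>2 / 2))"
    unfolding exponent_eq by (simp add: centered)
  then have "norm (\<kappa> x - \<kappa> y) \<le> (\<integral>z. z\<^sup>2 \<partial>\<mu>) * ?c + b * ?c"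
    using 1 2 by (smt (verit) norm_triangle_ineq4)
  then show ?thesis by (simp add: levy_var_def algebra_simps)
qed

text \<open>The cumulants of the centred variable L(1): the Gaussian part enters only at order two,
  and the first cumulant is the mean, which is zero.\<close>

definition "levy_cumulant k = (if k \<le> 1 then 0 else (\<integral>x. x ^ k \<partial>\<mu>) + (if k = 2 then b else 0))"

lemma levy_cumulant_2: "levy_cumulant 2 = levy_var"
  by (simp add: levy_cumulant_def levy_var_def)

text \<open>The remainder bound holds for all \<open>\<zeta>\<close>, not only near zero, so that
  \<open>\<zeta>\<close> may be multiplied by a kernel value and the bound integrated over the
  kernel variables.\<close>

lemma exponent_expansion:
  assumes mom: "\<And>k. k \<ge> 2 \<Longrightarrow> integrable \<mu> (\<lambda>x. x ^ k)" and N: "N > 0"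
  shows "\<exists>B\<ge>0. \<forall>\<zeta>. norm (\<kappa> \<zeta> - (\<Sum>k=1..N. of_real (levy_cumulant k) * (\<i> * of_real \<zeta>) ^ k / fact k)) \<le> B * \<bar>\<zeta>\<bar> ^ Suc N"
\<comment> \<open>For \<open>N = 1\<close> the polynomial has no term of order two to match the
  Gaussian part, so that part must go into the remainder; \<open>exponent_bound\<close> does
  this.\<close>
proof (cases "N = 1")
  case True
  have "norm (\<kappa> \<zeta> - (\<Sum>k=1..N. of_real (levy_cumulant k) * (\<i> * of_real \<zeta>) ^ k / fact k)) \<le> levy_var / 2 * \<bar>\<zeta>\<bar> ^ Suc N" for \<zeta>
    using exponent_bound[of \<zeta>] by (simp add: True levy_cumulant_def power2_eq_square abs_mult_self_eq)
  then show ?thesis using levy_var_nonneg by (intro exI[of _ "levy_var / 2"]) auto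
next
  case False
  with N have N: "N \<ge> 2" by simp
  define B where "B = (\<integral>x. \<bar>x\<bar> ^ Suc N / fact (Suc N) \<partial>\<mu>)"
  have ia: "integrable \<mu> (\<lambda>x. \<bar>x\<bar> ^ Suc N / fact (Suc N))"
    using integrable_abs[OF mom[of "Suc N"]] N unfolding power_abs by (intro integrable_divide) auto
  show ?thesis
  proof (intro exI conjI allI)
    show "B \<ge> 0" unfolding B_def by (intro integral_nonneg_AE) auto
    fix \<zeta>
    let ?T = "\<lambda>k x. (\<i> * of_real (\<zeta> * x)) ^ k / fact k"
    have iT: "integrable \<mu> (?T k)" if "k \<in> {2..N}" for k
    proof -
      have "integrable \<mu> (\<lambda>x. (\<i> * of_real \<zeta>) ^ k / fact k * complex_of_real (x ^ k))"
        using that by (intro integrable_mult_right integrable_of_real mom) auto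
      then show ?thesis by (simp add: power_mult_distrib mult_ac)
    qed
    have T: "(CLINT x|\<mu>. ?T k x) = of_real (\<integral>x. x ^ k \<partial>\<mu>) * (\<i> * of_real \<zeta>) ^ k / fact k" for k
    proof -
      have "(CLINT x|\<mu>. ?T k x) = (CLINT x|\<mu>. (\<i> * of_real \<zeta>) ^ k / fact k * complex_of_real (x ^ k))"
        by (intro Bochner_Integration.integral_cong refl) (simp add: power_mult_distrib mult_ac)
      then show ?thesis unfolding integral_mult_right_zero integral_complex_of_real by (simp add: mult_ac)
    qed
    have sum_split: "(\<Sum>k\<le>N. f k) = f 0 + f 1 + (\<Sum>k=2..N. f k)" for f :: "nat \<Rightarrow> complex"
      using N by (simp add: atMost_atLeast0 sum.atLeast_Suc_atMost numeral_2_eq_2)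
    have "(\<Sum>k=1..N. of_real (levy_cumulant k) * (\<i> * of_real \<zeta>) ^ k / fact k) =
        (\<Sum>k=2..N. of_real (levy_cumulant k) * (\<i> * of_real \<zeta>) ^ k / fact k)"
      using N by (subst sum.atLeast_Suc_atMost) (auto simp: levy_cumulant_def numeral_2_eq_2)
    also have "\<dots> = (\<Sum>k=2..N. (CLINT x|\<mu>. ?T k x) + (if k = 2 then - of_real (b * \<zeta>\<^sup>2 / 2) else 0))"
      unfolding T by (intro sum.cong refl) (auto simp: levy_cumulant_def power_mult_distrib algebra_simps add_divide_distrib)
    also have "\<dots> = (\<Sum>k=2..N. (CLINT x|\<mu>. ?T k x)) - of_real (b * \<zeta>\<^sup>2 / 2)"
      using N by (simp add: sum.distrib)
    finally have "\<kappa> \<zeta> - (\<Sum>k=1..N. of_real (levy_cumulant k) * (\<i> * of_real \<zeta>) ^ k / fact k) =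
        (CLINT x|\<mu>. iexp (\<zeta> * x) - 1 - \<i> * of_real (\<zeta> * x)) - (\<Sum>k=2..N. (CLINT x|\<mu>. ?T k x))"
      unfolding exponent_eq by (simp add: centered)
    also have "\<dots> = (CLINT x|\<mu>. (iexp (\<zeta> * x) - 1 - \<i> * of_real (\<zeta> * x)) - (\<Sum>k=2..N. ?T k x))"
    proof -
      have S: "(CLINT x|\<mu>. \<Sum>k=2..N. ?T k x) = (\<Sum>k=2..N. (CLINT x|\<mu>. ?T k x))"
        by (rule Bochner_Integration.integral_sum) (rule iT)
      have "integrable \<mu> (\<lambda>x. \<Sum>k=2..N. ?T k x)"
        by (rule Bochner_Integration.integrable_sum) (rule iT)
      from Bochner_Integration.integral_diff[OF integrable_compensated this, of \<zeta>] show ?thesis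
        unfolding S by (rule sym)
    qed
    also have "\<dots> = (CLINT x|\<mu>. iexp (\<zeta> * x) - (\<Sum>k\<le>N. ?T k x))"
      unfolding sum_split by (simp add: algebra_simps)
    also have "norm \<dots> \<le> (\<integral>x. norm (iexp (\<zeta> * x) - (\<Sum>k\<le>N. ?T k x)) \<partial>\<mu>)"
      by (rule integral_norm_bound)
    also have "\<dots> \<le> (\<integral>x. \<bar>\<zeta>\<bar> ^ Suc N * (\<bar>x\<bar> ^ Suc N / fact (Suc N)) \<partial>\<mu>)"
    proof (rule integral_mono_AE')
      show "AE x in \<mu>. norm (iexp (\<zeta> * x) - (\<Sum>k\<le>N. ?T k x)) \<le> \<bar>\<zeta>\<bar> ^ Suc N * (\<bar>x\<bar> ^ Suc N / fact (Suc N))"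
      proof (rule AE_I2)
        fix x
        show "norm (iexp (\<zeta> * x) - (\<Sum>k\<le>N. ?T k x)) \<le> \<bar>\<zeta>\<bar> ^ Suc N * (\<bar>x\<bar> ^ Suc N / fact (Suc N))"
          using iexp_approx1[of "\<zeta> * x" N] by (simp only: abs_mult power_mult_distrib times_divide_eq_right)
      qed
    next
      show "integrable \<mu> (\<lambda>x. \<bar>\<zeta>\<bar> ^ Suc N * (\<bar>x\<bar> ^ Suc N / fact (Suc N)))"
        by (rule integrable_mult_right[OF ia])
    qed auto
    also have "\<dots> = B * \<bar>\<zeta>\<bar> ^ Suc N"
      unfolding integral_mult_right_zero B_def by (rule mult.commute)
    finally show "norm (\<kappa> \<zeta> - (\<Sum>k=1..N. of_real (levy_cumulant k) * (\<i> * of_real \<zeta>) ^ k / fact k)) \<le> B * \<bar>\<zeta>\<bar> ^ Suc N" .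
  qed
qed

end

section \<open>The kernels\<close>

lemma nn_integral_exp_atMost:
  fixes r c :: real
  assumes r: "r > 0"
  shows "(\<integral>\<^sup>+s. ennreal (exp (r * (s - c)) * indicator {..c} s) \<partial>lborel) = ennreal (1 / r)"
proof -
  have "(\<integral>\<^sup>+s. ennreal (exp (r * (s - c)) * indicator {..c} s) \<partial>lborel) =
      ennreal \<bar>-1\<bar> * (\<integral>\<^sup>+x. ennreal (exp (r * (c + -1 * x - c)) * indicator {..c} (c + -1 * x)) \<partial>lborel)"
    by (rule nn_integral_real_affine) auto
  also have "\<dots> = (\<integral>\<^sup>+x. ennreal (exp (- r * x)) * indicator {0..} x \<partial>lborel)"
    by (auto simp: indicator_def intro!: nn_integral_cong)
  also have "\<dots> = ennreal (0 - (- exp (- r * 0) / r))"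
  proof (rule nn_integral_FTC_atLeast)
    show "((\<lambda>x. - exp (- r * x) / r) \<longlongrightarrow> 0) at_top"
      using r by real_asymp
    show "DERIV (\<lambda>x. - exp (- r * x) / r) x :> exp (- r * x)" for x
      using r by (auto intro!: derivative_eq_intros)
  qed auto
  finally show ?thesis by simp
qed

lemma integral_exp_atMost:
  fixes r c :: real
  assumes r: "r > 0"
  shows "integrable lborel (\<lambda>s. exp (r * (s - c)) * indicator {..c} s)" (is "integrable _ ?f")
    "(LBINT s. exp (r * (s - c)) * indicator {..c} s) = 1 / r"
proof -
  show i: "integrable lborel ?f"
    by (rule integrableI_nonneg) (auto simp: nn_integral_exp_atMost[OF r])
  have "ennreal (LBINT s. ?f s) = ennreal (1 / r)"
    unfolding nn_integral_exp_atMost[OF r, of c, symmetric] by (rule nn_integral_eq_integral[symmetric, OF i]) auto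
  then show "(LBINT s. ?f s) = 1 / r"
    using r by (subst (asm) ennreal_inj) (auto intro: integral_nonneg_AE)
qed

lemma supOU_kernel_eq: "supOU_kernel t (\<xi>, s) = exp (s - \<xi> * t) * indicator {..\<xi> * t} s"
  by (auto simp: supOU_kernel_def indicator_def)

lemma supOU_kernel_nonneg [simp]: "0 \<le> supOU_kernel t x"
  by (cases x) (simp add: supOU_kernel_eq)

lemma supOU_kernel_le_1: "supOU_kernel t x \<le> 1"
  by (cases x) (auto simp: supOU_kernel_eq indicator_def)

lemma supOU_kernel_power:
  assumes "n > 0"
  shows "supOU_kernel t (\<xi>, s) ^ n = exp (real n * (s - \<xi> * t)) * indicator {..\<xi> * t} s"
  using assms by (auto simp: supOU_kernel_eq indicator_def exp_of_nat_mult[symmetric])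

definition ou_kernel :: "real \<Rightarrow> real \<times> real \<Rightarrow> real" where
  "ou_kernel t x = (LBINT u:{0..t}. supOU_kernel u x)"

locale ou_measure = prob_space \<pi> for \<pi> :: "real measure" +
  assumes sets_pi: "sets \<pi> = sets (restrict_space borel {0<..})"
begin

abbreviation "C \<equiv> \<pi> \<Otimes>\<^sub>M (lborel :: real measure)"

lemma space_pi: "space \<pi> = {0<..}"
  using sets_eq_imp_space_eq[OF sets_pi] by (simp add: space_restrict_space)

lemma pi_pos: "AE \<xi> in \<pi>. \<xi> > 0"
  by (rule AE_I2) (simp add: space_pi)

lemma ident_measurable [measurable]: "(\<lambda>x. x) \<in> borel_measurable \<pi>"
  by (subst measurable_cong_sets[OF sets_pi refl]) (simp add: measurable_restrict_space1)

sublocale P: pair_sigma_finite \<pi> lborel ..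
sublocale C: sigma_finite_measure C ..

lemma kernel_measurable [measurable]:
  "(\<lambda>(u, x). supOU_kernel u x) \<in> borel_measurable (borel \<Otimes>\<^sub>M C)"
proof -
  have "(\<lambda>z. exp (- fst (snd z) * fst z + snd (snd z)) * indicator {0..} (fst (snd z) * fst z - snd (snd z)) :: real) \<in> borel_measurable (borel \<Otimes>\<^sub>M C)"
    by measurable
  then show ?thesis by (simp add: supOU_kernel_def case_prod_beta')
qed

lemma kernel_measurable_1 [measurable]: "supOU_kernel u \<in> borel_measurable C"
  using measurable_compose_Pair1[OF _ kernel_measurable, of u] by simp

lemma nn_integral_pair: "f \<in> borel_measurable C \<Longrightarrow> (\<integral>\<^sup>+x. f x \<partial>C) = (\<integral>\<^sup>+\<xi>. \<integral>\<^sup>+s. f (\<xi>, s) \<partial>lborel \<partial>\<pi>)"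
  by (rule lborel.nn_integral_fst[symmetric])

text \<open>The kernel is a shifted exponential in \<open>s\<close>, so the inner integral is 1 / n
  whatever \<open>\<xi>\<close> is, and \<open>\<pi>\<close> has mass one.\<close>

lemma nn_integral_kernel_power:
  assumes "n > 0"
  shows "(\<integral>\<^sup>+x. ennreal (supOU_kernel t x ^ n) \<partial>C) = ennreal (1 / real n)"
proof -
  have "(\<integral>\<^sup>+x. ennreal (supOU_kernel t x ^ n) \<partial>C) = (\<integral>\<^sup>+\<xi>. \<integral>\<^sup>+s. ennreal (supOU_kernel t (\<xi>, s) ^ n) \<partial>lborel \<partial>\<pi>)"
    by (rule nn_integral_pair) measurable
  also have "\<dots> = (\<integral>\<^sup>+\<xi>. ennreal (1 / real n) \<partial>\<pi>)"
    unfolding supOU_kernel_power[OF assms] using assms by (subst nn_integral_exp_atMost) auto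
  finally show ?thesis by (simp add: emeasure_space_1)
qed

lemma integrable_kernel_power:
  assumes "n > 0"
  shows "integrable C (\<lambda>x. supOU_kernel t x ^ n)" "(\<integral>x. supOU_kernel t x ^ n \<partial>C) = 1 / real n"
proof -
  show i: "integrable C (\<lambda>x. supOU_kernel t x ^ n)"
    by (rule integrableI_nonneg) (auto simp: nn_integral_kernel_power[OF assms])
  have "ennreal (\<integral>x. supOU_kernel t x ^ n \<partial>C) = ennreal (1 / real n)"
    unfolding nn_integral_kernel_power[OF assms, of t, symmetric]
    by (rule nn_integral_eq_integral[symmetric, OF i]) auto
  then show "(\<integral>x. supOU_kernel t x ^ n \<partial>C) = 1 / real n"
    by (subst (asm) ennreal_inj) (auto intro: integral_nonneg_AE)
qed

text \<open>One minus the Laplace transform of \<open>\<pi>\<close> at \<open>\<bar>d\<bar>\<close>,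
  that is, one minus the correlation of a supOU process at lag \<open>d\<close>. It is the squared
  \<open>L\<^sup>2\<close> distance of two kernels at times \<open>d\<close> apart.\<close>

definition "kernel_gap d = (\<integral>\<xi>. 1 - exp (- \<xi> * \<bar>d\<bar>) \<partial>\<pi>)"

lemma nn_integral_kernel_diff:
  "(\<integral>\<^sup>+x. ennreal ((supOU_kernel t x - supOU_kernel u x)\<^sup>2) \<partial>C) = ennreal (kernel_gap (t - u))"
proof -
  have inner: "(\<integral>\<^sup>+s. ennreal ((supOU_kernel t (\<xi>, s) - supOU_kernel u (\<xi>, s))\<^sup>2) \<partial>lborel) = ennreal (1 - exp (- \<xi> * \<bar>t - u\<bar>))"
    if \<xi>: "\<xi> > 0" for \<xi>
  proof -
    have sq: "(supOU_kernel r (\<xi>, s))\<^sup>2 = exp (2 * (s - \<xi> * r)) * indicator {..\<xi> * r} s" for r s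
      using supOU_kernel_power[of 2 r \<xi> s] by simp
    have isq: "integrable lborel (\<lambda>s. (supOU_kernel r (\<xi>, s))\<^sup>2)" "(LBINT s. (supOU_kernel r (\<xi>, s))\<^sup>2) = 1 / 2" for r
      unfolding sq using integral_exp_atMost[of 2 "\<xi> * r"] by simp_all
    \<comment> \<open>The product of the two kernels is supported where both are, that is up to
      \<open>\<xi> * min t u\<close>, and is there a multiple of exp (2 (s - m)).\<close>
    define m where "m = \<xi> * min t u"
    have ab: "\<bar>t - u\<bar> = t + u - 2 * min t u" by (simp add: min_def)
    have mm: "min (\<xi> * t) (\<xi> * u) = m" using \<xi> by (simp add: m_def min_mult_distrib_left)
    have pr: "supOU_kernel t (\<xi>, s) * supOU_kernel u (\<xi>, s) = exp (- \<xi> * \<bar>t - u\<bar>) * (exp (2 * (s - m)) * indicator {..m} s)" for s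
    proof -
      have "exp (s - \<xi> * t) * exp (s - \<xi> * u) = exp (- \<xi> * \<bar>t - u\<bar>) * exp (2 * (s - m))"
        unfolding exp_add[symmetric] ab m_def by (simp add: algebra_simps)
      then show ?thesis
        unfolding supOU_kernel_eq mm[symmetric] by (auto simp: indicator_def)
    qed
    have ipr: "integrable lborel (\<lambda>s. supOU_kernel t (\<xi>, s) * supOU_kernel u (\<xi>, s))"
      "(LBINT s. supOU_kernel t (\<xi>, s) * supOU_kernel u (\<xi>, s)) = exp (- \<xi> * \<bar>t - u\<bar>) / 2"
      unfolding pr using integral_exp_atMost[of 2 m] by (simp_all del: mult_minus_left)
    have eq: "(supOU_kernel t (\<xi>, s) - supOU_kernel u (\<xi>, s))\<^sup>2 =
        (supOU_kernel t (\<xi>, s))\<^sup>2 + (supOU_kernel u (\<xi>, s))\<^sup>2 - 2 * (supOU_kernel t (\<xi>, s) * supOU_kernel u (\<xi>, s))" for s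
      by (simp add: power2_diff)
    have "integrable lborel (\<lambda>s. (supOU_kernel t (\<xi>, s) - supOU_kernel u (\<xi>, s))\<^sup>2)"
      unfolding eq by (intro Bochner_Integration.integrable_diff Bochner_Integration.integrable_add integrable_mult_right isq ipr)
    then have "(\<integral>\<^sup>+s. ennreal ((supOU_kernel t (\<xi>, s) - supOU_kernel u (\<xi>, s))\<^sup>2) \<partial>lborel) =
        ennreal (LBINT s. (supOU_kernel t (\<xi>, s) - supOU_kernel u (\<xi>, s))\<^sup>2)"
      by (rule nn_integral_eq_integral) simp
    also have "(LBINT s. (supOU_kernel t (\<xi>, s) - supOU_kernel u (\<xi>, s))\<^sup>2) = 1 - exp (- \<xi> * \<bar>t - u\<bar>)"
      unfolding eq by (simp add: isq ipr)
    finally show ?thesis .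
  qed
  have "(\<integral>\<^sup>+x. ennreal ((supOU_kernel t x - supOU_kernel u x)\<^sup>2) \<partial>C) =
      (\<integral>\<^sup>+\<xi>. \<integral>\<^sup>+s. ennreal ((supOU_kernel t (\<xi>, s) - supOU_kernel u (\<xi>, s))\<^sup>2) \<partial>lborel \<partial>\<pi>)"
    by (rule nn_integral_pair) measurable
  also have "\<dots> = (\<integral>\<^sup>+\<xi>. ennreal (1 - exp (- \<xi> * \<bar>t - u\<bar>)) \<partial>\<pi>)"
    using pi_pos by (intro nn_integral_cong_AE) (auto simp: inner)
  also have "\<dots> = ennreal (kernel_gap (t - u))"
    unfolding kernel_gap_def
  proof (rule nn_integral_eq_integral)
    show "integrable \<pi> (\<lambda>\<xi>. 1 - exp (- \<xi> * \<bar>t - u\<bar>))"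
      using pi_pos by (intro integrable_const_bound[of _ 1]) (auto elim!: eventually_mono)
    show "AE \<xi> in \<pi>. 0 \<le> 1 - exp (- \<xi> * \<bar>t - u\<bar>)"
      using pi_pos by eventually_elim auto
  qed
  finally show ?thesis .
qed

lemma kernel_gap_bounds: "0 \<le> kernel_gap d" "kernel_gap d \<le> 1"
proof -
  show "0 \<le> kernel_gap d" unfolding kernel_gap_def
    by (rule integral_nonneg_AE, use pi_pos in eventually_elim) auto
  have "kernel_gap d \<le> (\<integral>\<xi>. 1 \<partial>\<pi>)"
    unfolding kernel_gap_def
  proof (rule integral_mono_AE)
    show "integrable \<pi> (\<lambda>\<xi>. 1 - exp (- \<xi> * \<bar>d\<bar>))"
      using pi_pos by (intro integrable_const_bound[of _ 1]) (auto elim!: eventually_mono)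
  qed auto
  then show "kernel_gap d \<le> 1" by (simp add: prob_space)
qed

lemma kernel_gap_tendsto_0:
  assumes "d \<longlonglongrightarrow> 0"
  shows "(\<lambda>n. kernel_gap (d n)) \<longlonglongrightarrow> 0"
proof -
  have "(\<lambda>n. kernel_gap (d n)) \<longlonglongrightarrow> (\<integral>\<xi>. 0 \<partial>\<pi>)"
    unfolding kernel_gap_def
  proof (rule integral_dominated_convergence[where w = "\<lambda>_. 1"])
    show "AE \<xi> in \<pi>. (\<lambda>n. 1 - exp (- \<xi> * \<bar>d n\<bar>)) \<longlonglongrightarrow> 0"
      using assms by (auto intro!: AE_I2 tendsto_eq_intros)
    show "AE \<xi> in \<pi>. norm (1 - exp (- \<xi> * \<bar>d n\<bar>)) \<le> 1" for n
      using pi_pos by eventually_elim auto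
  qed auto
  then show ?thesis by simp
qed

lemma kernel_set_integrable [simp]: "set_integrable lborel {0..t} (\<lambda>u. supOU_kernel u (\<xi>, s))"
proof -
  have [measurable]: "(\<lambda>u. supOU_kernel u (\<xi>, s)) \<in> borel_measurable borel"
    unfolding supOU_kernel_def by simp
  have "integrable lborel (indicator {0..t} :: real \<Rightarrow> real)"
    by (cases "t \<ge> 0") (simp_all add: integrable_indicator_iff)
  then show ?thesis
    unfolding set_integrable_def
    by (rule Bochner_Integration.integrable_bound)
       (auto simp: indicator_def abs_of_nonneg supOU_kernel_le_1)
qed

lemma ou_kernel_nn: "ennreal (ou_kernel t (\<xi>, s)) = (\<integral>\<^sup>+u. indicator {0..t} u * ennreal (supOU_kernel u (\<xi>, s)) \<partial>lborel)"
proof -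
  have "(\<integral>\<^sup>+u. indicator {0..t} u * ennreal (supOU_kernel u (\<xi>, s)) \<partial>lborel) =
      (\<integral>\<^sup>+u. ennreal (indicator {0..t} u *\<^sub>R supOU_kernel u (\<xi>, s)) \<partial>lborel)"
    by (intro nn_integral_cong) (auto simp: indicator_def)
  also have "\<dots> = ennreal (LBINT u. indicator {0..t} u *\<^sub>R supOU_kernel u (\<xi>, s))"
    using kernel_set_integrable[of t \<xi> s] unfolding set_integrable_def by (intro nn_integral_eq_integral) auto
  finally show ?thesis by (simp add: ou_kernel_def set_lebesgue_integral_def)
qed

lemma ou_kernel_nonneg [simp]: "0 \<le> ou_kernel t x"
  unfolding ou_kernel_def set_lebesgue_integral_def by (intro integral_nonneg_AE) auto

lemma ou_kernel_measurable [measurable]: "ou_kernel t \<in> borel_measurable C"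
proof -
  have "(\<lambda>(x, u). indicator {0..t} u *\<^sub>R supOU_kernel u x) \<in> borel_measurable (C \<Otimes>\<^sub>M lborel)"
    by measurable
  then have "(\<lambda>x. LBINT u. indicator {0..t} u *\<^sub>R supOU_kernel u x) \<in> borel_measurable C"
    by (rule lborel.borel_measurable_lebesgue_integral)
  then show ?thesis by (simp add: ou_kernel_def[abs_def] set_lebesgue_integral_def)
qed

text \<open>The bound \<open>t\<close> holds because the kernel is at most 1. For 1 / \<xi>, extend
  the time integral to the whole line: what remains is exp (s - \<xi> u) integrated over u \<ge> s /
  \<xi>.\<close>

lemma ou_kernel_le:
  assumes t: "t \<ge> 0" and \<xi>: "\<xi> > 0"
  shows "ou_kernel t (\<xi>, s) \<le> min t (1 / \<xi>)"
proof (rule min.boundedI)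
  have "ennreal (ou_kernel t (\<xi>, s)) \<le> (\<integral>\<^sup>+u. indicator {0..t} u \<partial>lborel)"
    unfolding ou_kernel_nn
    by (intro nn_integral_mono) (auto simp: indicator_def supOU_kernel_le_1)
  also have "\<dots> = ennreal t" using t by simp
  finally show "ou_kernel t (\<xi>, s) \<le> t" using t by simp
  have "ennreal (ou_kernel t (\<xi>, s)) \<le> (\<integral>\<^sup>+u. ennreal (exp (- \<xi> * u + s) * indicator {0..} (\<xi> * u - s)) \<partial>lborel)"
    unfolding ou_kernel_nn
    by (intro nn_integral_mono) (auto simp: indicator_def supOU_kernel_eq algebra_simps)
  also have "\<dots> = ennreal \<bar>-1\<bar> * (\<integral>\<^sup>+u. ennreal (exp (- \<xi> * (0 + -1 * u) + s) * indicator {0..} (\<xi> * (0 + -1 * u) - s)) \<partial>lborel)"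
    by (rule nn_integral_real_affine) auto
  also have "\<dots> = (\<integral>\<^sup>+u. ennreal (exp (\<xi> * (u - (- s / \<xi>))) * indicator {..- s / \<xi>} u) \<partial>lborel)"
    using \<xi> by (auto simp: indicator_def field_simps intro!: nn_integral_cong)
  also have "\<dots> = ennreal (1 / \<xi>)"
    by (rule nn_integral_exp_atMost[OF \<xi>])
  finally show "ou_kernel t (\<xi>, s) \<le> 1 / \<xi>" using \<xi> by simp
qed

text \<open>Tonelli's theorem, together with the fact that each \<open>supOU_kernel u\<close>
  integrates to one over \<open>s\<close>.\<close>

lemma nn_integral_ou_kernel:
  assumes t: "t \<ge> 0"
  shows "(\<integral>\<^sup>+s. ennreal (ou_kernel t (\<xi>, s)) \<partial>lborel) = ennreal t"
proof -
  have m: "(\<lambda>(s, u). indicator {0..t} u * ennreal (supOU_kernel u (\<xi>, s))) \<in> borel_measurable (lborel \<Otimes>\<^sub>M lborel)"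
  proof -
    have "(\<lambda>z. indicator {0..t} (snd z) * ennreal (exp (- \<xi> * snd z + fst z) * indicator {0..} (\<xi> * snd z - fst z))) \<in> borel_measurable (lborel \<Otimes>\<^sub>M lborel)"
      by measurable
    then show ?thesis by (simp add: supOU_kernel_def case_prod_beta')
  qed
  have "(\<integral>\<^sup>+s. ennreal (ou_kernel t (\<xi>, s)) \<partial>lborel) = (\<integral>\<^sup>+s. \<integral>\<^sup>+u. indicator {0..t} u * ennreal (supOU_kernel u (\<xi>, s)) \<partial>lborel \<partial>lborel)"
    unfolding ou_kernel_nn ..
  also have "\<dots> = (\<integral>\<^sup>+u. \<integral>\<^sup>+s. indicator {0..t} u * ennreal (supOU_kernel u (\<xi>, s)) \<partial>lborel \<partial>lborel)"
    by (rule lborel_pair.Fubini'[symmetric]) (use m in \<open>simp add: measurable_split_conv pred_def\<close>)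
  also have "\<dots> = (\<integral>\<^sup>+u. indicator {0..t} u \<partial>lborel)"
  proof (rule nn_integral_cong)
    fix u :: real
    have "(\<integral>\<^sup>+s. indicator {0..t} u * ennreal (supOU_kernel u (\<xi>, s)) \<partial>lborel) =
      indicator {0..t} u * (\<integral>\<^sup>+s. ennreal (exp (1 * (s - \<xi> * u)) * indicator {..\<xi> * u} s) \<partial>lborel)"
      by (subst nn_integral_cmult[symmetric]) (auto simp: supOU_kernel_eq)
    also have "\<dots> = indicator {0..t} u" by (subst nn_integral_exp_atMost) auto
    finally show "(\<integral>\<^sup>+s. indicator {0..t} u * ennreal (supOU_kernel u (\<xi>, s)) \<partial>lborel) = indicator {0..t} u" .
  qed
  finally show ?thesis using t by simp
qed

text \<open>All but one of the factors \<open>ou_kernel t x\<close> are bounded by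
  \<open>min t (1 / \<xi>)\<close>, and the last one integrates to \<open>t\<close> over
  \<open>s\<close>.\<close>

lemma ou_moment_upper:
  assumes t: "t \<ge> 0"
  shows "(\<integral>\<^sup>+x. ennreal (ou_kernel t x ^ Suc n) \<partial>C) \<le> ennreal t * (\<integral>\<^sup>+\<xi>. ennreal (min t (1 / \<xi>) ^ n) \<partial>\<pi>)"
proof -
  have "(\<integral>\<^sup>+x. ennreal (ou_kernel t x ^ Suc n) \<partial>C) = (\<integral>\<^sup>+\<xi>. \<integral>\<^sup>+s. ennreal (ou_kernel t (\<xi>, s) ^ Suc n) \<partial>lborel \<partial>\<pi>)"
    by (rule nn_integral_pair) measurable
  also have "\<dots> \<le> (\<integral>\<^sup>+\<xi>. ennreal t * ennreal (min t (1 / \<xi>) ^ n) \<partial>\<pi>)"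
  proof (rule nn_integral_mono_AE, use pi_pos in eventually_elim)
    fix \<xi> :: real assume \<xi>: "\<xi> > 0"
    have m: "(\<lambda>s. ou_kernel t (\<xi>, s)) \<in> borel_measurable lborel"
      using \<xi> by (intro measurable_Pair2[OF ou_kernel_measurable]) (simp add: space_pi)
    have "(\<integral>\<^sup>+s. ennreal (ou_kernel t (\<xi>, s) ^ Suc n) \<partial>lborel) \<le> (\<integral>\<^sup>+s. ennreal (min t (1 / \<xi>) ^ n) * ennreal (ou_kernel t (\<xi>, s)) \<partial>lborel)"
    proof (rule nn_integral_mono)
      fix s
      have "ou_kernel t (\<xi>, s) ^ Suc n \<le> min t (1 / \<xi>) ^ n * ou_kernel t (\<xi>, s)"
        unfolding power_Suc2 by (intro mult_right_mono power_mono ou_kernel_le t \<xi>) auto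
      then show "ennreal (ou_kernel t (\<xi>, s) ^ Suc n) \<le> ennreal (min t (1 / \<xi>) ^ n) * ennreal (ou_kernel t (\<xi>, s))"
        using t \<xi> by (subst ennreal_mult[symmetric]) (auto intro!: ennreal_leI)
    qed
    also have "\<dots> = ennreal (min t (1 / \<xi>) ^ n) * (\<integral>\<^sup>+s. ennreal (ou_kernel t (\<xi>, s)) \<partial>lborel)"
      using m by (intro nn_integral_cmult) auto
    also have "\<dots> = ennreal t * ennreal (min t (1 / \<xi>) ^ n)"
      by (simp add: nn_integral_ou_kernel[OF t] mult.commute)
    finally show "(\<integral>\<^sup>+s. ennreal (ou_kernel t (\<xi>, s) ^ Suc n) \<partial>lborel) \<le> ennreal t * ennreal (min t (1 / \<xi>) ^ n)" .
  qed
  also have "\<dots> = ennreal t * (\<integral>\<^sup>+\<xi>. ennreal (min t (1 / \<xi>) ^ n) \<partial>\<pi>)"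
    by (intro nn_integral_cmult) measurable
  finally show ?thesis .
qed

lemma ou_kernel_ge:
  assumes "0 \<le> p" "p \<le> q" "q \<le> t" "c \<ge> 0" and "\<And>u. p \<le> u \<Longrightarrow> u \<le> q \<Longrightarrow> c \<le> supOU_kernel u (\<xi>, s)"
  shows "c * (q - p) \<le> ou_kernel t (\<xi>, s)"
proof -
  have "ennreal (c * (q - p)) = (\<integral>\<^sup>+u. ennreal c * indicator {p..q} u \<partial>lborel)"
    using assms by (simp add: nn_integral_cmult_indicator ennreal_mult)
  also have "\<dots> \<le> ennreal (ou_kernel t (\<xi>, s))"
    unfolding ou_kernel_nn using assms by (intro nn_integral_mono) (auto simp: indicator_def intro!: ennreal_leI)
  finally show ?thesis by (simp add: ennreal_le_iff)
qed

text \<open>Keep only the slow components \<open>\<xi> \<le> 1 / t\<close> and \<open>s\<close> in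
  \<open>{-1..0}\<close>. There s - \<xi> u \<ge> -2 for all \<open>u\<close> in
  \<open>{0..t}\<close>, so the kernel is at least exp (-2) throughout and its time integral at
  least exp (-2) t.\<close>

lemma ou_moment_lower:
  assumes t: "t > 0"
  shows "ennreal (exp (- 2 * real n) * t ^ n * measure \<pi> {0<..1 / t}) \<le> (\<integral>\<^sup>+x. ennreal (ou_kernel t x ^ n) \<partial>C)"
proof -
  have S: "{0<..1 / t} \<in> sets \<pi>"
    by (auto simp: sets_pi sets_restrict_space_iff)
  have "ennreal (exp (- 2 * real n) * t ^ n * measure \<pi> {0<..1 / t}) = (\<integral>\<^sup>+\<xi>. ennreal ((exp (- 2) * t) ^ n) * indicator {0<..1 / t} \<xi> \<partial>\<pi>)"
    using S t by (subst nn_integral_cmult_indicator)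
      (auto simp: emeasure_eq_measure ennreal_mult power_mult_distrib exp_of_nat_mult[symmetric] mult.commute)
  also have "\<dots> \<le> (\<integral>\<^sup>+\<xi>. \<integral>\<^sup>+s. ennreal (ou_kernel t (\<xi>, s) ^ n) \<partial>lborel \<partial>\<pi>)"
  proof (rule nn_integral_mono)
    fix \<xi> :: real
    show "ennreal ((exp (- 2) * t) ^ n) * indicator {0<..1 / t} \<xi> \<le> (\<integral>\<^sup>+s. ennreal (ou_kernel t (\<xi>, s) ^ n) \<partial>lborel)"
    proof (cases "\<xi> \<in> {0<..1 / t}")
      case True
      then have \<xi>: "\<xi> > 0" "\<xi> * t \<le> 1" using t by (auto simp: field_simps)
      have "exp (- 2) * (t - 0) \<le> ou_kernel t (\<xi>, s)" if s: "s \<in> {-1..0}" for s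
      proof (rule ou_kernel_ge)
        fix u assume u: "0 \<le> u" "u \<le> t"
        have "\<xi> * u \<le> \<xi> * t" using u \<xi> by (intro mult_left_mono) auto
        moreover have "-1 \<le> s" using s by simp
        ultimately have "- 2 \<le> s - \<xi> * u" using \<xi>(2) by linarith
        moreover have "s \<le> \<xi> * u" using s u \<xi> by (auto intro: order_trans[of s 0])
        ultimately show "exp (- 2) \<le> supOU_kernel u (\<xi>, s)" by (simp add: supOU_kernel_eq)
      qed (use t in auto)
      then have "(exp (- 2) * t) ^ n \<le> ou_kernel t (\<xi>, s) ^ n" if "s \<in> {-1..0}" for s
        using that t by (intro power_mono) auto
      then have "(\<integral>\<^sup>+s. ennreal ((exp (- 2) * t) ^ n) * indicator {-1..0::real} s \<partial>lborel) \<le> (\<integral>\<^sup>+s. ennreal (ou_kernel t (\<xi>, s) ^ n) \<partial>lborel)"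
        by (intro nn_integral_mono) (auto simp: indicator_def intro!: ennreal_leI)
      then show ?thesis using True by (simp add: nn_integral_cmult_indicator)
    qed simp
  qed
  also have "\<dots> = (\<integral>\<^sup>+x. ennreal (ou_kernel t x ^ n) \<partial>C)"
    by (rule nn_integral_pair[symmetric]) measurable
  finally show ?thesis .
qed

text \<open>For \<open>s\<close> in \<open>{0..\<xi> * (t - 1)}\<close> the kernel is at least exp
  (- \<xi>) during the unit time window that starts at s / \<xi>, which lies within
  \<open>{0..t}\<close>. The length of this range of \<open>s\<close> is proportional to
  \<open>t - 1\<close>.\<close>

lemma ou_second_moment_lower:
  "\<exists>c>0. \<forall>t\<ge>1. ennreal (c * (t - 1)) \<le> (\<integral>\<^sup>+x. ennreal (ou_kernel t x ^ 2) \<partial>C)"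
proof -
  \<comment> \<open>A lower bound for what a single \<open>\<xi>\<close> contributes per unit of
    \<open>t - 1\<close>. The cap at 1 makes integrability evident, and positivity almost everywhere
    makes the integral \<open>c\<close> positive.\<close>
  define g where "g \<xi> = min 1 (\<xi> * exp (- 2 * \<xi>))" for \<xi> :: real
  have [measurable]: "g \<in> borel_measurable \<pi>" unfolding g_def by measurable
  have gpos: "g \<xi> > 0" if "\<xi> > 0" for \<xi> using that by (simp add: g_def)
  have ig: "integrable \<pi> g"
    using pi_pos by (intro integrable_const_bound[of _ 1]) (auto elim!: eventually_mono dest: gpos simp: abs_of_pos, auto simp: g_def)
  define c where "c = integral\<^sup>L \<pi> g"
  have "c \<noteq> 0"
  proof
    assume "c = 0"
    moreover have "AE \<xi> in \<pi>. 0 \<le> g \<xi>"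
      using pi_pos by eventually_elim (auto dest: gpos)
    ultimately have "AE \<xi> in \<pi>. g \<xi> = 0"
      using integral_nonneg_eq_0_iff_AE[OF ig] by (simp add: c_def)
    with pi_pos have "AE \<xi> in \<pi>. False" by eventually_elim (auto dest: gpos)
    then show False by (simp add: AE_False)
  qed
  moreover have "c \<ge> 0"
    unfolding c_def by (rule integral_nonneg_AE, use pi_pos in eventually_elim) (auto dest: gpos)
  ultimately have c: "c > 0" by simp
  show ?thesis
  proof (intro exI conjI allI impI)
    fix t :: real assume t: "1 \<le> t"
    have "ennreal (c * (t - 1)) = ennreal (t - 1) * (\<integral>\<^sup>+\<xi>. ennreal (g \<xi>) \<partial>\<pi>)"
      using c t by (subst nn_integral_eq_integral[OF ig]) (use pi_pos in \<open>auto simp: c_def[symmetric] ennreal_mult[symmetric] mult.commute elim!: eventually_mono dest: gpos\<close>)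
    also have "\<dots> = (\<integral>\<^sup>+\<xi>. ennreal (t - 1) * ennreal (g \<xi>) \<partial>\<pi>)"
      by (rule nn_integral_cmult[symmetric]) measurable
    also have "\<dots> \<le> (\<integral>\<^sup>+\<xi>. \<integral>\<^sup>+s. ennreal (ou_kernel t (\<xi>, s) ^ 2) \<partial>lborel \<partial>\<pi>)"
    proof (rule nn_integral_mono_AE, use pi_pos in eventually_elim)
      fix \<xi> :: real assume \<xi>: "\<xi> > 0"
      have "exp (- \<xi>) * (s / \<xi> + 1 - s / \<xi>) \<le> ou_kernel t (\<xi>, s)" if s: "s \<in> {0..\<xi> * (t - 1)}" for s
      proof (rule ou_kernel_ge)
        fix u assume u: "s / \<xi> \<le> u" "u \<le> s / \<xi> + 1"
        then have "s \<le> \<xi> * u" "\<xi> * u \<le> s + \<xi>" using \<xi> by (auto simp: field_simps)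
        then show "exp (- \<xi>) \<le> supOU_kernel u (\<xi>, s)" by (simp add: supOU_kernel_eq)
      qed (use \<xi> s in \<open>auto simp: field_simps\<close>)
      then have "exp (- \<xi>) ^ 2 \<le> ou_kernel t (\<xi>, s) ^ 2" if "s \<in> {0..\<xi> * (t - 1)}" for s
        using that by (intro power_mono) auto
      then have "(\<integral>\<^sup>+s. ennreal (exp (- \<xi>) ^ 2) * indicator {0..\<xi> * (t - 1)} s \<partial>lborel) \<le> (\<integral>\<^sup>+s. ennreal (ou_kernel t (\<xi>, s) ^ 2) \<partial>lborel)"
        by (intro nn_integral_mono) (auto simp: indicator_def intro!: ennreal_leI)
      moreover have "(\<integral>\<^sup>+s. ennreal (exp (- \<xi>) ^ 2) * indicator {0..\<xi> * (t - 1)} s \<partial>lborel) = ennreal (exp (- \<xi>) ^ 2 * (\<xi> * (t - 1)))"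
        using \<xi> t by (simp add: nn_integral_cmult_indicator ennreal_mult)
      moreover have "ennreal (t - 1) * ennreal (g \<xi>) \<le> ennreal (exp (- \<xi>) ^ 2 * (\<xi> * (t - 1)))"
      proof -
        have "(t - 1) * g \<xi> \<le> (t - 1) * (\<xi> * exp (- 2 * \<xi>))"
          using t by (intro mult_left_mono) (auto simp: g_def)
        also have "exp (- 2 * \<xi>) = exp (- \<xi>) ^ 2" by (simp add: exp_double[symmetric])
        finally show ?thesis using t gpos[OF \<xi>] by (subst ennreal_mult[symmetric]) (auto intro!: ennreal_leI simp: mult_ac)
      qed
      ultimately show "ennreal (t - 1) * ennreal (g \<xi>) \<le> (\<integral>\<^sup>+s. ennreal (ou_kernel t (\<xi>, s) ^ 2) \<partial>lborel)" by auto
    qed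
    also have "\<dots> = (\<integral>\<^sup>+x. ennreal (ou_kernel t x ^ 2) \<partial>C)"
      by (rule nn_integral_pair[symmetric]) measurable
    finally show "ennreal (c * (t - 1)) \<le> (\<integral>\<^sup>+x. ennreal (ou_kernel t x ^ 2) \<partial>C)" .
  qed (fact c)
qed

lemma integrable_ou_kernel_power:
  assumes "t \<ge> 0"
  shows "integrable C (\<lambda>x. ou_kernel t x ^ Suc n)"
proof (rule integrableI_nonneg)
  have "(\<integral>\<^sup>+\<xi>. ennreal (min t (1 / \<xi>) ^ n) \<partial>\<pi>) \<le> (\<integral>\<^sup>+\<xi>. ennreal (t ^ n) \<partial>\<pi>)"
    using assms pi_pos by (intro nn_integral_mono_AE) (auto elim!: eventually_mono intro!: ennreal_leI power_mono)
  also have "\<dots> < \<infinity>" by (simp add: emeasure_space_1)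
  finally have "ennreal t * (\<integral>\<^sup>+\<xi>. ennreal (min t (1 / \<xi>) ^ n) \<partial>\<pi>) < \<infinity>"
    by (simp add: ennreal_mult_less_top)
  with ou_moment_upper[OF assms, of n] show "(\<integral>\<^sup>+x. ennreal (ou_kernel t x ^ Suc n) \<partial>C) < \<infinity>"
    by (rule le_less_trans)
qed auto

end

section \<open>Riemann sums\<close>

text \<open>The linear term of the expansion vanishes with the mean, so only a quadratic deviation
  from 1 is left.\<close>

lemma (in prob_space) norm_char_minus_1_le:
  assumes [measurable]: "Y \<in> borel_measurable M" and sq: "integrable M (\<lambda>\<omega>. (Y \<omega>)\<^sup>2)" and mean: "expectation Y = 0"
  shows "norm (char (distr M borel Y) \<zeta> - 1) \<le> \<zeta>\<^sup>2 / 2 * expectation (\<lambda>\<omega>. (Y \<omega>)\<^sup>2)"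
proof -
  have iY: "integrable M Y"
    by (rule square_integrable_imp_integrable[OF _ sq]) simp
  have ii: "integrable M (\<lambda>x. iexp (\<zeta> * Y x))"
    by (intro integrable_const_bound[of _ 1]) auto
  have im: "integrable M (\<lambda>x. \<i> * of_real (\<zeta> * Y x))"
    by (intro integrable_mult_right integrable_of_real iY)
  have "(CLINT x|M. \<i> * of_real (\<zeta> * Y x)) = 0"
    unfolding integral_mult_right_zero integral_complex_of_real by (simp add: mean)
  moreover have "(CLINT x|M. iexp (\<zeta> * Y x) - 1 - \<i> * of_real (\<zeta> * Y x)) = (CLINT x|M. iexp (\<zeta> * Y x) - 1) - (CLINT x|M. \<i> * of_real (\<zeta> * Y x))"
    by (intro Bochner_Integration.integral_diff Bochner_Integration.integrable_diff ii im) auto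
  moreover have "(CLINT x|M. iexp (\<zeta> * Y x) - 1) = (CLINT x|M. iexp (\<zeta> * Y x)) - (CLINT x|M. 1)"
    by (intro Bochner_Integration.integral_diff ii) auto
  ultimately have "char (distr M borel Y) \<zeta> - 1 = (CLINT x|M. iexp (\<zeta> * Y x) - 1 - \<i> * of_real (\<zeta> * Y x))"
    by (simp add: char_def integral_distr prob_space)
  also have "norm \<dots> \<le> (\<integral>x. norm (iexp (\<zeta> * Y x) - 1 - \<i> * of_real (\<zeta> * Y x)) \<partial>M)"
    by (rule integral_norm_bound)
  also have "\<dots> \<le> (\<integral>x. \<zeta>\<^sup>2 / 2 * (Y x)\<^sup>2 \<partial>M)"
  proof (rule integral_mono)
    show "integrable M (\<lambda>x. norm (iexp (\<zeta> * Y x) - 1 - \<i> * of_real (\<zeta> * Y x)))"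
      by (intro integrable_norm Bochner_Integration.integrable_diff ii im) auto
    show "norm (iexp (\<zeta> * Y x) - 1 - \<i> * of_real (\<zeta> * Y x)) \<le> \<zeta>\<^sup>2 / 2 * (Y x)\<^sup>2" for x
      using norm_iexp_diff_2[of "\<zeta> * Y x"] by (simp add: power_mult_distrib)
  qed (intro integrable_mult_right sq)
  also have "\<dots> = \<zeta>\<^sup>2 / 2 * expectation (\<lambda>\<omega>. (Y \<omega>)\<^sup>2)"
    by simp
  finally show ?thesis .
qed

lemma (in centered_levy_exponent) exponent_integrable:
  assumes \<kappa>: "continuous_on UNIV \<kappa>" and [measurable]: "G \<in> borel_measurable N" and "integrable N (\<lambda>x. (G x)\<^sup>2)"
  shows "integrable N (\<lambda>x. \<kappa> (\<zeta> * G x))"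
    "norm (CLINT x|N. \<kappa> (\<zeta> * G x)) \<le> levy_var / 2 * \<zeta>\<^sup>2 * (\<integral>x. (G x)\<^sup>2 \<partial>N)"
proof -
  have [measurable]: "\<kappa> \<in> borel_measurable borel"
    using \<kappa> by (rule borel_measurable_continuous_onI)
  have i: "integrable N (\<lambda>x. levy_var / 2 * \<zeta>\<^sup>2 * (G x)\<^sup>2)"
    by (intro integrable_mult_right assms)
  have b: "norm (\<kappa> (\<zeta> * G x)) \<le> levy_var / 2 * \<zeta>\<^sup>2 * (G x)\<^sup>2" for x
    using exponent_bound[of "\<zeta> * G x"] by (simp add: power_mult_distrib mult.assoc)
  show *: "integrable N (\<lambda>x. \<kappa> (\<zeta> * G x))"
    by (rule Bochner_Integration.integrable_bound[OF i], measurable, rule AE_I2,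
        subst real_norm_def, rule order_trans[OF b abs_ge_self])
  have "norm (CLINT x|N. \<kappa> (\<zeta> * G x)) \<le> (\<integral>x. norm (\<kappa> (\<zeta> * G x)) \<partial>N)"
    by (rule integral_norm_bound)
  also have "\<dots> \<le> (\<integral>x. levy_var / 2 * \<zeta>\<^sup>2 * (G x)\<^sup>2 \<partial>N)"
    by (rule integral_mono[OF integrable_norm[OF *] i b])
  finally show "norm (CLINT x|N. \<kappa> (\<zeta> * G x)) \<le> levy_var / 2 * \<zeta>\<^sup>2 * (\<integral>x. (G x)\<^sup>2 \<partial>N)"
    by simp
qed

text \<open>\<open>exponent_diff_bound\<close> leaves a mixed term in \<bar>G - F\<bar> and
  \<bar>F\<bar>. Young's inequality with weight \<open>d\<close> splits it into a part that tends to
  zero and a part proportional to \<open>d\<close>.\<close>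

lemma (in centered_levy_exponent) exponent_integral_tendsto:
  assumes \<kappa>: "continuous_on UNIV \<kappa>"
    and [measurable]: "F \<in> borel_measurable N" "\<And>n. G n \<in> borel_measurable N"
    and F: "integrable N (\<lambda>x. (F x)\<^sup>2)" and G: "\<And>n. integrable N (\<lambda>x. (G n x)\<^sup>2)"
    and GF: "\<And>n. integrable N (\<lambda>x. (G n x - F x)\<^sup>2)"
    and lim: "(\<lambda>n. \<integral>x. (G n x - F x)\<^sup>2 \<partial>N) \<longlonglongrightarrow> 0"
  shows "(\<lambda>n. CLINT x|N. \<kappa> (\<zeta> * G n x)) \<longlonglongrightarrow> (CLINT x|N. \<kappa> (\<zeta> * F x))"
proof (rule LIMSEQ_I)
  fix r :: real assume r: "r > 0"
  define e where "e n = (\<integral>x. (G n x - F x)\<^sup>2 \<partial>N)" for n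
  define w where "w = (\<integral>x. (F x)\<^sup>2 \<partial>N)"
  have w: "w \<ge> 0" unfolding w_def by (intro integral_nonneg_AE) auto
  define A where "A = levy_var * \<zeta>\<^sup>2"
  have A: "A \<ge> 0" using levy_var_nonneg by (simp add: A_def)
  \<comment> \<open>Makes the part that carries the second moment \<open>w\<close> of
    \<open>F\<close> at most r / 2; the added 1 avoids division by zero.\<close>
  define d where "d = r / (2 * (A * w + 1))"
  have Aw: "A * w \<ge> 0" using A w by simp
  then have d: "d > 0" using r by (simp add: d_def)
  have bd: "norm (\<kappa> (\<zeta> * G n x) - \<kappa> (\<zeta> * F x)) \<le> A * (1 + 1 / d) * (G n x - F x)\<^sup>2 + A * d * (F x)\<^sup>2" for n x
  proof -
    let ?u = "\<bar>G n x - F x\<bar>" and ?v = "\<bar>F x\<bar>"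
    have "norm (\<kappa> (\<zeta> * G n x) - \<kappa> (\<zeta> * F x)) \<le> levy_var * ((\<zeta> * (G n x - F x))\<^sup>2 + \<bar>\<zeta> * (G n x - F x)\<bar> * \<bar>\<zeta> * F x\<bar>)"
      using exponent_diff_bound[of "\<zeta> * G n x" "\<zeta> * F x"] by (simp only: right_diff_distrib)
    also have "\<dots> = A * (?u\<^sup>2 + ?u * ?v)"
    proof -
      have "\<bar>\<zeta> * (G n x - F x)\<bar> * \<bar>\<zeta> * F x\<bar> = \<bar>\<zeta>\<bar>\<^sup>2 * (?u * ?v)"
        unfolding abs_mult by (simp only: power2_eq_square mult_ac)
      then show ?thesis by (simp add: A_def power_mult_distrib distrib_left mult.assoc)
    qed
    also have "\<dots> \<le> A * (?u\<^sup>2 + (1 / d * ?u\<^sup>2 + d * ?v\<^sup>2))"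
    proof (intro mult_left_mono add_left_mono A)
      have "0 \<le> (?u - d * ?v)\<^sup>2 / d" using d by simp
      also have "\<dots> = 1 / d * ?u\<^sup>2 + d * ?v\<^sup>2 - 2 * (?u * ?v)"
        using d by (simp add: power2_diff field_simps power2_eq_square)
      finally have "2 * (?u * ?v) \<le> 1 / d * ?u\<^sup>2 + d * ?v\<^sup>2" by simp
      moreover have "0 \<le> ?u * ?v" by simp
      ultimately show "?u * ?v \<le> 1 / d * ?u\<^sup>2 + d * ?v\<^sup>2" by linarith
    qed
    finally show ?thesis by (simp add: algebra_simps)
  qed
  have ineq: "norm ((CLINT x|N. \<kappa> (\<zeta> * G n x)) - (CLINT x|N. \<kappa> (\<zeta> * F x))) \<le> A * (1 + 1 / d) * e n + A * d * w" for n
  proof -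
    have iG: "integrable N (\<lambda>x. \<kappa> (\<zeta> * G n x))" and iF: "integrable N (\<lambda>x. \<kappa> (\<zeta> * F x))"
      by (intro exponent_integrable \<kappa> F G; measurable)+
    have "norm ((CLINT x|N. \<kappa> (\<zeta> * G n x)) - (CLINT x|N. \<kappa> (\<zeta> * F x))) = norm (CLINT x|N. \<kappa> (\<zeta> * G n x) - \<kappa> (\<zeta> * F x))"
      by (subst Bochner_Integration.integral_diff[OF iG iF]) simp
    also have "\<dots> \<le> (\<integral>x. norm (\<kappa> (\<zeta> * G n x) - \<kappa> (\<zeta> * F x)) \<partial>N)" by (rule integral_norm_bound)
    also have "\<dots> \<le> (\<integral>x. A * (1 + 1 / d) * (G n x - F x)\<^sup>2 + A * d * (F x)\<^sup>2 \<partial>N)"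
      by (rule integral_mono[OF integrable_norm[OF Bochner_Integration.integrable_diff[OF iG iF]] _ bd])
         (intro Bochner_Integration.integrable_add integrable_mult_right F GF)
    also have "\<dots> = A * (1 + 1 / d) * e n + A * d * w"
      unfolding e_def w_def by (subst Bochner_Integration.integral_add) (auto intro: F GF)
    finally show ?thesis .
  qed
  have Adw: "A * d * w < r / 2 + r / 4"
  proof -
    have "A * d * w = (A * w) * r / (2 * (A * w + 1))" by (simp add: d_def)
    also have "\<dots> \<le> r / 2" using Aw r by (simp add: field_simps)
    finally show ?thesis using r by linarith
  qed
  have "(\<lambda>n. A * (1 + 1 / d) * e n) \<longlonglongrightarrow> A * (1 + 1 / d) * 0"
    unfolding e_def by (intro tendsto_intros lim)
  then have "\<forall>\<^sub>F n in sequentially. A * (1 + 1 / d) * e n < r / 4"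
    using r by (intro order_tendstoD(2)) auto
  then obtain N0 where N0: "\<And>n. n \<ge> N0 \<Longrightarrow> A * (1 + 1 / d) * e n < r / 4"
    unfolding eventually_sequentially by blast
  have "norm ((CLINT x|N. \<kappa> (\<zeta> * G n x)) - (CLINT x|N. \<kappa> (\<zeta> * F x))) < r" if "n \<ge> N0" for n
    using ineq[of n] Adw N0[OF that] by linarith
  then show "\<exists>no. \<forall>n\<ge>no. norm ((CLINT x|N. \<kappa> (\<zeta> * G n x)) - (CLINT x|N. \<kappa> (\<zeta> * F x))) < r"
    by blast
qed

text \<open>The left end of the cell of mesh 1 / (n + 1) that contains \<open>s\<close>. The mesh
  does not depend on \<open>t\<close>; instead \<open>grid_weight\<close> cuts the cells off at
  \<open>t\<close>.\<close>

definition grid :: "nat \<Rightarrow> real \<Rightarrow> real" where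
  "grid n s = of_int \<lfloor>s * real (Suc n)\<rfloor> / real (Suc n)"

definition grid_weight :: "nat \<Rightarrow> real \<Rightarrow> nat \<Rightarrow> real" where
  "grid_weight n t k = measure lborel ({0..t} \<inter> {real k / real (Suc n)..<real (Suc k) / real (Suc n)})"

text \<open>A finite linear combination of values of \<open>h\<close>, so that linearity of the
  stochastic integral applies to it.\<close>

definition riemann_sum :: "nat \<Rightarrow> real \<Rightarrow> (real \<Rightarrow> real) \<Rightarrow> real" where
  "riemann_sum n t h = (\<Sum>k\<le>nat \<lfloor>t * real (Suc n)\<rfloor>. grid_weight n t k * h (real k / real (Suc n)))"

lemma grid_dist: "\<bar>s - grid n s\<bar> \<le> 1 / real (Suc n)"
proof -
  have "s * real (Suc n) - of_int \<lfloor>s * real (Suc n)\<rfloor> \<le> 1" "0 \<le> s * real (Suc n) - of_int \<lfloor>s * real (Suc n)\<rfloor>"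
    by linarith+
  moreover have "s - grid n s = (s * real (Suc n) - of_int \<lfloor>s * real (Suc n)\<rfloor>) / real (Suc n)"
    by (simp add: grid_def diff_divide_distrib del: of_nat_Suc)
  ultimately show ?thesis by (simp add: divide_right_mono del: of_nat_Suc)
qed

lemma grid_measurable [measurable]: "grid n \<in> borel_measurable borel"
  unfolding grid_def[abs_def] by measurable

text \<open>The sum is the exact integral of a step function, so its error is the integral of h at
  \<open>s\<close> minus h at \<open>grid n s\<close>.\<close>

lemma riemann_sum_eq:
  "set_integrable lborel {0..t} (\<lambda>s. h (grid n s))" "(LBINT s:{0..t}. h (grid n s)) = riemann_sum n t h"
proof -
  let ?K = "nat \<lfloor>t * real (Suc n)\<rfloor>"
  let ?I = "\<lambda>k. {0..t} \<inter> {real k / real (Suc n)..<real (Suc k) / real (Suc n)}"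
  have eq: "indicator {0..t} s *\<^sub>R h (grid n s) = (\<Sum>k\<le>?K. indicator (?I k) s * h (real k / real (Suc n)))" for s
  proof (cases "s \<in> {0..t}")
    case True
    define k where "k = nat \<lfloor>s * real (Suc n)\<rfloor>"
    have k0: "of_int \<lfloor>s * real (Suc n)\<rfloor> = real k" using True by (simp add: k_def)
    have kK: "k \<le> ?K"
      using True unfolding k_def by (intro nat_mono floor_mono mult_right_mono) auto
    have mem: "s \<in> ?I j \<longleftrightarrow> j = k" for j
    proof -
      have "s \<in> ?I j \<longleftrightarrow> real j \<le> s * real (Suc n) \<and> s * real (Suc n) < real j + 1"
        using True by (auto simp: pos_divide_le_eq pos_less_divide_eq simp del: of_nat_Suc)
      also have "\<dots> \<longleftrightarrow> \<lfloor>s * real (Suc n)\<rfloor> = int j"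
        by (simp add: floor_eq_iff del: of_nat_Suc)
      also have "\<dots> \<longleftrightarrow> j = k"
        using k0 by (metis of_int_eq_iff of_int_of_nat_eq of_nat_eq_iff)
      finally show ?thesis .
    qed
    have "(\<Sum>j\<le>?K. indicator (?I j) s * h (real j / real (Suc n))) = (\<Sum>j\<le>?K. if j = k then h (real j / real (Suc n)) else 0)"
      by (intro sum.cong refl) (simp only: indicator_def mem of_bool_def, simp)
    also have "\<dots> = h (real k / real (Suc n))" using kK by simp
    finally show ?thesis using True k0 by (simp add: grid_def)
  next
    case False
    then have "indicator (?I k) s = (0::real)" for k by (auto simp: indicator_def)
    with False show ?thesis by simp
  qed
  have fin: "emeasure lborel (?I k) < \<infinity>" for k
    by (rule le_less_trans[OF emeasure_mono[of _ "{real k / real (Suc n)..real (Suc k) / real (Suc n)}"]])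
       (auto simp del: of_nat_Suc simp: divide_right_mono)
  have i: "integrable lborel (\<lambda>s. indicator (?I k) s * h (real k / real (Suc n)))" for k
    using fin by (intro integrable_mult_left integrable_real_indicator) auto
  show "set_integrable lborel {0..t} (\<lambda>s. h (grid n s))"
    unfolding set_integrable_def eq by (intro Bochner_Integration.integrable_sum i)
  show "(LBINT s:{0..t}. h (grid n s)) = riemann_sum n t h"
    unfolding set_lebesgue_integral_def eq riemann_sum_def grid_weight_def
    by (subst Bochner_Integration.integral_sum[OF i]) simp
qed

lemma (in ou_measure) kernel_gap_mono:
  assumes "\<bar>d\<bar> \<le> \<bar>d'\<bar>" shows "kernel_gap d \<le> kernel_gap d'"
  unfolding kernel_gap_def
proof (rule integral_mono_AE)
  show "AE \<xi> in \<pi>. 1 - exp (- \<xi> * \<bar>d\<bar>) \<le> 1 - exp (- \<xi> * \<bar>d'\<bar>)"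
    using pi_pos assms by (auto elim!: eventually_mono intro: mult_left_mono)
qed (use pi_pos in \<open>auto intro!: integrable_const_bound[of _ 1] elim!: eventually_mono\<close>)

text \<open>The error is measured in mean square over \<open>x\<close>, not path by path. There it
  depends only on how far \<open>\<Phi> s\<close> is in mean square from its value at the grid
  point, so no continuity of paths enters.\<close>

lemma (in sigma_finite_measure) riemann_sum_error:
  fixes \<Phi> :: "real \<Rightarrow> 'a \<Rightarrow> real"
  assumes t: "t \<ge> 0" and m [measurable]: "(\<lambda>(s, x). \<Phi> s x) \<in> borel_measurable (borel \<Otimes>\<^sub>M M)"
    and int: "AE x in M. set_integrable lborel {0..t} (\<lambda>s. \<Phi> s x)"
    and gap: "\<And>s. (\<integral>\<^sup>+x. ennreal ((\<Phi> s x - \<Phi> (grid n s) x)\<^sup>2) \<partial>M) \<le> ennreal g"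
  shows "(\<integral>\<^sup>+x. ennreal ((riemann_sum n t (\<lambda>s. \<Phi> s x) - (LBINT s:{0..t}. \<Phi> s x))\<^sup>2) \<partial>M) \<le> ennreal (t\<^sup>2 * g)"
proof -
  have "(\<integral>\<^sup>+x. ennreal ((riemann_sum n t (\<lambda>s. \<Phi> s x) - (LBINT s:{0..t}. \<Phi> s x))\<^sup>2) \<partial>M) =
      (\<integral>\<^sup>+x. ennreal ((LBINT s:{0..t}. \<Phi> s x - \<Phi> (grid n s) x)\<^sup>2) \<partial>M)"
  proof (rule nn_integral_cong_AE, use int in eventually_elim)
    fix x assume i: "set_integrable lborel {0..t} (\<lambda>s. \<Phi> s x)"
    have "(LBINT s:{0..t}. \<Phi> s x - \<Phi> (grid n s) x) = (LBINT s:{0..t}. \<Phi> s x) - riemann_sum n t (\<lambda>s. \<Phi> s x)"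
      using set_integral_diff(2)[OF i riemann_sum_eq(1)[of t "\<lambda>s. \<Phi> s x" n]]
      unfolding riemann_sum_eq(2)[of t "\<lambda>s. \<Phi> s x" n] .
    then show "ennreal ((riemann_sum n t (\<lambda>s. \<Phi> s x) - (LBINT s:{0..t}. \<Phi> s x))\<^sup>2) = ennreal ((LBINT s:{0..t}. \<Phi> s x - \<Phi> (grid n s) x)\<^sup>2)"
      by (simp add: power2_commute)
  qed
  also have "\<dots> \<le> ennreal t * (\<integral>\<^sup>+s. indicator {0..t} s * (\<integral>\<^sup>+x. ennreal ((\<Phi> s x - \<Phi> (grid n s) x)\<^sup>2) \<partial>M) \<partial>lborel)"
  proof (rule nn_integral_square_time_integral_le[OF t])
    have "(\<lambda>z. (\<lambda>(s, x). \<Phi> s x) (grid n (fst z), snd z)) \<in> borel_measurable (borel \<Otimes>\<^sub>M M)"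
      by (rule measurable_compose[OF _ m]) measurable
    moreover have "(\<lambda>z. (\<lambda>(s, x). \<Phi> s x) z) \<in> borel_measurable (borel \<Otimes>\<^sub>M M)" by simp
    ultimately have "(\<lambda>z. (\<lambda>(s, x). \<Phi> s x) z - (\<lambda>(s, x). \<Phi> s x) (grid n (fst z), snd z)) \<in> borel_measurable (borel \<Otimes>\<^sub>M M)"
      by (rule borel_measurable_diff[rotated])
    then show "(\<lambda>(s, x). \<Phi> s x - \<Phi> (grid n s) x) \<in> borel_measurable (borel \<Otimes>\<^sub>M M)"
      by (simp add: case_prod_beta')
  qed
  also have "\<dots> \<le> ennreal t * (\<integral>\<^sup>+s. ennreal g * indicator {0..t} s \<partial>lborel)"
    using gap by (intro mult_left_mono nn_integral_mono) (auto simp: indicator_def)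
  also have "\<dots> = ennreal t * (ennreal g * ennreal t)"
    using t by (simp add: nn_integral_cmult_indicator)
  also have "\<dots> = ennreal (t\<^sup>2 * g)"
    using t by (simp add: ennreal_mult'[symmetric] ennreal_mult''[symmetric] power2_eq_square mult_ac)
  finally show ?thesis .
qed

section \<open>Moments of the Levy measure\<close>

locale supOU_setting = levy_basis_space M "\<pi> \<Otimes>\<^sub>M (lborel :: real measure)" "levy_khintchine a b \<mu>" \<Lambda> +
  lx: levy_exponent a b \<mu> + ou: ou_measure \<pi>
  for M :: "'w measure" and \<pi> :: "real measure" and a b :: real and \<mu> :: "real measure"
    and \<Lambda> :: "(real \<times> real) set \<Rightarrow> 'w \<Rightarrow> real" +
  fixes X :: "real \<Rightarrow> 'w \<Rightarrow> real"
  assumes integral: "\<And>t. has_stoch_integral M (\<pi> \<Otimes>\<^sub>M lborel) \<Lambda> (supOU_kernel t) (X t)"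
    and joint: "(\<lambda>(t, \<omega>). X t \<omega>) \<in> borel_measurable (borel \<Otimes>\<^sub>M M)"
    and square_int: "\<And>t. integrable M (\<lambda>\<omega>. (X t \<omega>)\<^sup>2)"
    and mean0: "\<And>t. expectation (X t) = 0"
begin

abbreviation "\<kappa> \<equiv> levy_khintchine a b \<mu>"

lemma power_measurable_mu [measurable]: "(\<lambda>x. x ^ n) \<in> borel_measurable \<mu>"
  by (subst measurable_cong_sets[OF lx.sets_mu refl]) measurable

lemma X_measurable [measurable]: "X t \<in> borel_measurable M"
  using has_stoch_integral_measurable(2)[OF integral] .

sublocale mu: sigma_finite_measure \<mu> by (rule lx.sigma_finite_mu)

text \<open>Kernel value times jump size, on the product of
  \<open>\<pi> \<Otimes>\<^sub>M lborel\<close> and \<open>\<mu>\<close>. It makes the jump part of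
  the real exponent of \<open>X 1\<close> a single cosine integral, fit for
  \<open>even_moment_bound\<close>, while its powers factor under Tonelli's theorem.\<close>

definition jump :: "(real \<times> real) \<times> real \<Rightarrow> real" where
  "jump z = supOU_kernel 1 (fst z) * snd z"

lemma jump_measurable [measurable]: "jump \<in> borel_measurable (ou.C \<Otimes>\<^sub>M \<mu>)"
proof -
  have "(\<lambda>z. supOU_kernel 1 (fst z)) \<in> borel_measurable (ou.C \<Otimes>\<^sub>M \<mu>)"
    by (rule measurable_compose[OF measurable_fst ou.kernel_measurable_1])
  then show ?thesis unfolding jump_def[abs_def] by measurable
qed

lemma nn_integral_jump_power:
  assumes "n > 0"
  shows "(\<integral>\<^sup>+z. ennreal (jump z ^ (2 * n)) \<partial>(ou.C \<Otimes>\<^sub>M \<mu>)) = ennreal (1 / real (2 * n)) * (\<integral>\<^sup>+x. ennreal (x ^ (2 * n)) \<partial>\<mu>)"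
proof -
  have "(\<integral>\<^sup>+z. ennreal (jump z ^ (2 * n)) \<partial>(ou.C \<Otimes>\<^sub>M \<mu>)) = (\<integral>\<^sup>+c. \<integral>\<^sup>+x. ennreal (jump (c, x) ^ (2 * n)) \<partial>\<mu> \<partial>ou.C)"
    by (rule mu.nn_integral_fst[symmetric]) measurable
  also have "\<dots> = (\<integral>\<^sup>+c. ennreal (supOU_kernel 1 c ^ (2 * n)) * (\<integral>\<^sup>+x. ennreal (x ^ (2 * n)) \<partial>\<mu>) \<partial>ou.C)"
  proof (rule nn_integral_cong)
    fix c
    show "(\<integral>\<^sup>+x. ennreal (jump (c, x) ^ (2 * n)) \<partial>\<mu>) = ennreal (supOU_kernel 1 c ^ (2 * n)) * (\<integral>\<^sup>+x. ennreal (x ^ (2 * n)) \<partial>\<mu>)"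
      by (subst nn_integral_cmult[symmetric]) (auto simp: jump_def power_mult_distrib ennreal_mult zero_le_even_power)
  qed
  also have "\<dots> = ennreal (1 / real (2 * n)) * (\<integral>\<^sup>+x. ennreal (x ^ (2 * n)) \<partial>\<mu>)"
    using assms by (subst nn_integral_multc) (auto simp: ou.nn_integral_kernel_power)
  finally show ?thesis .
qed

lemma nn_integral_one_minus_cos_jump:
  "(\<integral>\<^sup>+z. ennreal (1 - cos (\<zeta> * jump z)) \<partial>(ou.C \<Otimes>\<^sub>M \<mu>)) =
     (\<integral>\<^sup>+c. ennreal (- Re (\<kappa> (\<zeta> * supOU_kernel 1 c)) - b * (\<zeta> * supOU_kernel 1 c)\<^sup>2 / 2) \<partial>ou.C)"
proof -
  have "(\<integral>\<^sup>+z. ennreal (1 - cos (\<zeta> * jump z)) \<partial>(ou.C \<Otimes>\<^sub>M \<mu>)) = (\<integral>\<^sup>+c. \<integral>\<^sup>+x. ennreal (1 - cos (\<zeta> * jump (c, x))) \<partial>\<mu> \<partial>ou.C)"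
    by (rule mu.nn_integral_fst[symmetric]) measurable
  also have "\<dots> = (\<integral>\<^sup>+c. ennreal (- Re (\<kappa> (\<zeta> * supOU_kernel 1 c)) - b * (\<zeta> * supOU_kernel 1 c)\<^sup>2 / 2) \<partial>ou.C)"
  proof (rule nn_integral_cong)
    fix c
    let ?y = "\<zeta> * supOU_kernel 1 c"
    have "(\<integral>\<^sup>+x. ennreal (1 - cos (\<zeta> * jump (c, x))) \<partial>\<mu>) = (\<integral>\<^sup>+x. ennreal (1 - cos (?y * x)) \<partial>\<mu>)"
      by (simp add: jump_def mult.assoc)
    also have "\<dots> = ennreal (\<integral>x. 1 - cos (?y * x) \<partial>\<mu>)"
      by (intro nn_integral_eq_integral lx.integrable_cos) simp
    also have "(\<integral>x. 1 - cos (?y * x) \<partial>\<mu>) = - Re (\<kappa> ?y) - b * ?y\<^sup>2 / 2"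
      by (simp add: lx.Re_exponent)
    finally show "(\<integral>\<^sup>+x. ennreal (1 - cos (\<zeta> * jump (c, x))) \<partial>\<mu>) = ennreal (- Re (\<kappa> ?y) - b * ?y\<^sup>2 / 2)" .
  qed
  finally show ?thesis .
qed

text \<open>The second moment v of \<open>X 1\<close> gives - ln \<bar>\<phi>(\<zeta>)\<bar> \<le> v
  \<zeta>^2 near zero for its characteristic function \<phi>. By
  \<open>nn_integral_Re_exponent_le\<close> the cosine integral of \<open>jump\<close> obeys the
  same bound, so \<open>jump\<close>, and with it \<open>\<mu>\<close>, has a finite second
  moment.\<close>

lemma square_integrable_mu: "integrable \<mu> (\<lambda>x. x\<^sup>2)"
proof -
  define v where "v = expectation (\<lambda>\<omega>. (X 1 \<omega>)\<^sup>2)"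
  have v: "v \<ge> 0" unfolding v_def by (intro integral_nonneg_AE) auto
  let ?\<phi> = "char (distr M borel (X 1))"
  have ev: "\<forall>\<^sub>F z in nhds 0. z\<^sup>2 / 2 * v < 1 / 2"
  proof -
    have "((\<lambda>z. z\<^sup>2 / 2 * v) \<longlongrightarrow> 0\<^sup>2 / 2 * v) (nhds (0::real))"
      by (intro isCont_tendsto_nhds continuous_intros) auto
    then show ?thesis by (rule order_tendstoD(2)) simp
  qed
  have key: "integrable (ou.C \<Otimes>\<^sub>M \<mu>) (\<lambda>z. 1 - cos (\<zeta> * jump z)) \<and> (\<integral>z. 1 - cos (\<zeta> * jump z) \<partial>(ou.C \<Otimes>\<^sub>M \<mu>)) \<le> v * \<zeta>\<^sup>2"
    if z: "\<zeta>\<^sup>2 / 2 * v < 1 / 2" for \<zeta>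
  proof -
    have n1: "norm (?\<phi> \<zeta> - 1) \<le> \<zeta>\<^sup>2 / 2 * v"
      unfolding v_def by (rule norm_char_minus_1_le[OF X_measurable square_int mean0])
    have "norm (1::complex) - norm (?\<phi> \<zeta>) \<le> norm (1 - ?\<phi> \<zeta>)" by (rule norm_triangle_ineq2)
    then have n2: "1 - norm (?\<phi> \<zeta>) \<le> \<zeta>\<^sup>2 / 2 * v"
      using n1 by (simp add: norm_minus_commute)
    then have n3: "norm (?\<phi> \<zeta>) > 1 / 2" using z by linarith
    then have nz: "?\<phi> \<zeta> \<noteq> 0" by auto
    interpret D: real_distribution "distr M borel (X 1)"
      by (rule real_distribution_distr) simp
    \<comment> \<open>For x at most 1 / 2, - ln (1 - x) is at most x + 2 x^2 and hence at most 2
      x.\<close>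
    define x where "x = 1 - norm (?\<phi> \<zeta>)"
    have x: "0 \<le> x" "x \<le> 1 / 2" using D.cmod_char_le_1[of \<zeta>] n3 by (auto simp: x_def)
    have "- x - 2 * x\<^sup>2 \<le> ln (1 - x)" by (rule ln_one_minus_pos_lower_bound[OF x])
    moreover have "x\<^sup>2 \<le> x / 2" using mult_left_mono[OF x(2,1)] by (simp add: power2_eq_square)
    ultimately have "- ln (norm (?\<phi> \<zeta>)) \<le> 2 * x" by (simp add: x_def)
    also have "\<dots> \<le> v * \<zeta>\<^sup>2" using n2 by (simp add: x_def mult.commute)
    finally have ln_le: "- ln (norm (?\<phi> \<zeta>)) \<le> v * \<zeta>\<^sup>2" .
    have "(\<integral>\<^sup>+z. ennreal (1 - cos (\<zeta> * jump z)) \<partial>(ou.C \<Otimes>\<^sub>M \<mu>)) \<le> (\<integral>\<^sup>+c. ennreal (- Re (\<kappa> (\<zeta> * supOU_kernel 1 c))) \<partial>ou.C)"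
      unfolding nn_integral_one_minus_cos_jump using lx.gauss_nonneg by (intro nn_integral_mono ennreal_leI) auto
    also have "\<dots> \<le> ennreal (- ln (norm (?\<phi> \<zeta>)))"
      by (rule nn_integral_Re_exponent_le[OF integral lx.Re_exponent_nonpos nz])
    also have "\<dots> \<le> ennreal (v * \<zeta>\<^sup>2)" by (intro ennreal_leI ln_le)
    finally have nn: "(\<integral>\<^sup>+z. ennreal (1 - cos (\<zeta> * jump z)) \<partial>(ou.C \<Otimes>\<^sub>M \<mu>)) \<le> ennreal (v * \<zeta>\<^sup>2)" .
    have i: "integrable (ou.C \<Otimes>\<^sub>M \<mu>) (\<lambda>z. 1 - cos (\<zeta> * jump z))"
      by (rule integrableI_nonneg) (use le_less_trans[OF nn] in auto)
    have "ennreal (\<integral>z. 1 - cos (\<zeta> * jump z) \<partial>(ou.C \<Otimes>\<^sub>M \<mu>)) \<le> ennreal (v * \<zeta>\<^sup>2)"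
      using nn by (subst nn_integral_eq_integral[symmetric, OF i]) auto
    with i v show ?thesis by (simp add: ennreal_le_iff)
  qed
  have "(\<integral>\<^sup>+z. ennreal (jump z ^ (2 * 1)) \<partial>(ou.C \<Otimes>\<^sub>M \<mu>)) \<le> ennreal (v * cdiff_norm 1)"
  proof (rule even_moment_bound[where p = 0])
    show "\<forall>\<^sub>F z in nhds 0. integrable (ou.C \<Otimes>\<^sub>M \<mu>) (\<lambda>x. 1 - cos (z * jump x)) \<and>
       \<bar>(\<integral>x. 1 - cos (z * jump x) \<partial>(ou.C \<Otimes>\<^sub>M \<mu>)) - poly 0 z\<bar> \<le> v * \<bar>z\<bar> ^ (2 * 1)"
      using ev
    proof eventually_elim
      case (elim z)
      have "0 \<le> (\<integral>x. 1 - cos (z * jump x) \<partial>(ou.C \<Otimes>\<^sub>M \<mu>))" by (intro integral_nonneg_AE) auto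
      then show ?case using key[OF elim] by simp
    qed
  qed auto
  then have "ennreal (1 / 2) * (\<integral>\<^sup>+x. ennreal (x\<^sup>2) \<partial>\<mu>) < \<infinity>"
    using nn_integral_jump_power[of 1] by (simp add: le_less_trans)
  then have "(\<integral>\<^sup>+x. ennreal (x\<^sup>2) \<partial>\<mu>) < \<infinity>"
    by (auto simp: ennreal_mult_less_top ennreal_mult_eq_top_iff less_top)
  then show ?thesis by (intro integrableI_nonneg) auto
qed

sublocale sq: square_integrable_levy_exponent a b \<mu>
  by unfold_locales (rule square_integrable_mu)

text \<open>The kernel has integral one, so the exponent of \<open>X 1\<close> is i \<zeta> m +
  O(\<zeta>^2), where m is the mean of L(1). As \<open>X 1\<close> is centred, its characteristic
  function is 1 + O(\<zeta>^2). Dividing by \<zeta> and letting it tend to zero leaves m =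
  0.\<close>

lemma levy_mean_0: "sq.levy_mean = 0"
proof -
  let ?m = "sq.levy_mean" and ?k = "supOU_kernel 1" and ?\<phi> = "char (distr M borel (X 1))"
  have k1: "integrable ou.C ?k" "integral\<^sup>L ou.C ?k = 1" and k2: "integrable ou.C (\<lambda>c. (?k c)\<^sup>2)" "(\<integral>c. (?k c)\<^sup>2 \<partial>ou.C) = 1 / 2"
    using ou.integrable_kernel_power[of 1 1] ou.integrable_kernel_power[of 2 1] by simp_all
  define s where "s = sq.levy_var / 2"
  have s: "s \<ge> 0" using sq.levy_var_nonneg by (simp add: s_def)
  define v where "v = expectation (\<lambda>\<omega>. (X 1 \<omega>)\<^sup>2)"
  have v: "v \<ge> 0" unfolding v_def by (intro integral_nonneg_AE) auto
  have R: "integrable ou.C (\<lambda>c. \<kappa> (\<zeta> * ?k c)) \<and> norm ((CLINT c|ou.C. \<kappa> (\<zeta> * ?k c)) - \<i> * of_real (\<zeta> * ?m)) \<le> s * \<zeta>\<^sup>2" for \<zeta>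
  proof -
    let ?r = "\<lambda>c. \<kappa> (\<zeta> * ?k c) - \<i> * of_real (\<zeta> * ?k c * ?m)"
    have ib: "integrable ou.C (\<lambda>c. s * \<zeta>\<^sup>2 * (?k c)\<^sup>2)" by (intro integrable_mult_right k2)
    have b: "norm (?r c) \<le> s * \<zeta>\<^sup>2 * (?k c)\<^sup>2" for c
      using sq.exponent_mean_bound[of "\<zeta> * ?k c"] by (simp add: s_def power_mult_distrib mult.assoc)
    have [measurable]: "(\<lambda>c. \<kappa> (\<zeta> * ?k c)) \<in> borel_measurable ou.C"
      by (rule measurable_compose[OF _ exponent_measurable]) measurable
    have ir: "integrable ou.C ?r"
      by (rule Bochner_Integration.integrable_bound[OF ib], measurable, rule AE_I2, subst real_norm_def, rule order_trans[OF b abs_ge_self])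
    have il: "integrable ou.C (\<lambda>c. \<i> * of_real (\<zeta> * ?k c * ?m))"
      by (intro integrable_mult_right integrable_of_real integrable_mult_left k1)
    have "integrable ou.C (\<lambda>c. ?r c + \<i> * of_real (\<zeta> * ?k c * ?m))"
      by (rule Bochner_Integration.integrable_add[OF ir il])
    then have i: "integrable ou.C (\<lambda>c. \<kappa> (\<zeta> * ?k c))" by simp
    have "(CLINT c|ou.C. \<i> * of_real (\<zeta> * ?k c * ?m)) = \<i> * of_real (\<zeta> * ?m)"
      unfolding integral_mult_right_zero integral_complex_of_real by (simp add: k1)
    then have "(CLINT c|ou.C. \<kappa> (\<zeta> * ?k c)) - \<i> * of_real (\<zeta> * ?m) = (CLINT c|ou.C. ?r c)"
      using Bochner_Integration.integral_diff[OF i il] by simp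
    also have "norm \<dots> \<le> (\<integral>c. norm (?r c) \<partial>ou.C)" by (rule integral_norm_bound)
    also have "\<dots> \<le> (\<integral>c. s * \<zeta>\<^sup>2 * (?k c)\<^sup>2 \<partial>ou.C)"
      by (rule integral_mono[OF integrable_norm[OF ir] ib b])
    also have "\<dots> \<le> s * \<zeta>\<^sup>2" using s by (simp add: k2)
    finally show ?thesis using i by simp
  qed
  \<comment> \<open>For \<zeta> in (0, 1] the exponent has norm at most \<open>A * \<zeta>\<close>;
    the condition \<open>A * \<zeta> \<le> 1\<close> keeps it in the unit disc, where exp is at most
    3 in modulus.\<close>
  define A where "A = \<bar>?m\<bar> + s"
  have A: "A \<ge> 0" using s by (simp add: A_def)
  have main: "\<bar>?m\<bar> \<le> (s + v / 2 + 3 * A\<^sup>2) * \<zeta>" if z: "0 < \<zeta>" "\<zeta> \<le> 1" "A * \<zeta> \<le> 1" for \<zeta> :: real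
  proof -
    define w where "w = (CLINT c|ou.C. \<kappa> (\<zeta> * ?k c))"
    have w1: "norm (w - \<i> * of_real (\<zeta> * ?m)) \<le> s * \<zeta>\<^sup>2" using R[of \<zeta>] by (simp add: w_def)
    have m1: "norm (\<i> * complex_of_real (\<zeta> * ?m)) = \<zeta> * \<bar>?m\<bar>"
      unfolding norm_mult norm_of_real using z by (simp add: abs_mult)
    have "norm w \<le> norm (w - \<i> * of_real (\<zeta> * ?m)) + norm (\<i> * complex_of_real (\<zeta> * ?m))"
      using norm_triangle_ineq[of "w - \<i> * of_real (\<zeta> * ?m)" "\<i> * of_real (\<zeta> * ?m)"] by simp
    also have "\<dots> \<le> s * \<zeta>\<^sup>2 + \<zeta> * \<bar>?m\<bar>" using w1 m1 by simp
    also have "\<dots> \<le> A * \<zeta>"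
    proof -
      have "s * \<zeta>\<^sup>2 \<le> s * \<zeta>" using z s by (intro mult_left_mono) (auto simp: power2_eq_square mult_left_le)
      then show ?thesis by (simp add: A_def algebra_simps)
    qed
    finally have wA: "norm w \<le> A * \<zeta>" .
    have "norm (exp w - 1 - w) \<le> exp \<bar>Re w\<bar> * (norm w)\<^sup>2"
      using Taylor_exp[of w 1] by (simp add: diff_diff_eq numeral_2_eq_2)
    also have "\<dots> \<le> 3 * (A * \<zeta>)\<^sup>2"
    proof (intro mult_mono power_mono wA)
      have "\<bar>Re w\<bar> \<le> 1" using abs_Re_le_cmod[of w] wA z by linarith
      then have "exp \<bar>Re w\<bar> \<le> exp 1" by simp
      also have "exp (1::real) \<le> 3" by (rule exp_le)
      finally show "exp \<bar>Re w\<bar> \<le> 3" .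
    qed auto
    finally have e1: "norm (exp w - 1 - w) \<le> 3 * (A * \<zeta>)\<^sup>2" .
    have "exp w = ?\<phi> \<zeta>"
      unfolding w_def using char_stoch_integral[OF integral] R[of \<zeta>] by simp
    then have e2: "norm (exp w - 1) \<le> \<zeta>\<^sup>2 / 2 * v"
      unfolding v_def by (simp only: norm_char_minus_1_le[OF X_measurable square_int mean0])
    have tri: "norm (p - q - r) \<le> norm p + norm q + norm r" for p q r :: complex
      using norm_triangle_ineq4[of "p - q" r] norm_triangle_ineq4[of p q] by linarith
    have "\<i> * complex_of_real (\<zeta> * ?m) = (exp w - 1) - (exp w - 1 - w) - (w - \<i> * of_real (\<zeta> * ?m))" by simp
    then have "norm (\<i> * complex_of_real (\<zeta> * ?m)) \<le> norm (exp w - 1) + norm (exp w - 1 - w) + norm (w - \<i> * of_real (\<zeta> * ?m))"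
      using tri[of "exp w - 1" "exp w - 1 - w" "w - \<i> * of_real (\<zeta> * ?m)"] by (simp only:)
    then have "\<zeta> * \<bar>?m\<bar> \<le> \<zeta>\<^sup>2 / 2 * v + 3 * (A * \<zeta>)\<^sup>2 + s * \<zeta>\<^sup>2"
      using e1 e2 w1 m1 by linarith
    also have "\<dots> = \<zeta> * ((s + v / 2 + 3 * A\<^sup>2) * \<zeta>)"
      by (simp add: power_mult_distrib algebra_simps power2_eq_square)
    finally show ?thesis using z by simp
  qed
  define B where "B = s + v / 2 + 3 * A\<^sup>2"
  \<comment> \<open>The argument 1 / (n + 1 + A) meets all conditions of \<open>main\<close> and
    tends to zero.\<close>
  have "\<bar>?m\<bar> \<le> B * (1 / (real n + 1 + A))" for n
  proof -
    have p: "real n + 1 + A > 0" using A by simp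
    show ?thesis unfolding B_def
      by (rule main) (use p A in \<open>auto simp: divide_simps\<close>)
  qed
  moreover have "(\<lambda>n. B * (1 / (real n + 1 + A))) \<longlonglongrightarrow> 0"
    by real_asymp
  ultimately have "\<bar>?m\<bar> \<le> 0"
    by (intro tendsto_lowerbound[of _ 0 sequentially]) (auto intro!: always_eventually)
  then show ?thesis by simp
qed

sublocale cx: centered_levy_exponent a b \<mu>
  by unfold_locales (rule levy_mean_0)

text \<open>The real part of \<open>K\<close> is the integral of Re \<kappa> over the kernel at time
  1, and without the Gaussian part it is minus the cosine integral of \<open>jump\<close>.
  Analyticity supplies the polynomial that \<open>even_moment_bound\<close> asks for. Imaginary
  parts are avoided, as the two exponents are only known to agree after exponentiation.\<close>

lemma moments_mu:
  assumes K: "is_cumulant_function M (X 1) K" "analytic_near_zero K" and k: "k \<ge> 2"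
  shows "integrable \<mu> (\<lambda>x. x ^ k)"
proof -
  have even: "integrable \<mu> (\<lambda>x. x ^ (2 * n))" if n: "n \<ge> 2" for n
  proof -
    obtain p B where p: "degree p < 2 * n" and B: "\<forall>\<^sub>F \<zeta> in nhds 0. \<bar>Re (K \<zeta>) - poly p \<zeta>\<bar> \<le> B * \<bar>\<zeta>\<bar> ^ (2 * n)"
      using analytic_near_zero_Re_expansion[OF K(2), of "2 * n"] n by auto
    \<comment> \<open>The Gaussian part is b \<zeta>^2 / 2 times the squared norm 1 / 2 of the
      kernel, hence \<open>b / 4\<close>. Its degree 2 is below \<open>2 * n\<close> because
      \<open>n \<ge> 2\<close>.\<close>
    define q where "q = - p - monom (b / 4) 2"
    have q: "degree q < 2 * n"
      unfolding q_def using p n by (intro degree_diff_less) (auto intro: le_less_trans[OF degree_monom_le])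
    have k2: "integrable ou.C (\<lambda>c. (supOU_kernel 1 c)\<^sup>2)" "(\<integral>c. (supOU_kernel 1 c)\<^sup>2 \<partial>ou.C) = 1 / 2"
      using ou.integrable_kernel_power[of 2 1] by simp_all
    have val: "integrable (ou.C \<Otimes>\<^sub>M \<mu>) (\<lambda>z. 1 - cos (\<zeta> * jump z)) \<and> (\<integral>z. 1 - cos (\<zeta> * jump z) \<partial>(ou.C \<Otimes>\<^sub>M \<mu>)) = - Re (K \<zeta>) - b / 4 * \<zeta>\<^sup>2" for \<zeta>
    proof -
      let ?h = "\<lambda>c. - Re (\<kappa> (\<zeta> * supOU_kernel 1 c)) - b * (\<zeta> * supOU_kernel 1 c)\<^sup>2 / 2"
      have i\<kappa>: "integrable ou.C (\<lambda>c. \<kappa> (\<zeta> * supOU_kernel 1 c))"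
        by (rule cx.exponent_integrable(1)[OF continuous_exponent _ k2(1)]) measurable
      have ib: "integrable ou.C (\<lambda>c. b * (\<zeta> * supOU_kernel 1 c)\<^sup>2 / 2)"
        unfolding power_mult_distrib by (intro integrable_divide integrable_mult_right k2)
      have ih: "integrable ou.C ?h"
        by (intro Bochner_Integration.integrable_diff Bochner_Integration.integrable_minus integrable_Re i\<kappa> ib)
      have hpos: "0 \<le> ?h c" for c
      proof -
        have "0 \<le> (\<integral>x. 1 - cos (\<zeta> * supOU_kernel 1 c * x) \<partial>\<mu>)" by (intro integral_nonneg_AE) auto
        then show ?thesis by (simp add: lx.Re_exponent)
      qed
      have nn: "(\<integral>\<^sup>+z. ennreal (1 - cos (\<zeta> * jump z)) \<partial>(ou.C \<Otimes>\<^sub>M \<mu>)) = ennreal (integral\<^sup>L ou.C ?h)"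
        unfolding nn_integral_one_minus_cos_jump by (intro nn_integral_eq_integral ih AE_I2 hpos)
      have i: "integrable (ou.C \<Otimes>\<^sub>M \<mu>) (\<lambda>z. 1 - cos (\<zeta> * jump z))"
        by (rule integrableI_nonneg) (auto simp: nn)
      have "ennreal (\<integral>z. 1 - cos (\<zeta> * jump z) \<partial>(ou.C \<Otimes>\<^sub>M \<mu>)) = ennreal (integral\<^sup>L ou.C ?h)"
        unfolding nn[symmetric] by (rule nn_integral_eq_integral[symmetric, OF i]) simp
      then have eq: "(\<integral>z. 1 - cos (\<zeta> * jump z) \<partial>(ou.C \<Otimes>\<^sub>M \<mu>)) = integral\<^sup>L ou.C ?h"
        by (subst (asm) ennreal_inj) (auto intro!: integral_nonneg_AE AE_I2 hpos)
      have "exp (K \<zeta>) = exp (CLINT c|ou.C. \<kappa> (\<zeta> * supOU_kernel 1 c))"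
        using char_stoch_integral[OF integral i\<kappa>] K(1) unfolding is_cumulant_function_def by simp
      then have "norm (exp (K \<zeta>)) = norm (exp (CLINT c|ou.C. \<kappa> (\<zeta> * supOU_kernel 1 c)))" by simp
      then have "Re (K \<zeta>) = Re (CLINT c|ou.C. \<kappa> (\<zeta> * supOU_kernel 1 c))" by simp
      also have "\<dots> = (\<integral>c. Re (\<kappa> (\<zeta> * supOU_kernel 1 c)) \<partial>ou.C)" by (rule integral_Re[OF i\<kappa>, symmetric])
      finally have ReK: "(\<integral>c. Re (\<kappa> (\<zeta> * supOU_kernel 1 c)) \<partial>ou.C) = Re (K \<zeta>)" ..
      have "integral\<^sup>L ou.C ?h = - (\<integral>c. Re (\<kappa> (\<zeta> * supOU_kernel 1 c)) \<partial>ou.C) - (\<integral>c. b * (\<zeta> * supOU_kernel 1 c)\<^sup>2 / 2 \<partial>ou.C)"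
        using integrable_Re[OF i\<kappa>] ib by simp
      also have "(\<integral>c. b * (\<zeta> * supOU_kernel 1 c)\<^sup>2 / 2 \<partial>ou.C) = b / 4 * \<zeta>\<^sup>2"
        by (simp add: power_mult_distrib k2)
      finally show ?thesis using i eq ReK by simp
    qed
    have "(\<integral>\<^sup>+z. ennreal (jump z ^ (2 * n)) \<partial>(ou.C \<Otimes>\<^sub>M \<mu>)) \<le> ennreal (B * cdiff_norm n)"
    proof (rule even_moment_bound[OF jump_measurable _ q])
      show "\<forall>\<^sub>F z in nhds 0. integrable (ou.C \<Otimes>\<^sub>M \<mu>) (\<lambda>x. 1 - cos (z * jump x)) \<and>
       \<bar>(\<integral>x. 1 - cos (z * jump x) \<partial>(ou.C \<Otimes>\<^sub>M \<mu>)) - poly q z\<bar> \<le> B * \<bar>z\<bar> ^ (2 * n)"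
        using B
      proof eventually_elim
        case (elim z)
        have "(\<integral>x. 1 - cos (z * jump x) \<partial>(ou.C \<Otimes>\<^sub>M \<mu>)) - poly q z = - (Re (K z) - poly p z)"
          using val[of z] by (simp add: q_def poly_monom)
        with elim val[of z] show ?case by simp
      qed
    qed (use n in auto)
    then have fin: "ennreal (1 / real (2 * n)) * (\<integral>\<^sup>+x. ennreal (x ^ (2 * n)) \<partial>\<mu>) < \<infinity>"
      using nn_integral_jump_power[of n] n by (simp add: le_less_trans)
    have "(\<integral>\<^sup>+x. ennreal (x ^ (2 * n)) \<partial>\<mu>) < \<infinity>"
    proof (rule ccontr)
      assume "\<not> (\<integral>\<^sup>+x. ennreal (x ^ (2 * n)) \<partial>\<mu>) < \<infinity>"
      then have "(\<integral>\<^sup>+x. ennreal (x ^ (2 * n)) \<partial>\<mu>) = \<top>" by (simp add: less_top[symmetric])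
      with fin n show False by (simp add: ennreal_mult_top)
    qed
    then show ?thesis by (intro integrableI_nonneg) (auto simp: zero_le_even_power)
  qed
  show ?thesis
  proof (rule Bochner_Integration.integrable_bound[OF Bochner_Integration.integrable_add[OF square_integrable_mu even[OF k]]])
    \<comment> \<open>The square, not a constant, dominates near zero: \<open>\<mu>\<close> may be
      infinite there.\<close>
    have "\<bar>x\<bar> ^ k \<le> x\<^sup>2 + x ^ (2 * k)" for x :: real
    proof (cases "\<bar>x\<bar> \<le> 1")
      case True
      have "\<bar>x\<bar> ^ k \<le> \<bar>x\<bar>\<^sup>2" using True k by (intro power_decreasing) auto
      moreover have "0 \<le> x ^ (2 * k)" by (rule zero_le_even_power) simp
      ultimately show ?thesis unfolding power2_abs by linarith
    next
      case False
      then have "\<bar>x\<bar> ^ k \<le> \<bar>x\<bar> ^ (2 * k)" by (intro power_increasing) auto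
      also have "\<dots> = x ^ (2 * k)" by (rule power_even_abs) simp
      finally show ?thesis using zero_le_power2[of x] by linarith
    qed
    moreover have "0 \<le> x\<^sup>2 + x ^ (2 * k)" for x :: real by (simp add: zero_le_even_power)
    ultimately show "AE x in \<mu>. norm (x ^ k) \<le> norm (x\<^sup>2 + x ^ (2 * k))"
      by (auto simp: power_abs)
  qed measurable
qed

end

section \<open>The characteristic function of the integrated process\<close>

lemma power2_sum_le:
  fixes f :: "'i \<Rightarrow> real"
  assumes "finite J"
  shows "(\<Sum>i\<in>J. f i)\<^sup>2 \<le> real (card J) * (\<Sum>i\<in>J. (f i)\<^sup>2)"
  using Cauchy_Schwarz_ineq_sum[of "\<lambda>_. 1" f J] by simp

lemma nn_integral_square_sum_le:
  fixes f :: "'i \<Rightarrow> 'a \<Rightarrow> real"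
  assumes J: "finite J" and [measurable]: "\<And>i. i \<in> J \<Longrightarrow> f i \<in> borel_measurable N"
    and bd: "\<And>i. i \<in> J \<Longrightarrow> (\<integral>\<^sup>+x. ennreal ((f i x)\<^sup>2) \<partial>N) \<le> ennreal (e i)" and e: "\<And>i. i \<in> J \<Longrightarrow> e i \<ge> 0"
  shows "(\<integral>\<^sup>+x. ennreal ((\<Sum>i\<in>J. f i x)\<^sup>2) \<partial>N) \<le> ennreal (real (card J) * (\<Sum>i\<in>J. e i))"
proof -
  have "(\<integral>\<^sup>+x. ennreal ((\<Sum>i\<in>J. f i x)\<^sup>2) \<partial>N) \<le> (\<integral>\<^sup>+x. ennreal (real (card J)) * (\<Sum>i\<in>J. ennreal ((f i x)\<^sup>2)) \<partial>N)"
    using power2_sum_le[OF J] by (intro nn_integral_mono) (simp add: sum_ennreal ennreal_mult[symmetric] sum_nonneg ennreal_leI)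
  also have "\<dots> = ennreal (real (card J)) * (\<Sum>i\<in>J. \<integral>\<^sup>+x. ennreal ((f i x)\<^sup>2) \<partial>N)"
    by (subst nn_integral_cmult, measurable) (subst nn_integral_sum, auto)
  also have "\<dots> \<le> ennreal (real (card J)) * (\<Sum>i\<in>J. ennreal (e i))"
    by (intro mult_left_mono sum_mono bd) auto
  also have "\<dots> = ennreal (real (card J) * (\<Sum>i\<in>J. e i))"
    using e by (simp add: sum_ennreal ennreal_mult sum_nonneg)
  finally show ?thesis .
qed

text \<open>Several times are treated at once because Gaussianity of the integrated process concerns
  its finite linear combinations; the moments only use a single time.\<close>

lemma (in sigma_finite_measure) riemann_combination_error:
  fixes \<Phi> :: "real \<Rightarrow> 'a \<Rightarrow> real"
  assumes J: "finite J" "J \<subseteq> {0..}" and joint: "(\<lambda>(s, x). \<Phi> s x) \<in> borel_measurable (borel \<Otimes>\<^sub>M M)"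
    and m [measurable]: "\<And>s. \<Phi> s \<in> borel_measurable M" "\<And>t. (\<lambda>x. LBINT s:{0..t}. \<Phi> s x) \<in> borel_measurable M"
    and int: "\<And>t. AE x in M. set_integrable lborel {0..t} (\<lambda>s. \<Phi> s x)"
    and gap: "\<And>s. (\<integral>\<^sup>+x. ennreal ((\<Phi> s x - \<Phi> (grid n s) x)\<^sup>2) \<partial>M) \<le> ennreal g" and g: "g \<ge> 0"
  shows "(\<integral>\<^sup>+x. ennreal (((\<Sum>t\<in>J. c t * riemann_sum n t (\<lambda>s. \<Phi> s x)) - (\<Sum>t\<in>J. c t * (LBINT s:{0..t}. \<Phi> s x)))\<^sup>2) \<partial>M)
    \<le> ennreal (real (card J) * (\<Sum>t\<in>J. (c t)\<^sup>2 * t\<^sup>2) * g)"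
proof -
  let ?D = "\<lambda>t x. riemann_sum n t (\<lambda>s. \<Phi> s x) - (LBINT s:{0..t}. \<Phi> s x)"
  have [measurable]: "(\<lambda>x. riemann_sum n t (\<lambda>s. \<Phi> s x)) \<in> borel_measurable M" for t
    unfolding riemann_sum_def by measurable
  have "(\<integral>\<^sup>+x. ennreal (((\<Sum>t\<in>J. c t * riemann_sum n t (\<lambda>s. \<Phi> s x)) - (\<Sum>t\<in>J. c t * (LBINT s:{0..t}. \<Phi> s x)))\<^sup>2) \<partial>M) =
      (\<integral>\<^sup>+x. ennreal ((\<Sum>t\<in>J. c t * ?D t x)\<^sup>2) \<partial>M)"
    by (simp add: sum_subtractf right_diff_distrib)
  also have "\<dots> \<le> ennreal (real (card J) * (\<Sum>t\<in>J. (c t)\<^sup>2 * (t\<^sup>2 * g)))"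
  proof (rule nn_integral_square_sum_le[OF J(1)])
    fix t assume "t \<in> J"
    then have "t \<ge> 0" using J by auto
    then have "ennreal ((c t)\<^sup>2) * (\<integral>\<^sup>+x. ennreal ((?D t x)\<^sup>2) \<partial>M) \<le> ennreal ((c t)\<^sup>2) * ennreal (t\<^sup>2 * g)"
      by (intro mult_left_mono riemann_sum_error joint int gap) auto
    also have "\<dots> = ennreal ((c t)\<^sup>2 * (t\<^sup>2 * g))"
      using g by (simp add: ennreal_mult)
    finally show "(\<integral>\<^sup>+x. ennreal ((c t * ?D t x)\<^sup>2) \<partial>M) \<le> ennreal ((c t)\<^sup>2 * (t\<^sup>2 * g))"
      by (subst (asm) nn_integral_cmult[symmetric]) (auto simp: power_mult_distrib ennreal_mult)
  qed (use g in auto)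
  also have "real (card J) * (\<Sum>t\<in>J. (c t)\<^sup>2 * (t\<^sup>2 * g)) = real (card J) * (\<Sum>t\<in>J. (c t)\<^sup>2 * t\<^sup>2) * g"
    by (simp add: sum_distrib_right sum_distrib_left mult_ac)
  finally show ?thesis .
qed

lemma integrable_square_of_nn:
  fixes f :: "'a \<Rightarrow> real"
  assumes [measurable]: "f \<in> borel_measurable N" and "(\<integral>\<^sup>+x. ennreal ((f x)\<^sup>2) \<partial>N) \<le> ennreal e" "e \<ge> 0"
  shows "integrable N (\<lambda>x. (f x)\<^sup>2)" "(\<integral>x. (f x)\<^sup>2 \<partial>N) \<le> e"
proof -
  show i: "integrable N (\<lambda>x. (f x)\<^sup>2)"
    by (rule integrableI_nonneg) (use assms(2) in \<open>auto intro: le_less_trans\<close>)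
  have "ennreal (\<integral>x. (f x)\<^sup>2 \<partial>N) \<le> ennreal e"
    using assms(2) by (subst nn_integral_eq_integral[symmetric, OF i]) auto
  then show "(\<integral>x. (f x)\<^sup>2 \<partial>N) \<le> e" using assms(3) by (simp add: ennreal_le_iff)
qed

lemma integrable_square_diff:
  fixes f g :: "'a \<Rightarrow> real"
  assumes [measurable]: "f \<in> borel_measurable N" "g \<in> borel_measurable N"
    and "integrable N (\<lambda>x. (f x)\<^sup>2)" "integrable N (\<lambda>x. (g x)\<^sup>2)"
  shows "integrable N (\<lambda>x. (f x - g x)\<^sup>2)" "integrable N (\<lambda>x. (f x + g x)\<^sup>2)"
proof -
  have i: "integrable N (\<lambda>x. 2 * (f x)\<^sup>2 + 2 * (g x)\<^sup>2)"
    by (intro Bochner_Integration.integrable_add integrable_mult_right assms)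
  have b: "(u - v)\<^sup>2 \<le> 2 * u\<^sup>2 + 2 * v\<^sup>2" "(u + v)\<^sup>2 \<le> 2 * u\<^sup>2 + 2 * v\<^sup>2" for u v :: real
    using zero_le_power2[of "u + v"] zero_le_power2[of "u - v"] by (auto simp: power2_sum power2_diff)
  show "integrable N (\<lambda>x. (f x - g x)\<^sup>2)" "integrable N (\<lambda>x. (f x + g x)\<^sup>2)"
    by (rule Bochner_Integration.integrable_bound[OF i]; use b in \<open>auto intro!: AE_I2\<close>)+
qed

context supOU_setting
begin

text \<open>The factors are 3 from \<open>norm_exp_minus_one_le\<close>, half the variance from the
  quadratic bound on \<kappa>, and \<open>cdiff_norm 1\<close> from \<open>even_moment_bound\<close>
  with \<open>n = 1\<close>.\<close>

definition "moment_const = 3 * (sq.levy_var / 2) * cdiff_norm 1"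

lemma cdiff_norm_nonneg: "cdiff_norm n \<ge> 0"
  unfolding cdiff_norm_def by (intro sum_nonneg) simp

lemma moment_const_nonneg: "moment_const \<ge> 0"
  using sq.levy_var_nonneg cdiff_norm_nonneg by (simp add: moment_const_def)

lemma char_integral_L2:
  assumes "has_stoch_integral M ou.C \<Lambda> g Y" "integrable ou.C (\<lambda>x. (g x)\<^sup>2)"
  shows "char (distr M borel Y) \<zeta> = exp (CLINT x|ou.C. \<kappa> (\<zeta> * g x))"
  using assms has_stoch_integral_measurable[OF assms(1)]
  by (intro char_stoch_integral cx.exponent_integrable continuous_exponent) auto

text \<open>A bound up to a constant stands in for the isometry of the integral. It suffices for
  mean-square approximation and for recognising variables that vanish almost surely, and it depends
  only on the characteristic function.\<close>

lemma second_moment_of_char: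
  assumes [measurable]: "Y \<in> borel_measurable M" "g \<in> borel_measurable ou.C" and g: "integrable ou.C (\<lambda>x. (g x)\<^sup>2)"
    and ch: "\<And>\<zeta>. char (distr M borel Y) \<zeta> = exp (CLINT x|ou.C. \<kappa> (\<zeta> * g x))"
  shows "(\<integral>\<^sup>+\<omega>. ennreal ((Y \<omega>)\<^sup>2) \<partial>M) \<le> ennreal (moment_const * (\<integral>x. (g x)\<^sup>2 \<partial>ou.C))"
proof -
  define w where "w = sq.levy_var / 2 * (\<integral>x. (g x)\<^sup>2 \<partial>ou.C)"
  have "((\<lambda>z. w * z\<^sup>2) \<longlongrightarrow> w * 0\<^sup>2) (nhds (0::real))"
    by (intro isCont_tendsto_nhds continuous_intros)
  then have ev: "\<forall>\<^sub>F z in nhds 0. w * z\<^sup>2 < 1" by (rule order_tendstoD(2)) simp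
  have "(\<integral>\<^sup>+\<omega>. ennreal (Y \<omega> ^ (2 * 1)) \<partial>M) \<le> ennreal ((3 * w) * cdiff_norm 1)"
  proof (rule even_moment_bound[where p = 0])
    show "\<forall>\<^sub>F z in nhds 0. integrable M (\<lambda>x. 1 - cos (z * Y x)) \<and>
       \<bar>(\<integral>x. 1 - cos (z * Y x) \<partial>M) - poly 0 z\<bar> \<le> 3 * w * \<bar>z\<bar> ^ (2 * 1)"
      using ev
    proof eventually_elim
      case (elim z)
      let ?K = "CLINT x|ou.C. \<kappa> (z * g x)"
      have K: "norm ?K \<le> w * z\<^sup>2"
        using cx.exponent_integrable(2)[OF continuous_exponent _ g, of z] by (simp add: w_def mult_ac)
      have "\<bar>1 - Re (exp ?K)\<bar> = \<bar>Re (exp ?K - 1)\<bar>" by simp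
      also have "\<dots> \<le> norm (exp ?K - 1)" by (rule abs_Re_le_cmod)
      also have "\<dots> \<le> 3 * norm ?K" using K elim by (intro norm_exp_minus_one_le) linarith
      also have "\<dots> \<le> 3 * w * z\<^sup>2" using K by simp
      finally show ?case
        using integral_one_minus_cos[of Y z] by (simp add: ch)
    qed
  qed auto
  then show ?thesis by (simp add: moment_const_def w_def mult_ac)
qed

lemma nn_integral_X_diff:
  "(\<integral>\<^sup>+\<omega>. ennreal ((X t \<omega> - X u \<omega>)\<^sup>2) \<partial>M) \<le> ennreal (moment_const * ou.kernel_gap (t - u))"
proof -
  have h: "has_stoch_integral M ou.C \<Lambda> (\<lambda>x. supOU_kernel t x - supOU_kernel u x) (\<lambda>\<omega>. X t \<omega> - X u \<omega>)"
    using has_stoch_integral_linear[OF integral integral, of t "-1" u] by simp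
  note L2 = integrable_square_of_nn[OF _ eq_refl[OF ou.nn_integral_kernel_diff] ou.kernel_gap_bounds(1), of t u]
  have "(\<integral>\<^sup>+\<omega>. ennreal ((X t \<omega> - X u \<omega>)\<^sup>2) \<partial>M) \<le> ennreal (moment_const * (\<integral>x. (supOU_kernel t x - supOU_kernel u x)\<^sup>2 \<partial>ou.C))"
    by (rule second_moment_of_char[OF _ _ L2(1) char_integral_L2[OF h L2(1)]]) measurable
  also have "\<dots> \<le> ennreal (moment_const * ou.kernel_gap (t - u))"
    by (intro ennreal_leI mult_left_mono L2(2) moment_const_nonneg) measurable
  finally show ?thesis .
qed

lemma nn_integral_X_square: "(\<integral>\<^sup>+\<omega>. ennreal ((X t \<omega>)\<^sup>2) \<partial>M) \<le> ennreal moment_const"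
proof -
  have k2: "integrable ou.C (\<lambda>c. (supOU_kernel t c)\<^sup>2)" "(\<integral>c. (supOU_kernel t c)\<^sup>2 \<partial>ou.C) = 1 / 2"
    using ou.integrable_kernel_power[of 2 t] by simp_all
  have "(\<integral>\<^sup>+\<omega>. ennreal ((X t \<omega>)\<^sup>2) \<partial>M) \<le> ennreal (moment_const * (\<integral>c. (supOU_kernel t c)\<^sup>2 \<partial>ou.C))"
    by (rule second_moment_of_char[OF _ _ k2(1) char_integral_L2[OF integral k2(1)]]) measurable
  also have "\<dots> \<le> ennreal moment_const"
    using moment_const_nonneg by (intro ennreal_leI) (simp add: k2)
  finally show ?thesis .
qed

text \<open>Ensures that the Bochner integral in \<open>integrated_process\<close> is almost surely
  a genuine one and not the default value 0.\<close>

lemma AE_set_integrable: "AE \<omega> in M. set_integrable lborel {0..t} (\<lambda>s. X s \<omega>)"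
proof -
  interpret P: pair_sigma_finite lborel M ..
  have [measurable]: "(\<lambda>(s, \<omega>). X s \<omega>) \<in> borel_measurable (lborel \<Otimes>\<^sub>M M)"
    using joint by (simp cong: measurable_cong_sets sets_pair_measure_cong)
  have "(\<integral>\<^sup>+\<omega>. \<integral>\<^sup>+s. indicator {0..t} s * ennreal ((X s \<omega>)\<^sup>2) \<partial>lborel \<partial>M) =
      (\<integral>\<^sup>+s. \<integral>\<^sup>+\<omega>. indicator {0..t} s * ennreal ((X s \<omega>)\<^sup>2) \<partial>M \<partial>lborel)"
    by (rule P.Fubini') measurable
  also have "\<dots> = (\<integral>\<^sup>+s. indicator {0..t} s * (\<integral>\<^sup>+\<omega>. ennreal ((X s \<omega>)\<^sup>2) \<partial>M) \<partial>lborel)"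
    by (intro nn_integral_cong nn_integral_cmult) measurable
  also have "\<dots> \<le> (\<integral>\<^sup>+s. ennreal moment_const * indicator {0..t} s \<partial>lborel)"
    using nn_integral_X_square by (intro nn_integral_mono) (auto simp: indicator_def)
  also have "\<dots> < \<infinity>"
    by (cases "t \<ge> 0") (simp_all add: nn_integral_cmult_indicator ennreal_mult_less_top)
  finally have fin: "(\<integral>\<^sup>+\<omega>. \<integral>\<^sup>+s. indicator {0..t} s * ennreal ((X s \<omega>)\<^sup>2) \<partial>lborel \<partial>M) \<noteq> \<infinity>" by simp
  have "AE \<omega> in M. (\<integral>\<^sup>+s. indicator {0..t} s * ennreal ((X s \<omega>)\<^sup>2) \<partial>lborel) \<noteq> \<infinity>"
    by (rule nn_integral_PInf_AE[OF _ fin]) measurable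
  then show ?thesis
    using AE_space
  proof eventually_elim
    case (elim \<omega>)
    have [measurable]: "(\<lambda>s. X s \<omega>) \<in> borel_measurable borel"
      using measurable_Pair1[OF joint elim(2)] by simp
    show ?case
      using set_integrable_of_square(2)[of "\<lambda>s. X s \<omega>" t] elim(1) by (simp add: set_integrable_def less_top)
  qed
qed

lemma integrated_measurable [measurable]: "integrated_process X t \<in> borel_measurable M"
proof -
  have "(\<lambda>z. (\<lambda>(s, \<omega>). X s \<omega>) (snd z, fst z)) \<in> borel_measurable (M \<Otimes>\<^sub>M lborel)"
    by (rule measurable_compose[OF _ joint]) measurable
  then have [measurable]: "(\<lambda>z. X (snd z) (fst z)) \<in> borel_measurable (M \<Otimes>\<^sub>M lborel)" by simp
  have "(\<lambda>(\<omega>, s). indicator {0..t} s *\<^sub>R X s \<omega>) \<in> borel_measurable (M \<Otimes>\<^sub>M lborel)"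
    unfolding case_prod_beta' by measurable
  then have "(\<lambda>\<omega>. LBINT s. indicator {0..t} s *\<^sub>R X s \<omega>) \<in> borel_measurable M"
    by (rule lborel.borel_measurable_lebesgue_integral)
  then show ?thesis by (simp add: integrated_process_def[abs_def] set_lebesgue_integral_def)
qed

lemma ou_kernel_L2:
  assumes "t \<ge> 0" shows "integrable ou.C (\<lambda>x. (ou_kernel t x)\<^sup>2)"
  using ou.integrable_ou_kernel_power[OF assms, of 1] by (simp add: numeral_2_eq_2)

lemma combination_L2:
  assumes "finite J" "J \<subseteq> {0..}"
  shows "integrable ou.C (\<lambda>x. (\<Sum>t\<in>J. c t * ou_kernel t x)\<^sup>2)"
  using assms
proof (induction J rule: finite_induct)
  case (insert t J)
  have "integrable ou.C (\<lambda>x. (c t * ou_kernel t x)\<^sup>2)"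
    unfolding power_mult_distrib using insert by (intro integrable_mult_right ou_kernel_L2) auto
  then have "integrable ou.C (\<lambda>x. (c t * ou_kernel t x + (\<Sum>t\<in>J. c t * ou_kernel t x))\<^sup>2)"
    using insert by (intro integrable_square_diff(2)) auto
  then show ?case using insert by simp
qed simp

text \<open>
  Both \<open>X\<^sup>*\<close> and its kernel are approximated in \<open>L\<^sup>2\<close> by the same Riemann sums, for which
  the formula holds by linearity of the stochastic integral.
\<close>

theorem char_integrated_combination:
  assumes J: "finite J" "J \<subseteq> {0..}"
  shows "char (distr M borel (\<lambda>\<omega>. \<Sum>t\<in>J. c t * integrated_process X t \<omega>)) \<zeta> =
    exp (CLINT x|ou.C. \<kappa> (\<zeta> * (\<Sum>t\<in>J. c t * ou_kernel t x)))"
proof -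
  define Y where "Y \<omega> = (\<Sum>t\<in>J. c t * integrated_process X t \<omega>)" for \<omega>
  define F where "F x = (\<Sum>t\<in>J. c t * ou_kernel t x)" for x
  define Yn where "Yn n \<omega> = (\<Sum>t\<in>J. c t * riemann_sum n t (\<lambda>s. X s \<omega>))" for n \<omega>
  define G where "G n x = (\<Sum>t\<in>J. c t * riemann_sum n t (\<lambda>s. supOU_kernel s x))" for n x
  define gap where "gap n = ou.kernel_gap (1 / real (Suc n))" for n
  have gap0: "gap n \<ge> 0" for n unfolding gap_def by (rule ou.kernel_gap_bounds)
  have gaplim: "gap \<longlonglongrightarrow> 0"
    unfolding gap_def by (intro ou.kernel_gap_tendsto_0 LIMSEQ_Suc[OF lim_1_over_n])
  have gaple: "ou.kernel_gap (s - grid n s) \<le> gap n" for n s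
    unfolding gap_def using grid_dist[of s n] by (intro ou.kernel_gap_mono) simp
  have int: "has_stoch_integral M ou.C \<Lambda> (G n) (Yn n)" for n
    unfolding G_def[abs_def] Yn_def[abs_def] riemann_sum_def by (intro has_stoch_integral_sum integral)
  note Gm [measurable] = has_stoch_integral_measurable(1)[OF int] and Ym [measurable] = has_stoch_integral_measurable(2)[OF int]
  have [measurable]: "F \<in> borel_measurable ou.C" "Y \<in> borel_measurable M"
    unfolding F_def[abs_def] Y_def[abs_def] by measurable
  have F2: "integrable ou.C (\<lambda>x. (F x)\<^sup>2)" unfolding F_def by (rule combination_L2[OF J])
  define S where "S = real (card J) * (\<Sum>t\<in>J. (c t)\<^sup>2 * t\<^sup>2)"
  have S: "S \<ge> 0" unfolding S_def by (intro mult_nonneg_nonneg sum_nonneg) auto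
  have eY: "(\<integral>\<^sup>+\<omega>. ennreal ((Yn n \<omega> - Y \<omega>)\<^sup>2) \<partial>M) \<le> ennreal (S * (moment_const * gap n))" for n
    unfolding Yn_def Y_def S_def integrated_process_def
  proof (rule riemann_combination_error[OF J joint X_measurable integrated_measurable[unfolded integrated_process_def[abs_def]] AE_set_integrable])
    show "(\<integral>\<^sup>+x. ennreal ((X s x - X (grid n s) x)\<^sup>2) \<partial>M) \<le> ennreal (moment_const * gap n)" for s
      using gaple[of s n] moment_const_nonneg
      by (intro order_trans[OF nn_integral_X_diff] ennreal_leI mult_left_mono) auto
  qed (use moment_const_nonneg gap0 in simp)
  have eG: "(\<integral>\<^sup>+x. ennreal ((G n x - F x)\<^sup>2) \<partial>ou.C) \<le> ennreal (S * gap n)" for n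
    unfolding G_def F_def S_def ou_kernel_def
  proof (rule C.riemann_combination_error[OF J ou.kernel_measurable ou.kernel_measurable_1 ou.ou_kernel_measurable[unfolded ou_kernel_def[abs_def]]])
    show "AE x in ou.C. set_integrable lborel {0..t} (\<lambda>s. supOU_kernel s x)" for t
      by (rule AE_I2) (metis ou.kernel_set_integrable surj_pair)
    show "(\<integral>\<^sup>+x. ennreal ((supOU_kernel s x - supOU_kernel (grid n s) x)\<^sup>2) \<partial>ou.C) \<le> ennreal (gap n)" for s
      unfolding ou.nn_integral_kernel_diff by (intro ennreal_leI gaple)
  qed (fact gap0)
  have Sg: "S * gap n \<ge> 0" "S * (moment_const * gap n) \<ge> 0" for n
    using S gap0 moment_const_nonneg by simp_all
  have GF: "integrable ou.C (\<lambda>x. (G n x - F x)\<^sup>2)" "(\<integral>x. (G n x - F x)\<^sup>2 \<partial>ou.C) \<le> S * gap n" for n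
    by (rule integrable_square_of_nn[OF _ eG Sg(1)]; measurable)+
  have G2: "integrable ou.C (\<lambda>x. (G n x)\<^sup>2)" for n
  proof -
    have "integrable ou.C (\<lambda>x. ((G n x - F x) + F x)\<^sup>2)"
      by (rule integrable_square_diff(2)[OF _ _ GF(1) F2]; measurable)
    then show ?thesis by simp
  qed
  have Sgl: "(\<lambda>n. S * gap n) \<longlonglongrightarrow> 0" using tendsto_mult_right_zero[OF gaplim] by simp
  have "(\<lambda>n. \<integral>x. (G n x - F x)\<^sup>2 \<partial>ou.C) \<longlonglongrightarrow> 0"
  proof (rule Lim_null_comparison[OF always_eventually Sgl], rule allI)
    show "norm (\<integral>x. (G n x - F x)\<^sup>2 \<partial>ou.C) \<le> S * gap n" for n
      using GF(2)[of n] by (simp add: abs_of_nonneg integral_nonneg_AE)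
  qed
  then have limK: "(\<lambda>n. CLINT x|ou.C. \<kappa> (\<zeta> * G n x)) \<longlonglongrightarrow> (CLINT x|ou.C. \<kappa> (\<zeta> * F x))"
    by (intro cx.exponent_integral_tendsto continuous_exponent F2 G2 GF) measurable
  have "converges_in_probability M Yn Y"
    unfolding converges_in_probability_def
  proof (intro conjI allI impI)
    fix \<epsilon> :: real assume \<epsilon>: "\<epsilon> > 0"
    have lim: "(\<lambda>n. S * (moment_const * gap n) / \<epsilon>\<^sup>2) \<longlonglongrightarrow> 0"
      using tendsto_mult_right_zero[OF gaplim, of "S * moment_const / \<epsilon>\<^sup>2"] by (simp add: mult.assoc)
    show "(\<lambda>n. measure M {\<omega> \<in> space M. \<epsilon> < \<bar>Yn n \<omega> - Y \<omega>\<bar>}) \<longlonglongrightarrow> 0"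
    proof (rule Lim_null_comparison[OF always_eventually lim], rule allI)
      fix n
      note D = integrable_square_of_nn[OF _ eY Sg(2), of n]
      have "measure M {\<omega> \<in> space M. \<epsilon> < \<bar>Yn n \<omega> - Y \<omega>\<bar>} \<le> measure M {\<omega> \<in> space M. (Yn n \<omega> - Y \<omega>)\<^sup>2 \<ge> \<epsilon>\<^sup>2}"
      proof (rule finite_measure_mono)
        show "{\<omega> \<in> space M. \<epsilon> < \<bar>Yn n \<omega> - Y \<omega>\<bar>} \<subseteq> {\<omega> \<in> space M. (Yn n \<omega> - Y \<omega>)\<^sup>2 \<ge> \<epsilon>\<^sup>2}"
          using \<epsilon> by (auto simp: abs_le_square_iff[symmetric])
      qed measurable
      also have "\<dots> \<le> expectation (\<lambda>\<omega>. (Yn n \<omega> - Y \<omega>)\<^sup>2) / \<epsilon>\<^sup>2"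
        using \<epsilon> D(1) by (intro integral_Markov_inequality_measure[where A = "space M", simplified]) auto
      also have "\<dots> \<le> S * (moment_const * gap n) / \<epsilon>\<^sup>2"
        using D(2) by (intro divide_right_mono) auto
      finally show "norm (measure M {\<omega> \<in> space M. \<epsilon> < \<bar>Yn n \<omega> - Y \<omega>\<bar>}) \<le> S * (moment_const * gap n) / \<epsilon>\<^sup>2"
        by simp
    qed
  qed measurable
  then have "(\<lambda>n. char (distr M borel (Yn n)) \<zeta>) \<longlonglongrightarrow> char (distr M borel Y) \<zeta>"
    by (rule converges_in_probability_char[OF Ym])
  moreover have "(\<lambda>n. char (distr M borel (Yn n)) \<zeta>) \<longlonglongrightarrow> exp (CLINT x|ou.C. \<kappa> (\<zeta> * F x))"
    unfolding char_integral_L2[OF int G2] by (rule tendsto_exp[OF limK])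
  ultimately have "char (distr M borel Y) \<zeta> = exp (CLINT x|ou.C. \<kappa> (\<zeta> * F x))"
    by (rule LIMSEQ_unique)
  then show ?thesis by (simp add: Y_def[abs_def] F_def)
qed

end

section \<open>Growth exponents and convexity\<close>

text \<open>Hoelder's inequality, from Young's inequality applied pointwise after both outer moments
  are normalised. The value 0 at \<open>q = 0\<close> is the logarithm of the total mass; it lets
  the origin serve as an interpolation point.\<close>

lemma (in prob_space) log_moment_convex:
  fixes u :: "'a \<Rightarrow> real"
  assumes u [measurable]: "u \<in> borel_measurable M" and u0: "\<And>x. u x \<ge> 0"
    and int: "\<And>q. q > 0 \<Longrightarrow> integrable M (\<lambda>x. u x powr q)"
    and pos: "\<And>q. q > 0 \<Longrightarrow> expectation (\<lambda>x. u x powr q) > 0"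
  defines "L \<equiv> \<lambda>q. if q = 0 then 0 else ln (expectation (\<lambda>x. u x powr q))"
  shows "convex_on {0..} L"
proof (rule convex_onI)
  fix s p r :: real
  assume s: "0 < s" "s < 1" and p: "p \<in> {0..}" and r: "r \<in> {0..}"
  let ?q = "(1 - s) * p + s * r"
  define A where "A = exp (L p)"
  define B where "B = exp (L r)"
  have AB: "A > 0" "B > 0" by (simp_all add: A_def B_def)
  have int0: "integrable M (\<lambda>x. u x powr q)" if "q \<ge> 0" for q
    using int[of q] that by (cases "q = 0") (auto intro!: integrable_const_bound[of _ 1] simp: powr_def)
  \<comment> \<open>At \<open>q = 0\<close> equality can fail: since \<open>0 powr 0 = 0\<close>,
    the integral is the probability that \<open>u\<close> is nonzero.\<close>
  have le: "expectation (\<lambda>x. u x powr q) \<le> exp (L q)" if "q \<ge> 0" for q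
  proof (cases "q = 0")
    case True
    have "expectation (\<lambda>x. u x powr q) \<le> expectation (\<lambda>x. 1)"
      using True by (intro integral_mono int0) (auto simp: powr_def)
    then show ?thesis by (simp add: True L_def prob_space)
  next
    case False
    then show ?thesis using pos[of q] that by (simp add: L_def)
  qed
  show "L ((1 - s) *\<^sub>R p + s *\<^sub>R r) \<le> (1 - s) * L p + s * L r"
  proof (cases "?q = 0")
    case True
    then have "(1 - s) * p = 0" "s * r = 0" using s p r by (auto simp: add_nonneg_eq_0_iff)
    then have "p = 0" "r = 0" using s by auto
    then show ?thesis by (simp add: L_def)
  next
    case False
    have q: "?q > 0" using False s p r by (simp add: order.not_eq_order_implies_strict add_nonneg_nonneg)
    have pw: "u x powr ?q \<le> A powr (1 - s) * B powr s * ((1 - s) / A * u x powr p + s / B * u x powr r)" for x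
    proof (cases "u x = 0")
      case True
      then show ?thesis using s AB by simp
    next
      case False
      then have ux: "u x > 0" using u0[of x] by simp
      have "(u x powr p / A) powr (1 - s) * (u x powr r / B) powr s \<le> (1 - s) * (u x powr p / A) + s * (u x powr r / B)"
        using s ux AB by (intro Youngs_inequality_0) auto
      moreover have "u x powr ?q = A powr (1 - s) * B powr s * ((u x powr p / A) powr (1 - s) * (u x powr r / B) powr s)"
        using ux AB by (simp add: powr_divide powr_powr powr_add mult_ac)
      ultimately show ?thesis
        using AB by (simp add: mult_left_mono)
    qed
    have "expectation (\<lambda>x. u x powr ?q) \<le> expectation (\<lambda>x. A powr (1 - s) * B powr s * ((1 - s) / A * u x powr p + s / B * u x powr r))"
      using p r q by (intro integral_mono int0 pw integrable_mult_right Bochner_Integration.integrable_add) auto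
    also have "\<dots> = A powr (1 - s) * B powr s * ((1 - s) / A * expectation (\<lambda>x. u x powr p) + s / B * expectation (\<lambda>x. u x powr r))"
      using int0[of p] int0[of r] p r by simp
    also have "\<dots> \<le> A powr (1 - s) * B powr s * ((1 - s) / A * A + s / B * B)"
      using s AB le[of p] le[of r] p r by (intro mult_left_mono add_mono) (auto simp: A_def B_def)
    also have "\<dots> = A powr (1 - s) * B powr s" using AB by simp
    also have "\<dots> = exp ((1 - s) * L p + s * L r)"
      by (simp add: A_def B_def powr_def exp_add)
    finally have "expectation (\<lambda>x. u x powr ?q) \<le> exp ((1 - s) * L p + s * L r)" .
    then have "ln (expectation (\<lambda>x. u x powr ?q)) \<le> (1 - s) * L p + s * L r"
      using pos[OF q] by (simp add: ln_le_cancel_iff[symmetric] del: ln_le_cancel_iff)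
    then show ?thesis using False by (simp add: L_def)
  qed
qed simp

lemma affine_combination_eq:
  fixes q u v :: real
  assumes "u \<noteq> v"
  shows "q = (1 - (q - u) / (v - u)) * u + (q - u) / (v - u) * v"
    "q = (1 - (u - q) / (u - v)) * u + (u - q) / (u - v) * v"
proof -
  have lin: "(1 - s) * u + s * v = u + s * (v - u)" for s by (simp add: algebra_simps)
  have a: "(q - u) / (v - u) * (v - u) = q - u" using assms by simp
  show 1: "q = (1 - (q - u) / (v - u)) * u + (q - u) / (v - u) * v" unfolding lin a by simp
  have "(u - q) / (u - v) = (q - u) / (v - u)"
    by (metis minus_diff_eq minus_divide_divide)
  then show "q = (1 - (u - q) / (u - v)) * u + (u - q) / (u - v) * v" using 1 by simp
qed

text \<open>Between two neighbouring points the chord bounds from above. For the lower bound, a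
  middle point lies between \<open>q\<close> and a far point, so its known value is at most the
  corresponding value on their chord. As the three limits lie on one line, both bounds meet.\<close>

lemma convex_interpolation_limit:
  fixes L :: "real \<Rightarrow> real \<Rightarrow> real"
  assumes conv: "\<forall>\<^sub>F t in at_top. convex_on {0..} (L t)"
    and p: "0 \<le> p1" "p1 < p2" "p2 < p3"
    and lim: "((\<lambda>t. L t p1 / ln t) \<longlongrightarrow> A + B * p1) at_top" "((\<lambda>t. L t p2 / ln t) \<longlongrightarrow> A + B * p2) at_top"
      "((\<lambda>t. L t p3 / ln t) \<longlongrightarrow> A + B * p3) at_top"
    and q: "p1 \<le> q" "q \<le> p3"
  shows "((\<lambda>t. L t q / ln t) \<longlongrightarrow> A + B * q) at_top"
proof -
  have upper: "\<forall>\<^sub>F t in at_top. L t ((1 - s) * x + s * y) / ln t \<le> (1 - s) * (L t x / ln t) + s * (L t y / ln t)"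
    if "0 \<le> s" "s \<le> 1" "0 \<le> x" "0 \<le> y" for s x y
    using conv eventually_gt_at_top[of 1]
  proof eventually_elim
    case (elim t)
    have "L t ((1 - s) * x + s * y) \<le> (1 - s) * L t x + s * L t y"
      using convex_onD[OF elim(1), of s x y] that by simp
    then have "L t ((1 - s) * x + s * y) / ln t \<le> ((1 - s) * L t x + s * L t y) / ln t"
      using elim(2) by (intro divide_right_mono) auto
    then show ?case by (simp add: add_divide_distrib)
  qed
  \<comment> \<open>Here \<open>q\<close> lies between \<open>x\<close> and \<open>y\<close>, and
    \<open>y\<close> between \<open>q\<close> and \<open>z\<close>. The outer points
    \<open>x\<close> and \<open>z\<close> may come in either order, which treats both sides of
    \<open>p2\<close> at once.\<close>
  have between: "((\<lambda>t. L t q / ln t) \<longlongrightarrow> A + B * q) at_top"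
    if xy: "0 \<le> x" "0 \<le> y" "0 \<le> z" and s: "0 \<le> s" "s \<le> 1" "q = (1 - s) * x + s * y"
      and r: "0 \<le> r" "r < 1" "y = (1 - r) * q + r * z"
      and l: "((\<lambda>t. L t x / ln t) \<longlongrightarrow> A + B * x) at_top" "((\<lambda>t. L t y / ln t) \<longlongrightarrow> A + B * y) at_top"
        "((\<lambda>t. L t z / ln t) \<longlongrightarrow> A + B * z) at_top" for x y z s r
  proof (rule tendsto_sandwich)
    have q0: "0 \<le> q" using s xy by simp
    show "\<forall>\<^sub>F t in at_top. L t q / ln t \<le> (1 - s) * (L t x / ln t) + s * (L t y / ln t)"
      unfolding s(3) using s xy by (intro upper) auto
    show "\<forall>\<^sub>F t in at_top. (L t y / ln t - r * (L t z / ln t)) / (1 - r) \<le> L t q / ln t"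
      using upper[of r q z] r q0 xy unfolding r(3)[symmetric] by (auto elim!: eventually_mono simp: pos_divide_le_eq algebra_simps)
    have "((\<lambda>t. (1 - s) * (L t x / ln t) + s * (L t y / ln t)) \<longlongrightarrow> (1 - s) * (A + B * x) + s * (A + B * y)) at_top"
      by (intro tendsto_intros l)
    also have "(1 - s) * (A + B * x) + s * (A + B * y) = A + B * q" by (simp add: s(3) algebra_simps)
    finally show "((\<lambda>t. (1 - s) * (L t x / ln t) + s * (L t y / ln t)) \<longlongrightarrow> A + B * q) at_top" .
    have "((\<lambda>t. (L t y / ln t - r * (L t z / ln t)) / (1 - r)) \<longlongrightarrow> ((A + B * y) - r * (A + B * z)) / (1 - r)) at_top"
      using r by (intro tendsto_intros l) auto
    also have "((A + B * y) - r * (A + B * z)) / (1 - r) = A + B * q"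
    proof -
      have "(A + B * y) - r * (A + B * z) = (A + B * q) * (1 - r)"
        by (subst r(3)) (simp add: algebra_simps)
      then show ?thesis using r by simp
    qed
    finally show "((\<lambda>t. (L t y / ln t - r * (L t z / ln t)) / (1 - r)) \<longlongrightarrow> A + B * q) at_top" .
  qed
  have q0: "0 \<le> q" using p q by simp
  consider "q < p2" | "q = p2" | "p2 < q" by linarith
  then show ?thesis
  proof cases
    case 1
    show ?thesis
    proof (rule between[OF _ _ _ _ _ _ _ _ _ lim(1) lim(2) lim(3)])
      show "q = (1 - (q - p1) / (p2 - p1)) * p1 + (q - p1) / (p2 - p1) * p2"
        using p by (intro affine_combination_eq) simp
      show "p2 = (1 - (p2 - q) / (p3 - q)) * q + (p2 - q) / (p3 - q) * p3"
        using 1 p by (intro affine_combination_eq) simp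
    qed (use p q 1 in auto)
  next
    case 2
    then show ?thesis using lim by simp
  next
    case 3
    show ?thesis
    proof (rule between[OF _ _ _ _ _ _ _ _ _ lim(3) lim(2) lim(1)])
      show "q = (1 - (p3 - q) / (p3 - p2)) * p3 + (p3 - q) / (p3 - p2) * p2"
        using p by (intro affine_combination_eq) simp
      show "p2 = (1 - (q - p2) / (q - p1)) * q + (q - p2) / (q - p1) * p1"
        using p q 3 by (intro affine_combination_eq) simp
    qed (use p q 3 in auto)
  qed
qed

section \<open>Growth exponents of functions and of moments\<close>

lemma log_ratio_upper:
  fixes f :: "real \<Rightarrow> real"
  assumes pos: "\<forall>\<^sub>F t in at_top. 0 < f t"
    and up: "\<And>e. e > 0 \<Longrightarrow> \<exists>B. \<forall>\<^sub>F t in at_top. f t \<le> B * t powr (\<tau> + e)" and y: "\<tau> < y"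
  shows "\<forall>\<^sub>F t in at_top. ln (f t) / ln t < y"
proof -
  define e where "e = (y - \<tau>) / 2"
  have e: "e > 0" using y by (simp add: e_def)
  obtain B where B: "\<forall>\<^sub>F t in at_top. f t \<le> B * t powr (\<tau> + e)" using up[OF e] by blast
  have "((\<lambda>t. ln (\<bar>B\<bar> + 1) / ln t) \<longlongrightarrow> 0) at_top" by real_asymp
  then have "\<forall>\<^sub>F t in at_top. ln (\<bar>B\<bar> + 1) / ln t < e" using e by (rule order_tendstoD(2))
  then show ?thesis
    using B pos eventually_gt_at_top[of 1]
  proof eventually_elim
    case (elim t)
    have "f t \<le> (\<bar>B\<bar> + 1) * t powr (\<tau> + e)"
      using elim by (intro order_trans[OF elim(2)] mult_right_mono) auto
    then have "ln (f t) \<le> ln ((\<bar>B\<bar> + 1) * t powr (\<tau> + e))" using elim by simp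
    also have "\<dots> = ln (\<bar>B\<bar> + 1) + (\<tau> + e) * ln t"
      using elim by (subst ln_mult) (auto simp: ln_powr)
    finally have "ln (f t) / ln t \<le> (ln (\<bar>B\<bar> + 1) + (\<tau> + e) * ln t) / ln t"
      using elim by (intro divide_right_mono) auto
    also have "\<dots> = ln (\<bar>B\<bar> + 1) / ln t + (\<tau> + e)" using elim by (simp add: add_divide_distrib)
    also have "\<dots> < y" using elim by (simp add: e_def field_simps)
    finally show ?case .
  qed
qed

lemma log_ratio_limit:
  fixes f :: "real \<Rightarrow> real"
  assumes up: "\<And>e. e > 0 \<Longrightarrow> \<exists>B. \<forall>\<^sub>F t in at_top. f t \<le> B * t powr (\<tau> + e)"
    and lo: "\<And>e. e > 0 \<Longrightarrow> \<exists>c>0. \<forall>\<^sub>F t in at_top. c * t powr (\<tau> - e) \<le> f t"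
  shows "((\<lambda>t. ln (f t) / ln t) \<longlongrightarrow> \<tau>) at_top"
proof (rule order_tendstoI)
  fix y assume y: "\<tau> < y"
  obtain c where c: "c > 0" "\<forall>\<^sub>F t in at_top. c * t powr (\<tau> - 1) \<le> f t" using lo[of 1] by auto
  have "\<forall>\<^sub>F t in at_top. 0 < f t"
    using c(2) eventually_gt_at_top[of 0]
  proof eventually_elim
    case (elim t)
    then show ?case using c(1) by (intro less_le_trans[OF _ elim(1)]) simp
  qed
  then show "\<forall>\<^sub>F t in at_top. ln (f t) / ln t < y" using up y by (rule log_ratio_upper)
next
  fix y assume y: "y < \<tau>"
  define e where "e = (\<tau> - y) / 2"
  have e: "e > 0" using y by (simp add: e_def)
  obtain c where c: "c > 0" "\<forall>\<^sub>F t in at_top. c * t powr (\<tau> - e) \<le> f t" using lo[OF e] by blast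
  have "((\<lambda>t. ln c / ln t) \<longlongrightarrow> 0) at_top" by real_asymp
  then have "\<forall>\<^sub>F t in at_top. - e < ln c / ln t" using e by (intro order_tendstoD(1)) auto
  then show "\<forall>\<^sub>F t in at_top. y < ln (f t) / ln t"
    using c(2) eventually_gt_at_top[of 1]
  proof eventually_elim
    case (elim t)
    have "ln c + (\<tau> - e) * ln t = ln (c * t powr (\<tau> - e))"
      using elim c by (subst ln_mult) (auto simp: ln_powr)
    also have "\<dots> \<le> ln (f t)"
      using elim c by (subst ln_le_cancel_iff) (auto intro: less_le_trans[OF _ elim(2)])
    finally have "(ln c + (\<tau> - e) * ln t) / ln t \<le> ln (f t) / ln t"
      using elim by (intro divide_right_mono) auto
    moreover have "(ln c + (\<tau> - e) * ln t) / ln t = ln c / ln t + (\<tau> - e)" using elim by (simp add: add_divide_distrib)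
    moreover have "y = \<tau> - 2 * e" unfolding e_def by (simp add: field_simps)
    ultimately show ?case using elim by linarith
  qed
qed

text \<open>Growth exponent at most \<open>d\<close> up to arbitrarily small powers, which swallow
  slowly varying factors. The absolute value is there since cumulants of odd order may be negative,
  and the common range \<open>t \<ge> 1\<close> makes sums and products immediate.\<close>

definition power_bounded :: "(real \<Rightarrow> real) \<Rightarrow> real \<Rightarrow> bool" where
  "power_bounded f d \<longleftrightarrow> (\<forall>e>0. \<exists>B. \<forall>t\<ge>1. \<bar>f t\<bar> \<le> B * t powr (d + e))"

lemma power_bounded_0: "power_bounded (\<lambda>t. 0) d"
  by (auto simp: power_bounded_def intro!: exI[of _ 0])

lemma power_bounded_mono:
  assumes "power_bounded f d" "d \<le> d'" shows "power_bounded f d'"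
  unfolding power_bounded_def
proof (intro allI impI)
  fix e :: real assume "e > 0"
  then obtain B where B: "\<And>t. t \<ge> 1 \<Longrightarrow> \<bar>f t\<bar> \<le> B * t powr (d + e)"
    using assms(1) by (auto simp: power_bounded_def)
  have "\<bar>f t\<bar> \<le> \<bar>B\<bar> * t powr (d' + e)" if "t \<ge> 1" for t
  proof -
    have "\<bar>f t\<bar> \<le> B * t powr (d + e)" using B that by blast
    also have "\<dots> \<le> \<bar>B\<bar> * t powr (d' + e)"
      using that assms(2) by (intro mult_mono powr_mono) auto
    finally show ?thesis .
  qed
  then show "\<exists>B. \<forall>t\<ge>1. \<bar>f t\<bar> \<le> B * t powr (d' + e)" by blast
qed

lemma power_bounded_mult:
  assumes "power_bounded f d" "power_bounded g d'" shows "power_bounded (\<lambda>t. f t * g t) (d + d')"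
  unfolding power_bounded_def
proof (intro allI impI)
  fix e :: real assume e: "e > 0"
  obtain B where B: "\<And>t. t \<ge> 1 \<Longrightarrow> \<bar>f t\<bar> \<le> B * t powr (d + e / 2)"
    using assms(1)[unfolded power_bounded_def, rule_format, of "e / 2"] e by auto
  obtain B' where B': "\<And>t. t \<ge> 1 \<Longrightarrow> \<bar>g t\<bar> \<le> B' * t powr (d' + e / 2)"
    using assms(2)[unfolded power_bounded_def, rule_format, of "e / 2"] e by auto
  have "\<bar>f t * g t\<bar> \<le> (B * B') * t powr (d + d' + e)" if t: "t \<ge> 1" for t
  proof -
    have "\<bar>f t * g t\<bar> \<le> (B * t powr (d + e / 2)) * (B' * t powr (d' + e / 2))"
      unfolding abs_mult by (intro mult_mono B B' t order_trans[OF abs_ge_zero B]) auto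
    also have "\<dots> = (B * B') * (t powr (d + e / 2) * t powr (d' + e / 2))" by (simp add: mult_ac)
    also have "t powr (d + e / 2) * t powr (d' + e / 2) = t powr (d + d' + e)"
      unfolding powr_add[symmetric] by (simp add: algebra_simps)
    finally show ?thesis .
  qed
  then show "\<exists>B. \<forall>t\<ge>1. \<bar>f t * g t\<bar> \<le> B * t powr (d + d' + e)" by blast
qed

lemma power_bounded_add:
  assumes "power_bounded f d" "power_bounded g d" shows "power_bounded (\<lambda>t. f t + g t) d"
  unfolding power_bounded_def
proof (intro allI impI)
  fix e :: real assume e: "e > 0"
  obtain B where B: "\<And>t. t \<ge> 1 \<Longrightarrow> \<bar>f t\<bar> \<le> B * t powr (d + e)"
    using assms(1)[unfolded power_bounded_def, rule_format, OF e] by auto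
  obtain B' where B': "\<And>t. t \<ge> 1 \<Longrightarrow> \<bar>g t\<bar> \<le> B' * t powr (d + e)"
    using assms(2)[unfolded power_bounded_def, rule_format, OF e] by auto
  have "\<bar>f t + g t\<bar> \<le> (B + B') * t powr (d + e)" if t: "t \<ge> 1" for t
    using B[OF t] B'[OF t] abs_triangle_ineq[of "f t" "g t"] by (simp add: distrib_right)
  then show "\<exists>B. \<forall>t\<ge>1. \<bar>f t + g t\<bar> \<le> B * t powr (d + e)" by blast
qed

lemma power_bounded_sum:
  "(\<And>i. i \<in> I \<Longrightarrow> power_bounded (f i) d) \<Longrightarrow> power_bounded (\<lambda>t. \<Sum>i\<in>I. f i t) d"
  by (induction I rule: infinite_finite_induct) (auto intro: power_bounded_0 power_bounded_add)

lemma power_bounded_const: "power_bounded (\<lambda>t. c) 0"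
  unfolding power_bounded_def
proof (intro allI impI exI[of _ "\<bar>c\<bar>"])
  fix e t :: real assume "e > 0" "t \<ge> 1"
  then have "1 \<le> t powr (0 + e)" using ge_one_powr_ge_zero[of t e] by simp
  then show "\<bar>c\<bar> \<le> \<bar>c\<bar> * t powr (0 + e)" using mult_left_mono[of 1 _ "\<bar>c\<bar>"] by simp
qed

lemma power_bounded_cmult: "power_bounded f d \<Longrightarrow> power_bounded (\<lambda>t. c * f t) d"
  using power_bounded_mult[OF power_bounded_const, of f d c] by simp

text \<open>Induction along the recursion: each summand pairs a cumulant of order at least two, the
  first being zero, with a lower moment, and the superadditivity \<open>E\<close> of the exponents
  bounds the product.\<close>

lemma power_bounded_moment_of_cumulants:
  fixes c :: "nat \<Rightarrow> real \<Rightarrow> real"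
  assumes c1: "\<And>t. c 1 t = 0" and c: "\<And>k. k \<ge> 2 \<Longrightarrow> power_bounded (c k) (d k)"
    and E0: "E 0 \<ge> 0" and E: "\<And>k j. k \<ge> 2 \<Longrightarrow> d k + E j \<le> E (k + j)"
  shows "power_bounded (\<lambda>t. moment_of_cumulants (\<lambda>k. c k t) n) (E n)"
proof (induction n rule: less_induct)
  case (less n)
  show ?case
  proof (cases n)
    case 0
    then show ?thesis using power_bounded_mono[OF power_bounded_const[of 1] E0] by simp
  next
    case (Suc m)
    have "power_bounded (\<lambda>t. of_nat (m choose k) * c (Suc k) t * moment_of_cumulants (\<lambda>k. c k t) (m - k)) (E n)"
      if k: "k \<in> {..m}" for k
    proof (cases "k = 0")
      case True
      then show ?thesis using c1 by (simp add: power_bounded_0)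
    next
      case False
      have "power_bounded (\<lambda>t. (of_nat (m choose k) * c (Suc k) t) * moment_of_cumulants (\<lambda>k. c k t) (m - k)) (d (Suc k) + E (m - k))"
        using False Suc by (intro power_bounded_mult power_bounded_cmult c less.IH) auto
      moreover have "d (Suc k) + E (m - k) \<le> E n"
        using E[of "Suc k" "m - k"] False k Suc by simp
      ultimately show ?thesis by (rule power_bounded_mono)
    qed
    moreover have "moment_of_cumulants (\<lambda>k. c k t) n =
        (\<Sum>k\<le>m. of_nat (m choose k) * c (Suc k) t * moment_of_cumulants (\<lambda>k. c k t) (m - k))" for t
      by (simp add: Suc)
    ultimately show ?thesis by (simp only: power_bounded_sum)
  qed
qed

text \<open>Without the cumulant of full order, every product contains a moment of positive order.
  The moment of order one vanishes with the first cumulant, so both factors have order at least two,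
  where a smaller exponent \<open>D\<close> is possible.\<close>

lemma power_bounded_moment_minus_cumulant:
  fixes c :: "nat \<Rightarrow> real \<Rightarrow> real"
  assumes c1: "\<And>t. c 1 t = 0" and c: "\<And>k. k \<ge> 2 \<Longrightarrow> power_bounded (c k) (d k)"
    and E0: "E 0 \<ge> 0" and E: "\<And>k j. k \<ge> 2 \<Longrightarrow> d k + E j \<le> E (k + j)"
    and D: "\<And>k j. k \<ge> 2 \<Longrightarrow> j \<ge> 2 \<Longrightarrow> k + j = n \<Longrightarrow> d k + E j \<le> D" and n: "n > 0"
  shows "power_bounded (\<lambda>t. moment_of_cumulants (\<lambda>k. c k t) n - c n t) D"
proof -
  obtain m where m: "n = Suc m" using n by (cases n) auto
  have eq: "moment_of_cumulants (\<lambda>k. c k t) n - c n t =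
      (\<Sum>k<m. of_nat (m choose k) * c (Suc k) t * moment_of_cumulants (\<lambda>k. c k t) (m - k))" for t
    by (simp add: m lessThan_Suc_atMost[symmetric])
  have M1: "moment_of_cumulants (\<lambda>k. c k t) 1 = 0" for t
    using c1 by simp
  show ?thesis unfolding eq
  proof (rule power_bounded_sum)
    fix k assume k: "k \<in> {..<m}"
    show "power_bounded (\<lambda>t. of_nat (m choose k) * c (Suc k) t * moment_of_cumulants (\<lambda>k. c k t) (m - k)) D"
    proof (cases "k = 0 \<or> m - k = 1")
      case True
      then show ?thesis using c1 M1 by (auto simp: power_bounded_0)
    next
      case False
      have "power_bounded (\<lambda>t. (of_nat (m choose k) * c (Suc k) t) * moment_of_cumulants (\<lambda>k. c k t) (m - k)) (d (Suc k) + E (m - k))"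
        using False by (intro power_bounded_mult power_bounded_cmult c power_bounded_moment_of_cumulants[OF c1 c E0 E]) auto
      moreover have "d (Suc k) + E (m - k) \<le> D"
        using False k m by (intro D) auto
      ultimately show ?thesis by (rule power_bounded_mono)
    qed
  qed
qed

section \<open>Regular variation\<close>

text \<open>
  Monotonicity of \<open>x \<mapsto> \<pi>((0,x])\<close> reduces all that is needed of regular variation to
  the behaviour along \<open>x\<^sub>0 / 2\<^sup>k\<close>.
\<close>

locale regularly_varying_ou_measure = ou_measure +
  fixes l :: "real \<Rightarrow> real" and \<alpha> :: nat
  assumes slow: "slowly_varying l" and alpha: "\<alpha> > 1"
    and asymp: "(\<lambda>x. measure \<pi> {0<..x}) \<sim>[at_right 0] (\<lambda>x. l (1 / x) * x ^ \<alpha>)"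
begin

abbreviation "G x \<equiv> measure \<pi> {0<..x}"

lemma Ioc_sets [measurable]: "{0<..x::real} \<in> sets \<pi>"
  by (auto simp: sets_pi sets_restrict_space_iff)

lemma G_mono: "x \<le> y \<Longrightarrow> G x \<le> G y"
  by (intro finite_measure_mono) auto

lemma inverse_at_right: "filterlim (\<lambda>x::real. 1 / x) at_top (at_right 0)"
  by real_asymp

lemma half_at_right: "filterlim (\<lambda>x::real. x / 2) (at_right 0) (at_right 0)"
  by real_asymp

lemma l_pos: "\<forall>\<^sub>F x in at_right 0. l (1 / x) > 0"
proof -
  obtain x0 where "\<And>x. x \<ge> x0 \<Longrightarrow> l x > 0" using slow by (auto simp: slowly_varying_def)
  then have "\<forall>\<^sub>F x in at_top. l x > 0" by (auto simp: eventually_at_top_linorder)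
  then show ?thesis by (rule eventually_compose_filterlim[OF _ inverse_at_right])
qed

lemma ratio_limit: "((\<lambda>x. G x / (l (1 / x) * x ^ \<alpha>)) \<longlongrightarrow> 1) (at_right 0)"
proof -
  have "\<forall>\<^sub>F x in at_right 0. l (1 / x) * x ^ \<alpha> \<noteq> 0"
    using l_pos eventually_at_right_less[of 0] by eventually_elim auto
  then have "\<forall>\<^sub>F x in at_right 0. (if G x = 0 \<and> l (1 / x) * x ^ \<alpha> = 0 then 1 else G x / (l (1 / x) * x ^ \<alpha>)) = G x / (l (1 / x) * x ^ \<alpha>)"
    by eventually_elim auto
  with asymp_equivD[OF asymp] show ?thesis by (rule Lim_transform_eventually)
qed

lemma G_pos: "\<forall>\<^sub>F x in at_right 0. G x > 0"
proof -
  have "\<forall>\<^sub>F x in at_right 0. G x / (l (1 / x) * x ^ \<alpha>) > 0"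
    using ratio_limit by (rule order_tendstoD(1)) simp
  then show ?thesis
    by eventually_elim (use measure_nonneg[of \<pi>] in \<open>auto simp: zero_less_divide_iff order.order_iff_strict\<close>)
qed

text \<open>Slow variation is used with the factor 2 only: the quotient of \<open>l\<close> at 2 / x
  and at 1 / x tends to 1, which leaves the quotient of the powers.\<close>

lemma halving_limit: "((\<lambda>x. G (x / 2) / G x) \<longlongrightarrow> (1 / 2) ^ \<alpha>) (at_right 0)"
proof -
  let ?g = "\<lambda>x. l (1 / x) * x ^ \<alpha>"
  have 1: "((\<lambda>x. G (x / 2) / ?g (x / 2)) \<longlongrightarrow> 1) (at_right 0)"
    by (rule filterlim_compose[OF ratio_limit half_at_right])
  have 2: "((\<lambda>x. l (2 * (1 / x)) / l (1 / x)) \<longlongrightarrow> 1) (at_right 0)"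
    using slow by (intro filterlim_compose[OF _ inverse_at_right]) (auto simp: slowly_varying_def)
  have "((\<lambda>x. (G (x / 2) / ?g (x / 2)) * ((l (2 * (1 / x)) / l (1 / x)) * (1 / 2) ^ \<alpha>) / (G x / ?g x)) \<longlongrightarrow> 1 * (1 * (1 / 2) ^ \<alpha>) / 1) (at_right 0)"
    by (intro tendsto_intros 1 2 ratio_limit) simp
  then have "((\<lambda>x. (G (x / 2) / ?g (x / 2)) * ((l (2 * (1 / x)) / l (1 / x)) * (1 / 2) ^ \<alpha>) / (G x / ?g x)) \<longlongrightarrow> (1 / 2) ^ \<alpha>) (at_right 0)"
    by simp
  moreover have "\<forall>\<^sub>F x in at_right 0. (G (x / 2) / ?g (x / 2)) * ((l (2 * (1 / x)) / l (1 / x)) * (1 / 2) ^ \<alpha>) / (G x / ?g x) = G (x / 2) / G x"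
    using l_pos eventually_compose_filterlim[OF l_pos half_at_right] eventually_at_right_less[of 0] G_pos
  proof eventually_elim
    case (elim x)
    have g2: "?g (x / 2) = l (2 * (1 / x)) * (1 / 2) ^ \<alpha> * x ^ \<alpha>"
      by (simp add: power_divide)
    have gen: "a / (u * h * w) * (u / v * h) / (g / (v * w)) = a / g"
      if "u \<noteq> 0" "v \<noteq> 0" "h \<noteq> 0" "w \<noteq> 0" for a g h u v w :: real
      using that by (cases "g = 0") (simp_all add: field_simps)
    have h: "1 / (x / 2) = 2 * (1 / x)" by simp
    have "l (2 * (1 / x)) \<noteq> 0" using elim(2) unfolding h by (rule less_imp_neq[symmetric])
    moreover have "l (1 / x) \<noteq> 0" using elim(1) by (rule less_imp_neq[symmetric])
    moreover have "(1 / 2 :: real) ^ \<alpha> \<noteq> 0" by simp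
    moreover have "x ^ \<alpha> \<noteq> 0" using elim(3) by simp
    ultimately show ?case unfolding g2 by (rule gen)
  qed
  ultimately show ?thesis by (rule Lim_transform_eventually)
qed

lemma half_powr: "(1 / 2 :: real) ^ \<alpha> = 2 powr (- real \<alpha>)"
  by (simp add: powr_minus powr_realpow power_one_over inverse_eq_divide)

text \<open>The slack between \<open>p\<close> and \<alpha> absorbs the slowly varying factor: near
  zero each halving multiplies \<open>G\<close> by at most 2^(-p). The initial value is at most 1
  because \<open>\<pi>\<close> is a probability measure.\<close>

lemma halving_upper:
  assumes "p < real \<alpha>"
  obtains x0 where "x0 > 0" "\<And>k. G (x0 / 2 ^ k) \<le> 2 powr (- p * real k)"
proof -
  have "(1 / 2 :: real) ^ \<alpha> < 2 powr (- p)" using assms by (simp add: half_powr)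
  then have "\<forall>\<^sub>F x in at_right 0. G (x / 2) / G x < 2 powr (- p)"
    by (rule order_tendstoD(2)[OF halving_limit])
  then have "\<forall>\<^sub>F x in at_right 0. G (x / 2) \<le> 2 powr (- p) * G x"
    using G_pos by eventually_elim (simp add: pos_divide_less_eq)
  then obtain d where d: "d > 0" "\<And>x. 0 < x \<Longrightarrow> x < d \<Longrightarrow> G (x / 2) \<le> 2 powr (- p) * G x"
    unfolding eventually_at_right_field by auto
  define x0 where "x0 = d / 2"
  have x0: "x0 > 0" "x0 < d" using d by (simp_all add: x0_def)
  have "G (x0 / 2 ^ k) \<le> 2 powr (- p * real k)" for k
  proof (induction k)
    case 0
    then show ?case by simp
  next
    case (Suc k)
    have "x0 / 2 ^ k \<le> x0" using x0 by (simp add: divide_le_eq)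
    then have "x0 / 2 ^ k < d" using x0 by linarith
    then have "G (x0 / 2 ^ k / 2) \<le> 2 powr (- p) * G (x0 / 2 ^ k)"
      using x0 by (intro d) auto
    also have "\<dots> \<le> 2 powr (- p) * 2 powr (- p * real k)"
      using Suc by (intro mult_left_mono) auto
    also have "\<dots> = 2 powr (- p * real (Suc k))"
      unfolding powr_add[symmetric] by (simp add: algebra_simps)
    finally show ?case by (simp add: mult.commute)
  qed
  with x0(1) show thesis by (rule that)
qed

text \<open>The counterpart with the slack on the other side. The constant \<open>c\<close> is the
  initial value \<open>G x0\<close>, positive because the asymptotics force mass near zero.\<close>

lemma halving_lower:
  assumes "p > real \<alpha>"
  obtains x0 c where "x0 > 0" "c > 0" "\<And>k. c * 2 powr (- p * real k) \<le> G (x0 / 2 ^ k)"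
proof -
  have "2 powr (- p) < (1 / 2 :: real) ^ \<alpha>" using assms by (simp add: half_powr)
  then have "\<forall>\<^sub>F x in at_right 0. 2 powr (- p) < G (x / 2) / G x"
    by (rule order_tendstoD(1)[OF halving_limit])
  then have "\<forall>\<^sub>F x in at_right 0. 2 powr (- p) * G x \<le> G (x / 2) \<and> G x > 0"
    using G_pos by eventually_elim (simp add: pos_less_divide_eq)
  then obtain d where d: "d > 0" "\<And>x. 0 < x \<Longrightarrow> x < d \<Longrightarrow> 2 powr (- p) * G x \<le> G (x / 2) \<and> G x > 0"
    unfolding eventually_at_right_field by auto
  define x0 where "x0 = d / 2"
  have x0: "x0 > 0" "x0 < d" using d by (simp_all add: x0_def)
  have "G x0 * 2 powr (- p * real k) \<le> G (x0 / 2 ^ k)" for k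
  proof (induction k)
    case 0
    then show ?case by simp
  next
    case (Suc k)
    have "x0 / 2 ^ k \<le> x0" using x0 by (simp add: divide_le_eq)
    then have "x0 / 2 ^ k < d" using x0 by linarith
    then have step: "2 powr (- p) * G (x0 / 2 ^ k) \<le> G (x0 / 2 ^ k / 2)"
      using x0 d(2)[of "x0 / 2 ^ k"] by auto
    have "G x0 * 2 powr (- p * real (Suc k)) = 2 powr (- p) * (G x0 * 2 powr (- p * real k))"
    proof -
      have "2 powr (- p * real (Suc k)) = 2 powr (- p) * 2 powr (- p * real k)"
        unfolding powr_add[symmetric] by (simp add: algebra_simps)
      then show ?thesis by simp
    qed
    also have "\<dots> \<le> 2 powr (- p) * G (x0 / 2 ^ k)" using Suc by (intro mult_left_mono) auto
    also note step
    finally show ?case by (simp add: mult.commute)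
  qed
  moreover have "G x0 > 0" using d(2)[OF x0] by simp
  ultimately show thesis using x0(1) that by blast
qed

lemma dyadic_scale:
  fixes x0 y :: real
  assumes "x0 > 0" "0 < y" "y \<le> x0"
  obtains k where "x0 / 2 ^ Suc k < y" "y \<le> x0 / 2 ^ k"
proof -
  obtain n where "(1 / 2 :: real) ^ n < y / x0"
    using real_arch_pow_inv[of "y / x0" "1 / 2"] assms by auto
  then have ex: "x0 / 2 ^ n < y" using assms by (simp add: power_one_over field_simps)
  define m where "m = (LEAST n. x0 / 2 ^ n < y)"
  have m: "x0 / 2 ^ m < y" unfolding m_def using ex by (rule LeastI)
  have "m \<noteq> 0" using m assms by (intro notI) simp
  then obtain k where k: "m = Suc k" using not0_implies_Suc by blast
  have "\<not> x0 / 2 ^ k < y" using not_less_Least[of k "\<lambda>n. x0 / 2 ^ n < y"] k m_def by simp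
  with m k show thesis by (intro that[of k]) auto
qed

text \<open>Split (0, x0] into dyadic shells. On the k-th shell the integrand is at most a constant
  times 2^(p k) and the mass at most 2^(-p' k), with p' strictly between \<open>p\<close> and
  \<alpha>; a geometric series results.\<close>

lemma negative_moment_finite:
  assumes p: "0 < p" "p < real \<alpha>"
  shows "(\<integral>\<^sup>+\<xi>. ennreal (\<xi> powr (- p)) \<partial>\<pi>) < \<infinity>"
proof -
  define p' where "p' = (p + real \<alpha>) / 2"
  have p': "p < p'" "p' < real \<alpha>" using p by (auto simp: p'_def)
  obtain x0 where x0: "x0 > 0" "\<And>k. G (x0 / 2 ^ k) \<le> 2 powr (- p' * real k)"
    using halving_upper[OF p'(2)] by blast
  define a where "a k = (x0 / 2 ^ Suc k) powr (- p)" for k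
  \<comment> \<open>Each shell is enlarged to a full interval \<open>{0<..x0 / 2 ^ k}\<close>, since
    it is the mass of these intervals that \<open>halving_upper\<close> bounds.\<close>
  have pw: "ennreal (\<xi> powr (- p)) \<le> ennreal (x0 powr (- p)) + (\<Sum>k. ennreal (a k) * indicator {0<..x0 / 2 ^ k} \<xi>)"
    if \<xi>: "\<xi> > 0" for \<xi>
  proof (cases "\<xi> \<le> x0")
    case False
    then have "\<xi> powr (- p) \<le> x0 powr (- p)" using p x0 by (intro powr_mono2') auto
    then have "ennreal (\<xi> powr (- p)) \<le> ennreal (x0 powr (- p))" by (rule ennreal_leI)
    then show ?thesis by (rule order_trans) simp
  next
    case True
    obtain k where k: "x0 / 2 ^ Suc k < \<xi>" "\<xi> \<le> x0 / 2 ^ k"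
      using dyadic_scale[OF x0(1) \<xi> True] by blast
    have "\<xi> powr (- p) \<le> a k" unfolding a_def using k p x0 by (intro powr_mono2') auto
    then have "ennreal (\<xi> powr (- p)) \<le> ennreal (a k) * indicator {0<..x0 / 2 ^ k} \<xi>"
      using k \<xi> by (simp add: ennreal_leI)
    also have "\<dots> \<le> (\<Sum>k. ennreal (a k) * indicator {0<..x0 / 2 ^ k} \<xi>)"
    proof -
      have "F k \<le> suminf F" for F :: "nat \<Rightarrow> ennreal"
        using sum_le_suminf[OF summableI, of "{k}" F] by simp
      then show ?thesis .
    qed
    finally show ?thesis by (rule order_trans) simp
  qed
  define r where "r = (2::real) powr (p - p')"
  have r: "0 < r" "r < 1" using p' by (auto simp: r_def powr_less_one)
  define D where "D = x0 powr (- p) * 2 powr p"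
  have ak: "a k * 2 powr (- p' * real k) = D * r ^ k" for k
  proof -
    have "a k = x0 powr (- p) * 2 powr (p * real (Suc k))"
    proof -
      have "a k = x0 powr (- p) / (2 powr real (Suc k)) powr (- p)"
        unfolding a_def using x0(1) by (subst powr_divide) (auto simp: powr_realpow simp del: of_nat_Suc power_Suc)
      also have "(2 powr real (Suc k)) powr (- p) = 1 / 2 powr (p * real (Suc k))"
        unfolding powr_powr by (simp add: powr_minus_divide mult.commute del: of_nat_Suc)
      finally show ?thesis by simp
    qed
    also have "2 powr (p * real (Suc k)) = 2 powr p * 2 powr (p * real k)"
      unfolding powr_add[symmetric] by (simp add: algebra_simps)
    finally have "a k * 2 powr (- p' * real k) = D * (2 powr (p * real k) * 2 powr (- p' * real k))"
      by (simp add: D_def)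
    also have "2 powr (p * real k) * 2 powr (- p' * real k) = r ^ k"
    proof -
      have "r ^ k = 2 powr ((p - p') * real k)"
        using powr_realpow[OF r(1), of k] by (simp add: r_def powr_powr)
      then show ?thesis unfolding powr_add[symmetric] by (simp add: algebra_simps)
    qed
    finally show ?thesis .
  qed
  have "(\<integral>\<^sup>+\<xi>. ennreal (\<xi> powr (- p)) \<partial>\<pi>) \<le> (\<integral>\<^sup>+\<xi>. ennreal (x0 powr (- p)) + (\<Sum>k. ennreal (a k) * indicator {0<..x0 / 2 ^ k} \<xi>) \<partial>\<pi>)"
    using pi_pos by (intro nn_integral_mono_AE) (auto elim!: eventually_mono dest: pw)
  also have "\<dots> = ennreal (x0 powr (- p)) + (\<Sum>k. ennreal (a k) * emeasure \<pi> {0<..x0 / 2 ^ k})"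
    by (subst nn_integral_add, measurable) (subst nn_integral_suminf, measurable, simp add: emeasure_space_1 nn_integral_cmult_indicator)
  also have "\<dots> \<le> ennreal (x0 powr (- p)) + (\<Sum>k. ennreal (D * r ^ k))"
  proof (intro add_left_mono suminf_le)
    fix k
    have "a k * G (x0 / 2 ^ k) \<le> a k * 2 powr (- p' * real k)"
      by (intro mult_left_mono x0(2)) (simp add: a_def)
    then have "a k * G (x0 / 2 ^ k) \<le> D * r ^ k" by (simp only: ak)
    moreover have "a k \<ge> 0" by (simp add: a_def)
    ultimately show "ennreal (a k) * emeasure \<pi> {0<..x0 / 2 ^ k} \<le> ennreal (D * r ^ k)"
      by (simp add: emeasure_eq_measure ennreal_mult[symmetric] ennreal_leI)
  qed auto
  also have "(\<Sum>k. ennreal (D * r ^ k)) = ennreal (\<Sum>k. D * r ^ k)"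
    using r by (intro suminf_ennreal2 summable_mult summable_geometric) (auto simp: D_def)
  also have "ennreal (x0 powr (- p)) + \<dots> < \<infinity>" by simp
  finally show ?thesis .
qed

text \<open>Every small 1 / t lies in a dyadic shell, and monotonicity of \<open>G\<close> passes
  from the lower end of the shell to 1 / t at the cost of a constant factor.\<close>

lemma G_lower:
  assumes e: "e > 0"
  obtains c T where "c > 0" "T \<ge> 1" "\<And>t. t \<ge> T \<Longrightarrow> c * t powr (- (real \<alpha> + e)) \<le> G (1 / t)"
proof -
  define p where "p = real \<alpha> + e"
  have p: "p > real \<alpha>" "p > 0" using e by (auto simp: p_def)
  obtain x0 c where x0: "x0 > 0" "c > 0" "\<And>k. c * 2 powr (- p * real k) \<le> G (x0 / 2 ^ k)"
    using halving_lower[OF p(1)] by blast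
  define T where "T = max 1 (1 / x0)"
  show thesis
  proof (rule that[of "c * (2 * x0) powr (- p)" T])
    show "c * (2 * x0) powr (- p) > 0" using x0 by simp
    fix t assume t: "t \<ge> T"
    then have t1: "t \<ge> 1" "1 / x0 \<le> t" by (auto simp: T_def)
    then have tx: "0 < 1 / t" "1 / t \<le> x0" using x0(1) by (auto simp: field_simps)
    obtain k where k: "x0 / 2 ^ Suc k < 1 / t" "1 / t \<le> x0 / 2 ^ k"
      using dyadic_scale[OF x0(1) tx] by blast
    have "2 ^ k * 2 \<le> 2 * x0 * t" using k(2) t1 x0(1) by (simp add: field_simps)
    then have "2 powr real (Suc k) \<le> 2 * x0 * t" by (simp add: powr_realpow del: of_nat_Suc)
    then have "(2 * x0 * t) powr (- p) \<le> (2 powr real (Suc k)) powr (- p)"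
      using p by (intro powr_mono2') auto
    also have "\<dots> = 2 powr (- p * real (Suc k))" by (simp add: powr_powr mult.commute del: of_nat_Suc)
    finally have "c * (2 * x0 * t) powr (- p) \<le> c * 2 powr (- p * real (Suc k))" using x0 by (intro mult_left_mono) auto
    also have "\<dots> \<le> G (x0 / 2 ^ Suc k)" by (rule x0(3))
    also have "\<dots> \<le> G (1 / t)" using k(1) by (intro G_mono) simp
    finally show "c * (2 * x0) powr (- p) * t powr (- (real \<alpha> + e)) \<le> G (1 / t)"
      using x0(1) t1 by (simp add: powr_mult p_def mult.assoc)
  qed (simp add: T_def)
qed

section \<open>Growth of the kernel moments\<close>

definition "J n t = (\<integral>x. ou_kernel t x ^ n \<partial>C)"

lemma J_nonneg: "J n t \<ge> 0"
  unfolding J_def by (intro integral_nonneg_AE AE_I2) simp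

lemma J_nn:
  assumes "t \<ge> 0" "n > 0" shows "(\<integral>\<^sup>+x. ennreal (ou_kernel t x ^ n) \<partial>C) = ennreal (J n t)"
  unfolding J_def using integrable_ou_kernel_power[OF assms(1), of "n - 1"] assms(2)
  by (intro nn_integral_eq_integral) auto

text \<open>Of the power n - 1 of min t (1 / \<xi>), a part \<open>p\<close> is spent on 1 / \<xi>
  and the rest on \<open>t\<close>. Finiteness of the negative moment of order
  \<open>p < \<alpha>\<close> then gives growth of order n - p.\<close>

lemma J_upper:
  assumes n: "n \<ge> 2"
  shows "power_bounded (J n) (max 1 (real n - real \<alpha>))"
  unfolding power_bounded_def
proof (intro allI impI)
  fix e :: real assume e: "e > 0"
  \<comment> \<open>As large as possible: n - 1 if that is small enough, which gives linear growth,
    and otherwise just below \<alpha>. The cap 1 / 2 keeps \<open>p\<close> positive for large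
    \<open>e\<close>.\<close>
  define p where "p = min (real n - 1) (real \<alpha> - min e (1 / 2))"
  have p: "0 < p" "p < real \<alpha>" "p \<le> real n - 1" "real n - p \<le> max 1 (real n - real \<alpha>) + e"
    using n alpha e by (auto simp: p_def min_def max_def)
  obtain Q where Q: "Q \<ge> 0" "(\<integral>\<^sup>+\<xi>. ennreal (\<xi> powr (- p)) \<partial>\<pi>) = ennreal Q"
    using negative_moment_finite[OF p(1,2)] by (metis ennreal_cases infinity_ennreal_def less_irrefl)
  have "\<bar>J n t\<bar> \<le> Q * t powr (max 1 (real n - real \<alpha>) + e)" if t: "t \<ge> 1" for t
  proof -
    have pw: "min t (1 / \<xi>) ^ (n - 1) \<le> t powr (real n - 1 - p) * \<xi> powr (- p)" if \<xi>: "\<xi> > 0" for \<xi>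
    proof -
      let ?m = "min t (1 / \<xi>)"
      have m: "?m > 0" using t \<xi> by simp
      have "?m ^ (n - 1) = ?m powr (real n - 1)"
        using n m by (simp add: powr_realpow[symmetric] of_nat_diff)
      also have "\<dots> = ?m powr (real n - 1 - p) * ?m powr p" unfolding powr_add[symmetric] by simp
      also have "\<dots> \<le> t powr (real n - 1 - p) * (1 / \<xi>) powr p"
        using m p by (intro mult_mono powr_mono2) auto
      also have "(1 / \<xi>) powr p = \<xi> powr (- p)"
        using \<xi> by (simp add: powr_divide powr_minus_divide)
      finally show ?thesis .
    qed
    have "ennreal (J n t) = (\<integral>\<^sup>+x. ennreal (ou_kernel t x ^ Suc (n - 1)) \<partial>C)"
      using t n J_nn[of t n] by simp
    also have "\<dots> \<le> ennreal t * (\<integral>\<^sup>+\<xi>. ennreal (min t (1 / \<xi>) ^ (n - 1)) \<partial>\<pi>)"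
      using t by (intro ou_moment_upper) simp
    also have "\<dots> \<le> ennreal t * (\<integral>\<^sup>+\<xi>. ennreal (t powr (real n - 1 - p)) * ennreal (\<xi> powr (- p)) \<partial>\<pi>)"
      using pi_pos pw by (intro mult_left_mono nn_integral_mono_AE) (auto elim!: eventually_mono simp: ennreal_mult[symmetric] ennreal_leI)
    also have "\<dots> = ennreal (t * (t powr (real n - 1 - p) * Q))"
      using t Q by (subst nn_integral_cmult) (auto simp: ennreal_mult)
    also have "t * (t powr (real n - 1 - p) * Q) = Q * t powr (real n - p)"
    proof -
      have "t * (t powr (real n - 1 - p) * Q) = Q * (t powr 1 * t powr (real n - 1 - p))" using t by simp
      then show ?thesis unfolding powr_add[symmetric] by simp
    qed
    finally have "J n t \<le> Q * t powr (real n - p)"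
      using Q by (simp add: ennreal_le_iff)
    also have "\<dots> \<le> Q * t powr (max 1 (real n - real \<alpha>) + e)"
      using p t Q by (intro mult_left_mono powr_mono) auto
    finally show ?thesis using J_nonneg[of n t] by simp
  qed
  then show "\<exists>B. \<forall>t\<ge>1. \<bar>J n t\<bar> \<le> B * t powr (max 1 (real n - real \<alpha>) + e)" by blast
qed

lemma J_lower:
  assumes n: "n > 0" and e: "e > 0"
  shows "\<exists>c>0. \<forall>\<^sub>F t in at_top. c * t powr (real n - real \<alpha> - e) \<le> J n t"
proof -
  obtain c T where c: "c > 0" "T \<ge> 1" "\<And>t. t \<ge> T \<Longrightarrow> c * t powr (- (real \<alpha> + e)) \<le> G (1 / t)"
    using G_lower[OF e] by blast
  show ?thesis
  proof (intro exI conjI)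
    show "exp (- 2 * real n) * c > 0" using c by simp
    show "\<forall>\<^sub>F t in at_top. exp (- 2 * real n) * c * t powr (real n - real \<alpha> - e) \<le> J n t"
      using eventually_ge_at_top[of T]
    proof eventually_elim
      case (elim t)
      have t: "t > 0" using elim c by simp
      have "t powr (real n - real \<alpha> - e) = t ^ n * t powr (- (real \<alpha> + e))"
        using t by (simp add: powr_realpow[symmetric] powr_add[symmetric] algebra_simps)
      then have "exp (- 2 * real n) * c * t powr (real n - real \<alpha> - e) = exp (- 2 * real n) * t ^ n * (c * t powr (- (real \<alpha> + e)))"
        by (simp add: mult_ac)
      also have "\<dots> \<le> exp (- 2 * real n) * t ^ n * G (1 / t)"
        using t c(3)[OF elim] by (intro mult_left_mono) auto
      finally have "ennreal (exp (- 2 * real n) * c * t powr (real n - real \<alpha> - e)) \<le> ennreal (exp (- 2 * real n) * t ^ n * G (1 / t))"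
        by (rule ennreal_leI)
      also have "\<dots> \<le> ennreal (J n t)"
        using ou_moment_lower[OF t, of n] J_nn[of t n] t n by simp
      finally show ?case using J_nonneg by (simp add: ennreal_le_iff)
    qed
  qed
qed

lemma J_2_lower: "\<exists>c>0. \<forall>\<^sub>F t in at_top. c * t \<le> J 2 t"
proof -
  obtain c where c: "c > 0" "\<And>t. t \<ge> 1 \<Longrightarrow> ennreal (c * (t - 1)) \<le> (\<integral>\<^sup>+x. ennreal (ou_kernel t x ^ 2) \<partial>C)"
    using ou_second_moment_lower by blast
  have "c / 2 * t \<le> J 2 t" if t: "t \<ge> 2" for t
  proof -
    have "ennreal (c * (t - 1)) \<le> ennreal (J 2 t)" using c(2)[of t] J_nn[of t 2] t by simp
    then have "c * (t - 1) \<le> J 2 t" using J_nonneg by (simp add: ennreal_le_iff)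
    moreover have "c / 2 * t \<le> c * (t - 1)" using c t by (simp add: field_simps)
    ultimately show ?thesis by linarith
  qed
  then show ?thesis
    using c(1) by (intro exI[of _ "c / 2"]) (auto simp: eventually_at_top_linorder)
qed

end

section \<open>Scaling of moments\<close>

locale supOU_asymptotics = supOU_setting + reg: regularly_varying_ou_measure \<pi> l \<alpha> for l \<alpha> +
  fixes K :: "real \<Rightarrow> complex"
  assumes cumulant: "is_cumulant_function M (X 1) K" and analytic: "analytic_near_zero K"
    and nondegenerate: "variance (X 1) \<noteq> 0"
begin

abbreviation "Y t \<equiv> integrated_process X t"

definition "cumul k t = cx.levy_cumulant k * reg.J k t"

text \<open>Insert \<open>\<zeta> * ou_kernel t x\<close> into the expansion of \<kappa>, whose
  remainder bound is global, and integrate term by term.\<close>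

lemma cumul_expansion:
  assumes t: "t \<ge> 0" and N: "N > 0"
  shows "\<exists>B. \<forall>\<zeta>. norm ((CLINT x|ou.C. \<kappa> (\<zeta> * ou_kernel t x)) -
    (\<Sum>k=1..N. of_real (cumul k t) * (\<i> * of_real \<zeta>) ^ k / fact k)) \<le> B * \<bar>\<zeta>\<bar> ^ Suc N"
proof -
  obtain B where B: "B \<ge> 0" "\<And>\<zeta>. norm (\<kappa> \<zeta> - (\<Sum>k=1..N. of_real (cx.levy_cumulant k) * (\<i> * of_real \<zeta>) ^ k / fact k)) \<le> B * \<bar>\<zeta>\<bar> ^ Suc N"
    using cx.exponent_expansion[OF moments_mu[OF cumulant analytic] N] by blast
  have ip: "integrable ou.C (\<lambda>x. ou_kernel t x ^ k)" if "k > 0" for k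
    using ou.integrable_ou_kernel_power[OF t, of "k - 1"] that by simp
  have "norm ((CLINT x|ou.C. \<kappa> (\<zeta> * ou_kernel t x)) -
    (\<Sum>k=1..N. of_real (cumul k t) * (\<i> * of_real \<zeta>) ^ k / fact k)) \<le> (B * reg.J (Suc N) t) * \<bar>\<zeta>\<bar> ^ Suc N" for \<zeta>
  proof -
    let ?a = "\<lambda>k. of_real (cx.levy_cumulant k) * (\<i> * of_real \<zeta>) ^ k / fact k"
    let ?T = "\<lambda>k x. ?a k * of_real (ou_kernel t x ^ k)"
    have iT: "integrable ou.C (?T k)" if "k \<in> {1..N}" for k
      using that by (intro integrable_mult_right integrable_of_real ip) auto
    have sT: "(CLINT x|ou.C. (\<Sum>k=1..N. ?T k x)) = (\<Sum>k=1..N. of_real (cumul k t) * (\<i> * of_real \<zeta>) ^ k / fact k)"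
    proof -
      have "(CLINT x|ou.C. (\<Sum>k=1..N. ?T k x)) = (\<Sum>k=1..N. (CLINT x|ou.C. ?T k x))"
        by (rule Bochner_Integration.integral_sum) (rule iT)
      also have "\<dots> = (\<Sum>k=1..N. of_real (cumul k t) * (\<i> * of_real \<zeta>) ^ k / fact k)"
        unfolding integral_mult_right_zero integral_complex_of_real
        by (intro sum.cong refl) (simp add: cumul_def reg.J_def)
      finally show ?thesis .
    qed
    have isum: "integrable ou.C (\<lambda>x. \<Sum>k=1..N. ?T k x)"
      by (rule Bochner_Integration.integrable_sum) (rule iT)
    have i\<kappa>: "integrable ou.C (\<lambda>x. \<kappa> (\<zeta> * ou_kernel t x))"
      by (rule cx.exponent_integrable(1)[OF continuous_exponent ou.ou_kernel_measurable ou_kernel_L2[OF t]])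
    have ib: "integrable ou.C (\<lambda>x. B * \<bar>\<zeta>\<bar> ^ Suc N * ou_kernel t x ^ Suc N)"
      by (intro integrable_mult_right ip) simp
    have b: "norm (\<kappa> (\<zeta> * ou_kernel t x) - (\<Sum>k=1..N. ?T k x)) \<le> B * \<bar>\<zeta>\<bar> ^ Suc N * ou_kernel t x ^ Suc N" for x
    proof -
      have "(\<Sum>k=1..N. ?T k x) = (\<Sum>k=1..N. of_real (cx.levy_cumulant k) * (\<i> * of_real (\<zeta> * ou_kernel t x)) ^ k / fact k)"
        by (intro sum.cong refl) (simp add: power_mult_distrib)
      then show ?thesis
        using B(2)[of "\<zeta> * ou_kernel t x"]
        by (simp only: abs_mult power_mult_distrib abs_of_nonneg[OF ou.ou_kernel_nonneg] mult.assoc)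
    qed
    have "norm ((CLINT x|ou.C. \<kappa> (\<zeta> * ou_kernel t x)) - (CLINT x|ou.C. (\<Sum>k=1..N. ?T k x))) =
        norm (CLINT x|ou.C. \<kappa> (\<zeta> * ou_kernel t x) - (\<Sum>k=1..N. ?T k x))"
      by (subst Bochner_Integration.integral_diff[OF i\<kappa> isum]) simp
    also have "\<dots> \<le> (\<integral>x. norm (\<kappa> (\<zeta> * ou_kernel t x) - (\<Sum>k=1..N. ?T k x)) \<partial>ou.C)"
      by (rule integral_norm_bound)
    also have "\<dots> \<le> (\<integral>x. B * \<bar>\<zeta>\<bar> ^ Suc N * ou_kernel t x ^ Suc N \<partial>ou.C)"
      by (rule integral_mono[OF integrable_norm[OF Bochner_Integration.integrable_diff[OF i\<kappa> isum]] ib b])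
    also have "\<dots> = (B * reg.J (Suc N) t) * \<bar>\<zeta>\<bar> ^ Suc N"
      by (simp add: reg.J_def del: power_Suc)
    finally show ?thesis unfolding sT .
  qed
  then show ?thesis by blast
qed

lemma moments_integrated:
  assumes t: "t \<ge> 0"
  shows "integrable M (\<lambda>\<omega>. Y t \<omega> ^ n)" "expectation (\<lambda>\<omega>. Y t \<omega> ^ n) = moment_of_cumulants (\<lambda>k. cumul k t) n"
proof -
  have ch: "char (distr M borel (Y t)) \<zeta> = exp (CLINT x|ou.C. \<kappa> (\<zeta> * ou_kernel t x))" for \<zeta>
    using char_integrated_combination[of "{t}" "\<lambda>_. 1" \<zeta>] t by simp
  have ex: "\<exists>B. \<forall>\<^sub>F \<zeta> in nhds 0. norm ((CLINT x|ou.C. \<kappa> (\<zeta> * ou_kernel t x)) -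
      (\<Sum>k=1..N. of_real (cumul k t) * (\<i> * of_real \<zeta>) ^ k / fact k)) \<le> B * \<bar>\<zeta>\<bar> ^ Suc N" if "N > 0" for N
    using cumul_expansion[OF t that] by (meson always_eventually)
  show "integrable M (\<lambda>\<omega>. Y t \<omega> ^ n)" "expectation (\<lambda>\<omega>. Y t \<omega> ^ n) = moment_of_cumulants (\<lambda>k. cumul k t) n"
    using moments_eq_moment_of_cumulants[OF integrated_measurable ch ex] by blast+
qed

text \<open>Otherwise \<open>moment_const\<close>, and with it the second moment of
  \<open>X 1\<close>, would vanish, against nondegeneracy.\<close>

lemma levy_var_pos: "sq.levy_var > 0"
proof (rule ccontr)
  assume "\<not> sq.levy_var > 0"
  then have "sq.levy_var = 0" using sq.levy_var_nonneg by simp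
  then have "moment_const = 0" by (simp add: moment_const_def)
  then have "(\<integral>\<^sup>+\<omega>. ennreal ((X 1 \<omega>)\<^sup>2) \<partial>M) = 0" using nn_integral_X_square[of 1] by simp
  then have "AE \<omega> in M. ennreal ((X 1 \<omega>)\<^sup>2) = 0" by (subst (asm) nn_integral_0_iff_AE) auto
  then have "AE \<omega> in M. (X 1 \<omega>)\<^sup>2 = 0" by eventually_elim (simp add: ennreal_eq_0_iff)
  then have "expectation (\<lambda>\<omega>. (X 1 \<omega>)\<^sup>2) = 0" by (rule integral_eq_zero_AE)
  then show False using nondegenerate by (simp add: mean0)
qed

lemma cumul_1: "cumul 1 t = 0"
  by (simp add: cumul_def cx.levy_cumulant_def)

lemma second_moment: "t \<ge> 0 \<Longrightarrow> expectation (\<lambda>\<omega>. (Y t \<omega>)\<^sup>2) = sq.levy_var * reg.J 2 t"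
  using moments_integrated(2)[of t 2] cumul_1[of t]
  by (simp add: numeral_2_eq_2 cumul_def cx.levy_cumulant_2[unfolded numeral_2_eq_2])

text \<open>The case \<open>q = 0\<close> is the logarithm of the total mass. The general formula
  would give that of the probability of \<open>Y t\<close> being nonzero, because
  \<open>0 powr 0 = 0\<close>.\<close>

definition "logm t q = (if q = 0 then 0 else ln (expectation (\<lambda>\<omega>. \<bar>Y t \<omega>\<bar> powr q)))"

lemma abs_powr_even:
  assumes "m > 0"
  shows "\<bar>Y t \<omega>\<bar> powr real (2 * m) = Y t \<omega> ^ (2 * m)"
proof (cases "Y t \<omega> = 0")
  case False
  then have "\<bar>Y t \<omega>\<bar> powr real (2 * m) = \<bar>Y t \<omega>\<bar> ^ (2 * m)" by (subst powr_realpow) auto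
  then show ?thesis by (simp only: power_even_abs[OF dvd_triv_left])
qed (use assms in simp)

lemma integrable_abs_powr:
  assumes "t \<ge> 0" "q > 0"
  shows "integrable M (\<lambda>\<omega>. \<bar>Y t \<omega>\<bar> powr q)"
proof -
  obtain m :: nat where m: "q \<le> real m" using real_arch_simple by blast
  have i: "integrable M (\<lambda>\<omega>. 1 + Y t \<omega> ^ (2 * m))"
    by (intro Bochner_Integration.integrable_add moments_integrated assms) simp
  show ?thesis
  proof (rule Bochner_Integration.integrable_bound[OF i])
    have "\<bar>y\<bar> powr q \<le> 1 + y ^ (2 * m)" for y :: real
    proof (cases "\<bar>y\<bar> \<le> 1")
      case True
      then have "\<bar>y\<bar> powr q \<le> 1" using assms by (cases "y = 0") (auto intro!: powr_le1)
      moreover have "0 \<le> y ^ (2 * m)" by (rule zero_le_even_power) simp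
      ultimately show ?thesis by linarith
    next
      case False
      then have "\<bar>y\<bar> powr q \<le> \<bar>y\<bar> powr real (2 * m)" using m by (intro powr_mono) auto
      also have "\<dots> = \<bar>y\<bar> ^ (2 * m)" using False by (subst powr_realpow) auto
      also have "\<dots> = y ^ (2 * m)" by (simp only: power_even_abs[OF dvd_triv_left])
      finally show ?thesis by linarith
    qed
    then show "AE \<omega> in M. norm (\<bar>Y t \<omega>\<bar> powr q) \<le> norm (1 + Y t \<omega> ^ (2 * m))"
      by (intro AE_I2) (simp add: order_trans[OF _ abs_ge_self])
  qed measurable
qed

lemma J_2_pos: "\<forall>\<^sub>F t in at_top. reg.J 2 t > 0"
proof -
  obtain c where c: "c > 0" "\<forall>\<^sub>F t in at_top. c * t \<le> reg.J 2 t" using reg.J_2_lower by blast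
  show ?thesis
    using c(2) eventually_gt_at_top[of 0]
  proof eventually_elim
    case (elim t)
    then show ?case using c(1) by (intro less_le_trans[OF _ elim(1)]) simp
  qed
qed

lemma abs_moment_pos:
  assumes t: "t \<ge> 0" "reg.J 2 t > 0" and q: "q > 0"
  shows "expectation (\<lambda>\<omega>. \<bar>Y t \<omega>\<bar> powr q) > 0"
proof -
  have "expectation (\<lambda>\<omega>. \<bar>Y t \<omega>\<bar> powr q) \<noteq> 0"
  proof
    assume "expectation (\<lambda>\<omega>. \<bar>Y t \<omega>\<bar> powr q) = 0"
    then have "AE \<omega> in M. \<bar>Y t \<omega>\<bar> powr q = 0"
      using integral_nonneg_eq_0_iff_AE[OF integrable_abs_powr[OF t(1) q]] by simp
    then have "AE \<omega> in M. (Y t \<omega>)\<^sup>2 = 0" by eventually_elim simp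
    then have "expectation (\<lambda>\<omega>. (Y t \<omega>)\<^sup>2) = 0" by (rule integral_eq_zero_AE)
    then show False using second_moment[OF t(1)] t(2) levy_var_pos by simp
  qed
  moreover have "expectation (\<lambda>\<omega>. \<bar>Y t \<omega>\<bar> powr q) \<ge> 0" by (intro integral_nonneg_AE) auto
  ultimately show ?thesis by linarith
qed

lemma log_moments_convex: "\<forall>\<^sub>F t in at_top. convex_on {0..} (logm t)"
  using J_2_pos eventually_ge_at_top[of 0]
proof eventually_elim
  case (elim t)
  show ?case
    unfolding logm_def[abs_def]
    by (rule log_moment_convex) (use elim abs_moment_pos integrable_abs_powr in auto)
qed

lemma scaling_iff:
  assumes "q > 0"
  shows "has_scaling_exponent M (integrated_process X) q \<tau> \<longleftrightarrow> ((\<lambda>t. logm t q / ln t) \<longlongrightarrow> \<tau>) at_top"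
  using assms by (simp add: has_scaling_exponent_def logm_def)

lemma logm_even:
  assumes "m > 0" "t \<ge> 0"
  shows "logm t (real (2 * m)) = ln (moment_of_cumulants (\<lambda>k. cumul k t) (2 * m))"
  using assms moments_integrated(2)[of t "2 * m"] abs_powr_even[OF assms(1), of t]
  by (simp add: logm_def del: of_nat_mult)

text \<open>The second moment is the Levy variance times \<open>J 2 t\<close>. As \<alpha> is an
  integer above 1, 2 - \<alpha> is at most 0, so \<open>J 2\<close> has exponent 1 from above;
  \<open>J_2_lower\<close> matches it from below.\<close>

lemma logm_2_limit: "((\<lambda>t. logm t 2 / ln t) \<longlongrightarrow> 1) at_top"
proof -
  have ev: "\<forall>\<^sub>F t in at_top. ln (sq.levy_var * reg.J 2 t) / ln t = logm t 2 / ln t"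
    using eventually_ge_at_top[of 0]
  proof eventually_elim
    case (elim t)
    have "expectation (\<lambda>\<omega>. \<bar>Y t \<omega>\<bar> powr 2) = expectation (\<lambda>\<omega>. (Y t \<omega>)\<^sup>2)"
      using abs_powr_even[of 1 t] by simp
    then show ?case using second_moment[OF elim] by (simp add: logm_def)
  qed
  have "((\<lambda>t. ln (sq.levy_var * reg.J 2 t) / ln t) \<longlongrightarrow> 1) at_top"
  proof (rule log_ratio_limit)
    fix e :: real assume e: "e > 0"
    have "power_bounded (\<lambda>t. sq.levy_var * reg.J 2 t) 1"
      using reg.J_upper[of 2] reg.alpha by (intro power_bounded_cmult) (simp add: max_def)
    then obtain B where "\<And>t. t \<ge> 1 \<Longrightarrow> \<bar>sq.levy_var * reg.J 2 t\<bar> \<le> B * t powr (1 + e)"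
      using e unfolding power_bounded_def by blast
    then show "\<exists>B. \<forall>\<^sub>F t in at_top. sq.levy_var * reg.J 2 t \<le> B * t powr (1 + e)"
      by (intro exI[of _ B] eventually_at_top_linorderI[of 1]) (blast intro: order_trans[OF abs_ge_self])
    obtain c where c: "c > 0" "\<forall>\<^sub>F t in at_top. c * t \<le> reg.J 2 t" using reg.J_2_lower by blast
    show "\<exists>c>0. \<forall>\<^sub>F t in at_top. c * t powr (1 - e) \<le> sq.levy_var * reg.J 2 t"
    proof (intro exI conjI)
      show "sq.levy_var * c > 0" using c levy_var_pos by simp
      show "\<forall>\<^sub>F t in at_top. sq.levy_var * c * t powr (1 - e) \<le> sq.levy_var * reg.J 2 t"
        using c(2) eventually_ge_at_top[of 1]
      proof eventually_elim
        case (elim t)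
        have "t powr (1 - e) \<le> t powr 1" using elim e by (intro powr_mono) auto
        then have "c * t powr (1 - e) \<le> c * t" using c elim by (intro mult_left_mono) auto
        then have "c * t powr (1 - e) \<le> reg.J 2 t" using elim by linarith
        then show ?case using levy_var_pos by (simp add: mult.assoc)
      qed
    qed
  qed
  then show ?thesis by (rule Lim_transform_eventually[OF _ ev])
qed

text \<open>Where the exponent is \<open>m\<close>, convexity through \<open>(0, 0)\<close> supplies the lower bound.\<close>

lemma logm_linear_limit:
  assumes m: "m > 0" and ub: "power_bounded (\<lambda>t. moment_of_cumulants (\<lambda>k. cumul k t) (2 * m)) (real m)"
  shows "((\<lambda>t. logm t (real (2 * m)) / ln t) \<longlongrightarrow> real m) at_top"
proof (rule order_tendstoI)
  fix y assume y: "y < real m"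
  have "((\<lambda>t. real m * (logm t 2 / ln t)) \<longlongrightarrow> real m * 1) at_top"
    by (intro tendsto_intros logm_2_limit)
  then have "\<forall>\<^sub>F t in at_top. y < real m * (logm t 2 / ln t)"
    using y by (intro order_tendstoD(1)) auto
  then show "\<forall>\<^sub>F t in at_top. y < logm t (real (2 * m)) / ln t"
    using log_moments_convex eventually_gt_at_top[of 1]
  proof eventually_elim
    case (elim t)
    \<comment> \<open>Convexity between the orders 0 and \<open>2 * m\<close>: the order 2 sits at
      the fraction 1 / m of the way.\<close>
    have "logm t ((1 - 1 / real m) *\<^sub>R 0 + (1 / real m) *\<^sub>R real (2 * m)) \<le> (1 - 1 / real m) * logm t 0 + 1 / real m * logm t (real (2 * m))"
      using m by (intro convex_onD[OF elim(2)]) auto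
    moreover have "(1 - 1 / real m) *\<^sub>R 0 + (1 / real m) *\<^sub>R real (2 * m) = 2" using m by simp
    ultimately have "real m * logm t 2 \<le> logm t (real (2 * m))"
      using m by (simp add: logm_def[of t 0] pos_le_divide_eq mult.commute del: of_nat_mult)
    then have "real m * (logm t 2 / ln t) \<le> logm t (real (2 * m)) / ln t"
      using elim(3) by (simp add: divide_right_mono del: of_nat_mult)
    then show ?case using elim(1) by linarith
  qed
next
  fix y assume y: "real m < y"
  let ?f = "\<lambda>t. moment_of_cumulants (\<lambda>k. cumul k t) (2 * m)"
  have "\<forall>\<^sub>F t in at_top. 0 < ?f t"
    using J_2_pos eventually_ge_at_top[of 0]
  proof eventually_elim
    case (elim t)
    show ?case
      using abs_moment_pos[OF elim(2,1), of "real (2 * m)"] m moments_integrated(2)[OF elim(2), of "2 * m"]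
      unfolding abs_powr_even[OF m] by simp
  qed
  then have "\<forall>\<^sub>F t in at_top. ln (?f t) / ln t < y"
  proof (rule log_ratio_upper[OF _ _ y])
    fix e :: real assume "e > 0"
    then obtain B where "\<And>t. t \<ge> 1 \<Longrightarrow> \<bar>?f t\<bar> \<le> B * t powr (real m + e)"
      using ub unfolding power_bounded_def by blast
    then show "\<exists>B. \<forall>\<^sub>F t in at_top. ?f t \<le> B * t powr (real m + e)"
      by (intro exI[of _ B] eventually_at_top_linorderI[of 1]) (blast intro: order_trans[OF abs_ge_self])
  qed
  then show "\<forall>\<^sub>F t in at_top. logm t (real (2 * m)) / ln t < y"
    using eventually_ge_at_top[of 0] by eventually_elim (use m in \<open>simp add: logm_even del: of_nat_mult\<close>)
qed

text \<open>Only the second cumulant survives, with exponent 1. So k / 2 serves as exponent for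
  cumulants and moments alike, and superadditivity is an equality.\<close>

lemma gaussian_upper:
  assumes "\<mu> = null_measure borel"
  shows "power_bounded (\<lambda>t. moment_of_cumulants (\<lambda>k. cumul k t) n) (real n / 2)"
proof (rule power_bounded_moment_of_cumulants[where d = "\<lambda>k. real k / 2" and c = cumul])
  fix k :: nat assume k: "k \<ge> 2"
  show "power_bounded (cumul k) (real k / 2)"
  proof (cases "k = 2")
    case True
    have "power_bounded (\<lambda>t. cx.levy_cumulant 2 * reg.J 2 t) 1"
      using reg.J_upper[of 2] reg.alpha by (intro power_bounded_cmult) (simp add: max_def)
    then show ?thesis by (simp add: True cumul_def[abs_def])
  next
    case False
    then have "cx.levy_cumulant k = 0" using k by (simp add: cx.levy_cumulant_def) (simp add: assms)
    then show ?thesis by (simp add: cumul_def[abs_def] power_bounded_0)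
  qed
qed (auto simp: cumul_1[simplified] field_simps)

lemma cumul_bounded: "k \<ge> 2 \<Longrightarrow> power_bounded (cumul k) (max 1 (real k - real \<alpha>))"
  unfolding cumul_def[abs_def] by (intro power_bounded_cmult reg.J_upper)

text \<open>Of the four combinations on the left, 1 + j / 2 is at most (k + j) / 2 because
  \<open>k \<ge> 2\<close>, and the other three are at most k + j - \<alpha>.\<close>

lemma exponent_superadditive:
  "k \<ge> 2 \<Longrightarrow> max 1 (real k - real \<alpha>) + max (real j / 2) (real j - real \<alpha>) \<le> max (real (k + j) / 2) (real (k + j) - real \<alpha>)"
  by (auto simp: max_def field_simps)

lemma general_upper: "power_bounded (\<lambda>t. moment_of_cumulants (\<lambda>k. cumul k t) n) (max (real n / 2) (real n - real \<alpha>))"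
  by (rule power_bounded_moment_of_cumulants[where d = "\<lambda>k. max 1 (real k - real \<alpha>)" and c = cumul])
     (use cumul_bounded exponent_superadditive in \<open>auto simp: cumul_1[simplified]\<close>)

text \<open>\<open>\<mu>\<close> does not charge 0, so a vanishing even moment would make it null.
  From order four on the Gaussian part adds nothing to the cumulant.\<close>

lemma even_moment_mu_pos:
  assumes "\<mu> \<noteq> null_measure borel" "m > 1"
  shows "cx.levy_cumulant (2 * m) > 0"
proof -
  have i: "integrable \<mu> (\<lambda>x. x ^ (2 * m))"
    using assms by (intro moments_mu[OF cumulant analytic]) auto
  have "(\<integral>x. x ^ (2 * m) \<partial>\<mu>) \<noteq> 0"
  proof
    assume "(\<integral>x. x ^ (2 * m) \<partial>\<mu>) = 0"
    then have "AE x in \<mu>. x ^ (2 * m) = 0"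
      using integral_nonneg_eq_0_iff_AE[OF i] by (auto simp: zero_le_even_power)
    then have "AE x in \<mu>. x = 0" by eventually_elim simp
    moreover have "AE x in \<mu>. x \<noteq> 0"
      using lx.null_0 by (intro AE_I'[of "{0}"]) auto
    ultimately have "AE x in \<mu>. False" by eventually_elim simp
    then have "emeasure \<mu> (space \<mu>) = 0" by (simp add: AE_iff_measurable[OF sets.top])
    then have "emeasure \<mu> A = 0" if "A \<in> sets borel" for A
      using emeasure_mono[of A "space \<mu>" \<mu>] by simp
    then have "\<mu> = null_measure borel"
      by (intro measure_eqI) auto
    with assms show False by simp
  qed
  moreover have "(\<integral>x. x ^ (2 * m) \<partial>\<mu>) \<ge> 0"
    by (intro integral_nonneg_AE AE_I2 zero_le_even_power) simp
  ultimately have "(\<integral>x. x ^ (2 * m) \<partial>\<mu>) > 0" by linarith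
  then show ?thesis using assms(2) by (simp add: cx.levy_cumulant_def)
qed

text \<open>Beyond \<open>2\<alpha>\<close> the cumulant of full order dominates all other terms of the moment.\<close>

lemma logm_jump_limit:
  assumes \<mu>: "\<mu> \<noteq> null_measure borel" and m: "m > \<alpha>"
  shows "((\<lambda>t. logm t (real (2 * m)) / ln t) \<longlongrightarrow> real (2 * m) - real \<alpha>) at_top"
proof -
  let ?f = "\<lambda>t. moment_of_cumulants (\<lambda>k. cumul k t) (2 * m)" and ?\<tau> = "real (2 * m) - real \<alpha>"
  have E: "max (real (2 * m) / 2) ?\<tau> = ?\<tau>" using m by simp
  have "((\<lambda>t. ln (?f t) / ln t) \<longlongrightarrow> ?\<tau>) at_top"
  proof (rule log_ratio_limit)
    fix e :: real assume e: "e > 0"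
    obtain B where "\<And>t. t \<ge> 1 \<Longrightarrow> \<bar>?f t\<bar> \<le> B * t powr (?\<tau> + e)"
      using general_upper[of "2 * m"] e unfolding E power_bounded_def by blast
    then show "\<exists>B. \<forall>\<^sub>F t in at_top. ?f t \<le> B * t powr (?\<tau> + e)"
      by (intro exI[of _ B] eventually_at_top_linorderI[of 1]) (blast intro: order_trans[OF abs_ge_self])
    \<comment> \<open>With this cap the exponent \<open>?\<tau> - 1 + e'\<close> of the remainder
      stays below \<open>?\<tau> - e'\<close> by at least 1 / 2.\<close>
    define e' where "e' = min e (1 / 4)"
    have e': "e' > 0" "e' \<le> e" "e' \<le> 1 / 4" using e by (auto simp: e'_def)
    have "power_bounded (\<lambda>t. ?f t - cumul (2 * m) t) (?\<tau> - 1)"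
    proof (rule power_bounded_moment_minus_cumulant[where d = "\<lambda>k. max 1 (real k - real \<alpha>)" and c = cumul
          and E = "\<lambda>n. max (real n / 2) (real n - real \<alpha>)"])
      \<comment> \<open>All four combinations of the maxima fall short of \<open>?\<tau>\<close> by
        at least one: 1 + j / 2 because k + j \<ge> 2 \<alpha> + 2 and \<open>k \<ge> 2\<close>, the
        two mixed ones because \<open>k\<close> and \<open>j\<close> are at least 2, and the last
        because \<alpha> is subtracted twice.\<close>
      fix k j :: nat assume kj: "k \<ge> 2" "j \<ge> 2" "k + j = 2 * m"
      then have r: "real (2 * m) = real k + real j" by (metis of_nat_add)
      have "2 * real \<alpha> + 2 \<le> real k + real j" using m unfolding r[symmetric] by linarith
      moreover have "real \<alpha> \<ge> 2" using reg.alpha by simp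
      moreover have "real k \<ge> 2" "real j \<ge> 2" using kj by simp_all
      ultimately show "max 1 (real k - real \<alpha>) + max (real j / 2) (real j - real \<alpha>) \<le> real (2 * m) - real \<alpha> - 1"
        unfolding r by (auto simp: max_def)
    qed (use cumul_bounded exponent_superadditive m in \<open>auto simp: cumul_1[simplified]\<close>)
    then obtain B where B: "\<And>t. t \<ge> 1 \<Longrightarrow> \<bar>?f t - cumul (2 * m) t\<bar> \<le> B * t powr (?\<tau> - 1 + e')"
      using e' unfolding power_bounded_def by blast
    obtain c0 where c0: "c0 > 0" "\<forall>\<^sub>F t in at_top. c0 * t powr (?\<tau> - e') \<le> reg.J (2 * m) t"
      using reg.J_lower[of "2 * m" e'] e' m by auto
    define q where "q = cx.levy_cumulant (2 * m)"
    have q: "q > 0" unfolding q_def using m reg.alpha by (intro even_moment_mu_pos \<mu>) simp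
    define c where "c = q * c0"
    have c: "c > 0" using q c0 by (simp add: c_def)
    have "((\<lambda>t::real. \<bar>B\<bar> * t powr (- (1 / 2))) \<longlongrightarrow> \<bar>B\<bar> * 0) at_top"
      by (intro tendsto_intros) real_asymp
    then have "\<forall>\<^sub>F t in at_top. \<bar>B\<bar> * t powr (- (1 / 2)) < c / 2"
      using c by (intro order_tendstoD(2)) auto
    then have "\<forall>\<^sub>F t in at_top. c / 2 * t powr (?\<tau> - e) \<le> ?f t"
      using c0(2) eventually_ge_at_top[of 1]
    proof eventually_elim
      case (elim t)
      have t: "t > 0" using elim by simp
      have "B * t powr (?\<tau> - 1 + e') \<le> \<bar>B\<bar> * t powr (?\<tau> - e' + - (1 / 2))"
        using elim e' by (intro mult_mono powr_mono) auto
      also have "\<dots> = (\<bar>B\<bar> * t powr (- (1 / 2))) * t powr (?\<tau> - e')"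
        unfolding powr_add by simp
      also have "\<dots> \<le> c / 2 * t powr (?\<tau> - e')" using elim(1) by (intro mult_right_mono) auto
      finally have 1: "B * t powr (?\<tau> - 1 + e') \<le> c / 2 * t powr (?\<tau> - e')" .
      have 2: "c * t powr (?\<tau> - e') \<le> cumul (2 * m) t"
        using elim(2) q by (simp add: c_def cumul_def q_def[symmetric] mult.assoc)
      have "c / 2 * t powr (?\<tau> - e) \<le> c / 2 * t powr (?\<tau> - e')"
        using elim e' c by (intro mult_left_mono powr_mono) auto
      also have "\<dots> \<le> ?f t" using 1 2 B[OF elim(3)] by (simp add: abs_le_iff)
      finally show ?case .
    qed
    then show "\<exists>c>0. \<forall>\<^sub>F t in at_top. c * t powr (?\<tau> - e) \<le> ?f t"
      using c by (intro exI[of _ "c / 2"]) simp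
  qed
  moreover have "\<forall>\<^sub>F t in at_top. ln (?f t) / ln t = logm t (real (2 * m)) / ln t"
    using eventually_ge_at_top[of 0] by eventually_elim (use m in \<open>simp add: logm_even del: of_nat_mult\<close>)
  ultimately show ?thesis by (rule Lim_transform_eventually)
qed

section \<open>Interpolation between even orders, and the Gaussian case\<close>

lemma logm_0_limit: "((\<lambda>t. logm t 0 / ln t) \<longlongrightarrow> 0) at_top"
  by (simp add: logm_def)

text \<open>All even orders lie on the line q / 2, so besides 0 and 2 any even order beyond
  \<open>q\<close> can be the third point.\<close>

lemma scaling_gaussian:
  assumes \<mu>: "\<mu> = null_measure borel" and q: "q > 0"
  shows "has_scaling_exponent M (integrated_process X) q (q / 2)"
proof -
  obtain m0 :: nat where m0: "q \<le> real m0" using real_arch_simple by blast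
  define m where "m = m0 + 2"
  have mpos: "m > 0" by (simp add: m_def)
  have "((\<lambda>t. logm t q / ln t) \<longlongrightarrow> 0 + 1 / 2 * q) at_top"
  proof (rule convex_interpolation_limit[OF log_moments_convex, of 0 2 "real (2 * m)"])
    show "((\<lambda>t. logm t (real (2 * m)) / ln t) \<longlongrightarrow> 0 + 1 / 2 * real (2 * m)) at_top"
      using logm_linear_limit[of m] gaussian_upper[OF \<mu>, of "2 * m"] mpos by simp
  qed (use q m0 logm_0_limit logm_2_limit in \<open>auto simp: m_def\<close>)
  then show ?thesis using q by (simp add: scaling_iff)
qed

text \<open>Interpolates through the orders 0, 2 and 2 \<alpha>, which are distinct because \<alpha>
  > 1.\<close>

lemma scaling_small:
  assumes q: "0 < q" "q \<le> 2 * real \<alpha>"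
  shows "has_scaling_exponent M (integrated_process X) q (q / 2)"
proof -
  have "((\<lambda>t. logm t q / ln t) \<longlongrightarrow> 0 + 1 / 2 * q) at_top"
  proof (rule convex_interpolation_limit[OF log_moments_convex, of 0 2 "real (2 * \<alpha>)"])
    show "((\<lambda>t. logm t (real (2 * \<alpha>)) / ln t) \<longlongrightarrow> 0 + 1 / 2 * real (2 * \<alpha>)) at_top"
      using logm_linear_limit[of \<alpha>] general_upper[of "2 * \<alpha>"] reg.alpha by simp
  qed (use q reg.alpha logm_0_limit logm_2_limit in auto)
  then show ?thesis using q by (simp add: scaling_iff)
qed

text \<open>The lines q / 2 and q - \<alpha> meet at 2 \<alpha>, so this order is an endpoint here
  too; 2 \<alpha> + 2 is the middle point, and \<open>2 * m\<close> lies beyond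
  \<open>q\<close>.\<close>

lemma scaling_large:
  assumes \<mu>: "\<mu> \<noteq> null_measure borel" and q: "q \<ge> 2 * real \<alpha>"
  shows "has_scaling_exponent M (integrated_process X) q (q - real \<alpha>)"
proof -
  obtain m0 :: nat where m0: "q \<le> real m0" using real_arch_simple by blast
  define m where "m = \<alpha> + 2 + m0"
  have q0: "q > 0" using q reg.alpha by linarith
  have "((\<lambda>t. logm t q / ln t) \<longlongrightarrow> - real \<alpha> + 1 * q) at_top"
  proof (rule convex_interpolation_limit[OF log_moments_convex, of "real (2 * \<alpha>)" "real (2 * (\<alpha> + 1))" "real (2 * m)"])
    show "((\<lambda>t. logm t (real (2 * \<alpha>)) / ln t) \<longlongrightarrow> - real \<alpha> + 1 * real (2 * \<alpha>)) at_top"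
      using logm_linear_limit[of \<alpha>] general_upper[of "2 * \<alpha>"] reg.alpha by simp
    show "((\<lambda>t. logm t (real (2 * (\<alpha> + 1))) / ln t) \<longlongrightarrow> - real \<alpha> + 1 * real (2 * (\<alpha> + 1))) at_top"
      using logm_jump_limit[OF \<mu>, of "\<alpha> + 1"] by simp
    show "((\<lambda>t. logm t (real (2 * m)) / ln t) \<longlongrightarrow> - real \<alpha> + 1 * real (2 * m)) at_top"
      using logm_jump_limit[OF \<mu>, of m] by (simp add: m_def)
  qed (use q m0 in \<open>auto simp: m_def\<close>)
  then show ?thesis using q0 by (simp add: scaling_iff)
qed

end

text \<open>Without jumps \<kappa> is quadratic, so a finite linear combination has a Gaussian
  characteristic function with variance \<open>b\<close> times the squared norm of its kernel. If
  this variance is zero, the combination vanishes almost surely.\<close>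

lemma (in supOU_setting) gaussian_process_integrated:
  assumes \<mu>: "\<mu> = null_measure borel"
  shows "gaussian_process M {0..} (integrated_process X)"
  unfolding gaussian_process_def
proof (intro allI impI)
  fix J :: "real set" and c :: "real \<Rightarrow> real"
  assume J: "finite J" "J \<subseteq> {0..}"
  define Z where "Z \<omega> = (\<Sum>t\<in>J. c t * integrated_process X t \<omega>)" for \<omega>
  define F where "F x = (\<Sum>t\<in>J. c t * ou_kernel t x)" for x
  have Z [measurable]: "Z \<in> borel_measurable M" unfolding Z_def[abs_def] by measurable
  have F [measurable]: "F \<in> borel_measurable ou.C" unfolding F_def[abs_def] by measurable
  have F2: "integrable ou.C (\<lambda>x. (F x)\<^sup>2)" unfolding F_def by (rule combination_L2[OF J])
  have ch: "char (distr M borel Z) \<zeta> = exp (CLINT x|ou.C. \<kappa> (\<zeta> * F x))" for \<zeta>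
    unfolding Z_def[abs_def] F_def by (rule char_integrated_combination[OF J])
  define v where "v = (\<integral>x. (F x)\<^sup>2 \<partial>ou.C)"
  have v: "v \<ge> 0" unfolding v_def by (intro integral_nonneg_AE) auto
  have k: "\<kappa> \<zeta> = - of_real (b * \<zeta>\<^sup>2 / 2)" for \<zeta>
    unfolding sq.exponent_eq by (simp add: levy_mean_0) (simp add: \<mu>)
  have ch2: "char (distr M borel Z) \<zeta> = of_real (exp (- (b * v * \<zeta>\<^sup>2) / 2))" for \<zeta>
  proof -
    have "(CLINT x|ou.C. \<kappa> (\<zeta> * F x)) = (CLINT x|ou.C. of_real (- (b * \<zeta>\<^sup>2 / 2) * (F x)\<^sup>2))"
      unfolding k by (intro Bochner_Integration.integral_cong refl) (simp add: power_mult_distrib)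
    also have "\<dots> = of_real (- (b * \<zeta>\<^sup>2 / 2) * v)"
      unfolding integral_complex_of_real v_def by simp
    finally show ?thesis
      unfolding ch by (simp add: exp_of_real[symmetric] mult_ac)
  qed
  have "gaussian_variable M Z"
  proof (cases "b * v = 0")
    case True
    have "sq.levy_var = b" by (simp add: sq.levy_var_def) (simp add: \<mu>)
    then have "moment_const * v = 0" using True by (auto simp: moment_const_def)
    with second_moment_of_char[OF Z F F2 ch] have "(\<integral>\<^sup>+\<omega>. ennreal ((Z \<omega>)\<^sup>2) \<partial>M) = 0"
      unfolding v_def by (simp del: mult_eq_0_iff)
    then have "AE \<omega> in M. ennreal ((Z \<omega>)\<^sup>2) = 0" by (subst (asm) nn_integral_0_iff_AE) auto
    then have "AE \<omega> in M. Z \<omega> = 0" by eventually_elim (simp add: ennreal_eq_0_iff)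
    then show ?thesis unfolding gaussian_variable_def by auto
  next
    case False
    define \<sigma> where "\<sigma> = sqrt (b * v)"
    have \<sigma>: "\<sigma> > 0" "\<sigma>\<^sup>2 = b * v"
      using False v lx.gauss_nonneg by (simp_all add: \<sigma>_def order.not_eq_order_implies_strict)
    \<comment> \<open>Uniqueness of characteristic functions is applied to the standardised
      variable, since the characteristic function of the standard normal law is at hand.\<close>
    define W where "W \<omega> = Z \<omega> / \<sigma>" for \<omega>
    have W [measurable]: "W \<in> borel_measurable M" unfolding W_def[abs_def] by measurable
    have "char (distr M borel W) = char std_normal_distribution"
    proof
      fix \<zeta>
      have "char (distr M borel W) \<zeta> = char (distr M borel Z) (\<zeta> / \<sigma>)"
        by (simp add: char_def integral_distr W_def mult_ac)
      also have "\<dots> = of_real (exp (- (\<zeta>\<^sup>2) / 2))"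
        unfolding ch2 \<sigma>(2)[symmetric] using \<sigma>(1) by (simp add: power_divide)
      finally show "char (distr M borel W) \<zeta> = char std_normal_distribution \<zeta>"
        by (simp add: char_std_normal_distribution)
    qed
    then have eq: "distr M borel W = std_normal_distribution"
      by (intro Levy_uniqueness real_distribution_distr real_dist_normal_dist) auto
    have "distributed M lborel W std_normal_density"
      unfolding distributed_def
    proof (intro conjI)
      have "distr M lborel W = distr M borel W" by (rule distr_cong) auto
      then show "distr M lborel W = density lborel std_normal_density" by (simp add: eq)
    qed auto
    then have "distributed M lborel (\<lambda>\<omega>. 0 + \<sigma> * W \<omega>) (normal_density (0 + \<sigma> * 0) (\<bar>\<sigma>\<bar> * 1))"
      using \<sigma>(1) by (intro normal_density_affine) auto
    moreover have "(\<lambda>\<omega>. 0 + \<sigma> * W \<omega>) = Z" using \<sigma>(1) by (simp add: W_def fun_eq_iff)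
    ultimately have "distributed M lborel Z (normal_density 0 \<sigma>)" using \<sigma>(1) by simp
    then show ?thesis unfolding gaussian_variable_def using Z \<sigma>(1) by blast
  qed
  then show "gaussian_variable M (\<lambda>\<omega>. \<Sum>t\<in>J. c t * integrated_process X t \<omega>)"
    by (simp add: Z_def[abs_def])
qed

theorem theorem4p4:
  fixes M :: "'w measure"
    and X :: "real \<Rightarrow> 'w \<Rightarrow> real"
    and a b :: real
    and \<mu> \<pi> :: "real measure"
    and \<kappa>X :: "real \<Rightarrow> complex"
    and l :: "real \<Rightarrow> real"
    and \<alpha> :: nat
  assumes "prob_space M"
    and "supOU_process M a b \<mu> \<pi> X"
    and "(\<lambda>(t, \<omega>). X t \<omega>) \<in> borel_measurable (borel \<Otimes>\<^sub>M M)"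
    and "\<And>t. integrable M (\<lambda>\<omega>. (X t \<omega>)\<^sup>2)"
    and "\<And>t. prob_space.expectation M (X t) = 0"
    and "\<And>t. prob_space.variance M (X t) \<noteq> 0"
    and "is_cumulant_function M (X 1) \<kappa>X"
    and "analytic_near_zero \<kappa>X"
    and "\<alpha> > 1"
    and "slowly_varying l"
    and "(\<lambda>x. measure \<pi> {0<..x}) \<sim>[at_right 0] (\<lambda>x. l (1 / x) * x ^ \<alpha>)"
  shows "(\<mu> \<noteq> null_measure borel \<longrightarrow>
            (\<forall>q. 0 < q \<and> q \<le> 2 * real \<alpha> \<longrightarrow>
               has_scaling_exponent M (integrated_process X) q (q / 2)) \<and>
            (\<forall>q. q \<ge> 2 * real \<alpha> \<longrightarrow>
               has_scaling_exponent M (integrated_process X) q (q - real \<alpha>))) \<and>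
         (\<mu> = null_measure borel \<longrightarrow>
            gaussian_process M {0..} (integrated_process X) \<and>
            (\<forall>q>0. has_scaling_exponent M (integrated_process X) q (q / 2)))"
proof -
  from assms(2) obtain \<Lambda> where triplet: "levy_triplet a b \<mu>" and "prob_space \<pi>"
    and sets: "sets \<pi> = sets (restrict_space borel {0<..})"
    and basis: "levy_basis M (\<pi> \<Otimes>\<^sub>M lborel) (levy_khintchine a b \<mu>) \<Lambda>"
    and int: "\<And>t. has_stoch_integral M (\<pi> \<Otimes>\<^sub>M lborel) \<Lambda> (supOU_kernel t) (X t)"
    unfolding supOU_process_def by blast
  interpret M: prob_space M by fact
  interpret pi: prob_space \<pi> by fact
  interpret ou: ou_measure \<pi> by unfold_locales fact
  interpret lx: levy_exponent a b \<mu> by unfold_locales fact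
  \<comment> \<open>A set of measure one: the cumulant function of \<open>\<Lambda> A\<close> is
    then the Levy-Khintchine function itself, which yields its continuity.\<close>
  define A where "A = space \<pi> \<times> {0..1::real}"
  have em: "emeasure (\<pi> \<Otimes>\<^sub>M lborel) A = 1"
    unfolding A_def by (subst lborel.emeasure_pair_measure_Times) (auto simp: pi.emeasure_space_1)
  have "A \<in> sets (\<pi> \<Otimes>\<^sub>M lborel)" unfolding A_def by measurable
  then have A: "A \<in> fmeasurable (\<pi> \<Otimes>\<^sub>M lborel)" using em by (intro fmeasurableI) auto
  have mA: "measure (\<pi> \<Otimes>\<^sub>M lborel) A = 1" by (simp add: measure_def em)
  have cont: "continuous_on UNIV (levy_khintchine a b \<mu>)"
    using basis A unfolding levy_basis_def is_cumulant_function_def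
    by (auto dest!: bspec[where x = A] simp: mA)
  interpret supOU_asymptotics M \<pi> a b \<mu> \<Lambda> X l \<alpha> \<kappa>X
    by unfold_locales (use basis cont lx.exponent_0 int assms in auto)
  show ?thesis
    using scaling_small scaling_large scaling_gaussian gaussian_process_integrated by blast
qed

end
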